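(* Let $\alpha=1/2$, $\theta>-1/2$, let $S$ be a locally compact, separable metric space, and $\nu_0$ a diffuse probability measure on $S$. Let $(\Xi,D(\Xi))$ be the relaxation on $L^2(\mathcal{P}_1(S);\Pi_{\alpha,\theta,\nu_0})$ of the bilinear form $(\mathcal{E},\mathcal{F})$ and let $(\mathcal{E},\mathcal{F}_k)$, $k\in\mathbb{N}$, be its projection forms (all defined in the context). Then the sequence of bilinear forms $(\mathcal{E},\mathcal{F}_k)$ converges to $(\Xi,D(\Xi))$ in the sense of Mosco convergence as $k\to\infty$.
   Context: $\mathcal{P}_1(S)$ is the space of Borel probability measures on $S$; $B_b(S)$ the bounded Borel functions on $S$; $\langle\phi,\mu\rangle=\int\phi\,d\mu$. Diffuse means $\nu_0(\{x\})=0$ for all $x\in S$. Write $L^2=L^2(\mathcal{P}_1(S);\Pi_{\alpha,\theta,\nu_0})$. Two-parameter Dirichlet process: for $0\le\alpha<1$, $\theta>-\alpha$, let $U_k$, $k\ge1$, be independent with $U_k\sim \mathrm{Beta}(1-\alpha,\theta+k\alpha)$, and set $V_1=U_1$, $V_n=(1-U_1)\cdots(1-U_{n-1})U_n$ for $n\ge2$. Let $(P_1,P_2,\dots)$ be $(V_1,V_2,\dots)$ in descending order, and let $\xi_1,\xi_2,\dots$ be i.i.d. with law $\nu_0$, independent of $(U_k)$. Then $\Pi_{\alpha,\theta,\nu_0}$ is the law of $\sum_{k\ge1}P_k\delta_{\xi_k}$. Form: $\mathcal{F}=\{F(\mu)=f(\langle\phi_1,\mu\rangle,\dots,\langle\phi_d,\mu\rangle):\phi_i\in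 B_b(S),\ 1\le i\le d,\ f\in C^\infty(\mathbb{R}^d),\ d\ge1\}$; for such $F$, $\nabla F(\mu)$ is the function $x\mapsto\sum_{i=1}^d\partial_if(\langle\phi_1,\mu\rangle,\dots,\langle\phi_d,\mu\rangle)\phi_i(x)$; $\langle\phi,\psi\rangle_\mu=\int\phi\psi\,d\mu-(\int\phi\,d\mu)(\int\psi\,d\mu)$; and $\mathcal{E}(F,G)=\frac12\int_{\mathcal{P}_1(S)}\langle\nabla F(\mu),\nabla G(\mu)\rangle_\mu\,\Pi_{\alpha,\theta,\nu_0}(d\mu)$ for $F,G\in\mathcal{F}$. Relaxation: $(\Xi,D(\Xi))$ is the greatest lower semicontinuous (closed) symmetric bilinear form on $L^2$ that is a minorant of $(\mathcal{E},\mathcal{F})$, i.e. $\mathcal{F}\subset D(\Xi)$ and $\Xi(F,F)\le\mathcal{E}(F,F)$ for $F\in\mathcal{F}$. For $F\in D(\Xi)$, $\Xi(F,F)=\min\{\liminf_{n\to\infty}\mathcal{E}(F_n,F_n): F_n\in\mathcal{F},\ F_n\to F\text{ in }L^2\}$. It is known to be a Dirichlet form on $L^2$. Projection forms: fix a sequence of partitions $(B^k_1,\dots,B^k_{2^k})$ of $S$ (into Borel sets), $k\in\mathbb{N}$, with $\nu_0(B^k_j)=2^{-k}$ and $B^k_j=B^{k+1}_{2j-1}\cup B^{k+1}_{2j}$ for $1\le j\le2^k$, $k\in\mathbb{N}$. Let $\mathcal{F}_k=\{F(\mu)=f(\langle1_{B^k_1},\mu\rangle,\dots,\langle1_{B^k_{2^k-1}},\mu\rangle):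 f\in C^\infty(\mathbb{R}^{2^k-1})\}$. Each $(\mathcal{E},\mathcal{F}_k)$ is closable on $L^2$. Mosco convergence: extend each quadratic form to $L^2$ by the value $+\infty$ outside its domain. Forms $\mathcal{E}_k$ (here $\mathcal{E}_k=(\mathcal{E},\mathcal{F}_k)$) Mosco-converge to $\Xi$ if (a) whenever $F_k\to F$ weakly in $L^2$, $\liminf_{k\to\infty}\mathcal{E}_k(F_k,F_k)\ge\Xi(F,F)$; and (b) for every $F\in L^2$ there are $F_k\to F$ strongly in $L^2$ with $\limsup_{k\to\infty}\mathcal{E}_k(F_k,F_k)\le\Xi(F,F)$.
   Formalization: The partition sets B^k_j are additionally assumed to generate the Borel sets of S up to ν_0-null sets; without this the claim fails, e.g. for S=[0,1]^2 with Lebesgue measure and dyadic strips, where the F_k see only the first marginal of μ. *)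

theory Defs
  imports "HOL-Probability.Probability"
begin

section \<open>The two-parameter Dirichlet process\<close>

definition beta_distribution :: "real \<Rightarrow> real \<Rightarrow> real measure" where
  "beta_distribution a b = density lborel
     (\<lambda>x. ennreal (indicator {0<..<1} x * (x powr (a - 1) * (1 - x) powr (b - 1) / Beta a b)))"

text \<open>Indices start at \<open>0\<close>: \<open>u n\<close> is \<open>U\<^sub>n\<^sub>+\<^sub>1\<close>.\<close>

definition stick_breaking :: "(nat \<Rightarrow> real) \<Rightarrow> nat \<Rightarrow> real" where
  "stick_breaking u n = (\<Prod>i<n. 1 - u i) * u n"

text \<open>Meaningful (exactly one such \<open>p\<close>) for strictly positive sequences tending to \<open>0\<close>.\<close>

definition descending :: "(nat \<Rightarrow> real) \<Rightarrow> nat \<Rightarrow> real" where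
  "descending v = (THE p. decseq p \<and> (\<exists>\<sigma>. bij \<sigma> \<and> p = v \<circ> \<sigma>))"

text \<open>The image of the measure with weights \<open>p k\<close> on the index set under \<open>x\<close>, that is,
  the sum over \<open>k\<close> of \<open>p k\<close> times the unit mass at \<open>x k\<close>.\<close>

definition atomic_measure :: "(nat \<Rightarrow> real) \<Rightarrow> (nat \<Rightarrow> 'a::topological_space) \<Rightarrow> 'a measure" where
  "atomic_measure p x = distr (density (count_space UNIV) (\<lambda>k. ennreal (p k))) borel x"

text \<open>
  The space of Borel probability measures is \<open>prob_algebra borel\<close>; its \<open>\<sigma>\<close>-algebra is generated by
  the evaluations at Borel sets, which on a separable metric space is the Borel \<open>\<sigma>\<close>-algebra of the
  weak topology.  Almost surely all stick-breaking weights are positive and sum to \<open>1\<close>.  On the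
  exceptional null set the random measure is set to \<open>\<nu>\<close>, only so that the map takes values in
  \<open>prob_algebra borel\<close> everywhere; the law is not affected.
\<close>

definition dirichlet_process ::
    "real \<Rightarrow> real \<Rightarrow> 'a::topological_space measure \<Rightarrow> 'a measure measure" where
  "dirichlet_process \<alpha> \<theta> \<nu> =
     distr ((\<Pi>\<^sub>M k\<in>UNIV. beta_distribution (1 - \<alpha>) (\<theta> + real (Suc k) * \<alpha>)) \<Otimes>\<^sub>M
            (\<Pi>\<^sub>M k\<in>(UNIV :: nat set). \<nu>))
       (prob_algebra borel)
       (\<lambda>(u, \<xi>).
          if (\<forall>n. 0 < stick_breaking u n) \<and> stick_breaking u sums 1
          then atomic_measure (descending (stick_breaking u)) \<xi>
          else \<nu>)"

section \<open>Smooth functions of finitely many real variables\<close>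

text \<open>
  Since the number \<open>d\<close> of variables varies, a function on \<open>d\<close>-dimensional space is represented
  by a function on \<open>nat \<Rightarrow> real\<close> (with the product topology) that depends only on the coordinates
  below \<open>d\<close>.  It is smooth if its iterated partial derivatives of all orders exist and are
  continuous.
\<close>

definition pderivative :: "nat \<Rightarrow> ((nat \<Rightarrow> real) \<Rightarrow> real) \<Rightarrow> (nat \<Rightarrow> real) \<Rightarrow> real" where
  "pderivative i f x = deriv (\<lambda>t. f (x(i := t))) (x i)"

definition C_infinity :: "nat \<Rightarrow> ((nat \<Rightarrow> real) \<Rightarrow> real) set" where
  "C_infinity d = {f.
     (\<forall>x y. (\<forall>i<d. x i = y i) \<longrightarrow> f x = f y) \<and>
     (\<forall>is \<in> lists {..<d}.
        continuous_on UNIV (foldr pderivative is f) \<and>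
        (\<forall>i<d. \<forall>x. (\<lambda>t. foldr pderivative is f (x(i := t))) differentiable (at (x i))))}"

section \<open>The bilinear form and its projections\<close>

definition cyl_fun :: "(nat \<Rightarrow> 'a \<Rightarrow> real) \<Rightarrow> ((nat \<Rightarrow> real) \<Rightarrow> real) \<Rightarrow> 'a measure \<Rightarrow> real" where
  "cyl_fun \<phi> f \<mu> = f (\<lambda>i. \<integral>x. \<phi> i x \<partial>\<mu>)"

definition cyl_grad ::
    "nat \<Rightarrow> (nat \<Rightarrow> 'a \<Rightarrow> real) \<Rightarrow> ((nat \<Rightarrow> real) \<Rightarrow> real) \<Rightarrow> 'a measure \<Rightarrow> 'a \<Rightarrow> real" where
  "cyl_grad d \<phi> f \<mu> x = (\<Sum>i<d. pderivative i f (\<lambda>j. \<integral>y. \<phi> j y \<partial>\<mu>) * \<phi> i x)"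

text \<open>
  The domain of the form, given as the graph of the gradient: the set of pairs of a cylinder
  function and its gradient.  Different representations of the same function on probability
  measures can have gradients that differ by a function of \<open>\<mu>\<close> alone, which the bracket
  \<open>cov_form\<close> annihilates; the form therefore depends on the functions only.
\<close>

definition smooth_cyl ::
    "(('a::topological_space measure \<Rightarrow> real) \<times> ('a measure \<Rightarrow> 'a \<Rightarrow> real)) set" where
  "smooth_cyl = {(cyl_fun \<phi> f, cyl_grad d \<phi> f) | d \<phi> f.
     1 \<le> d \<and> (\<forall>i<d. \<phi> i \<in> borel_measurable borel \<and> bounded (range (\<phi> i))) \<and> f \<in> C_infinity d}"

definition proj_cyl :: "(nat \<Rightarrow> nat \<Rightarrow> 'a set) \<Rightarrow> nat \<Rightarrow>
    (('a measure \<Rightarrow> real) \<times> ('a measure \<Rightarrow> 'a \<Rightarrow> real)) set" where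
  "proj_cyl B k =
     {(cyl_fun (\<lambda>i. indicator (B k (Suc i))) f, cyl_grad (2 ^ k - 1) (\<lambda>i. indicator (B k (Suc i))) f)
      | f. f \<in> C_infinity (2 ^ k - 1)}"

definition cov_form :: "'a measure \<Rightarrow> ('a \<Rightarrow> real) \<Rightarrow> ('a \<Rightarrow> real) \<Rightarrow> real" where
  "cov_form \<mu> \<phi> \<psi> = (\<integral>x. \<phi> x * \<psi> x \<partial>\<mu>) - (\<integral>x. \<phi> x \<partial>\<mu>) * (\<integral>x. \<psi> x \<partial>\<mu>)"

text \<open>The value \<open>\<E>(F, G)\<close> for functions with gradients \<open>DF\<close> and \<open>DG\<close>.\<close>

definition energy :: "'a measure measure \<Rightarrow>
    ('a measure \<Rightarrow> 'a \<Rightarrow> real) \<Rightarrow> ('a measure \<Rightarrow> 'a \<Rightarrow> real) \<Rightarrow> real" where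
  "energy P DF DG = 1 / 2 * (\<integral>\<mu>. cov_form \<mu> (DF \<mu>) (DG \<mu>) \<partial>P)"

definition dyadic_partitions :: "'a::topological_space measure \<Rightarrow> (nat \<Rightarrow> nat \<Rightarrow> 'a set) \<Rightarrow> bool" where
  "dyadic_partitions \<nu> B \<longleftrightarrow>
     (\<forall>k\<ge>1. disjoint_family_on (B k) {1..2 ^ k} \<and> (\<Union>j\<in>{1..2 ^ k}. B k j) = UNIV) \<and>
     (\<forall>k\<ge>1. \<forall>j\<in>{1..2 ^ k}. B k j \<in> sets borel \<and> measure \<nu> (B k j) = 1 / 2 ^ k \<and>
        B k j = B (Suc k) (2 * j - 1) \<union> B (Suc k) (2 * j))"

section \<open>Quadratic forms on \<open>L\<^sup>2\<close>\<close>

text \<open>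
  Elements of \<open>L\<^sup>2\<close> are represented by square-integrable functions; domains and forms are
  required to be invariant under almost-everywhere equality.
\<close>

definition L2_space :: "'b measure \<Rightarrow> ('b \<Rightarrow> real) set" where
  "L2_space M = {F \<in> borel_measurable M. integrable M (\<lambda>x. (F x)\<^sup>2)}"

definition L2_converges :: "'b measure \<Rightarrow> (nat \<Rightarrow> 'b \<Rightarrow> real) \<Rightarrow> ('b \<Rightarrow> real) \<Rightarrow> bool" where
  "L2_converges M u F \<longleftrightarrow> (\<lambda>n. \<integral>x. (u n x - F x)\<^sup>2 \<partial>M) \<longlonglongrightarrow> 0"

definition L2_converges_weakly :: "'b measure \<Rightarrow> (nat \<Rightarrow> 'b \<Rightarrow> real) \<Rightarrow> ('b \<Rightarrow> real) \<Rightarrow> bool" where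
  "L2_converges_weakly M u F \<longleftrightarrow>
     (\<forall>G \<in> L2_space M. (\<lambda>n. \<integral>x. u n x * G x \<partial>M) \<longlonglongrightarrow> (\<integral>x. F x * G x \<partial>M))"

definition extended_form ::
    "('b \<Rightarrow> real) set \<Rightarrow> (('b \<Rightarrow> real) \<Rightarrow> ('b \<Rightarrow> real) \<Rightarrow> real) \<Rightarrow> ('b \<Rightarrow> real) \<Rightarrow> ereal" where
  "extended_form D Q F = (if F \<in> D then ereal (Q F F) else \<infinity>)"

definition symmetric_form ::
    "'b measure \<Rightarrow> ('b \<Rightarrow> real) set \<Rightarrow> (('b \<Rightarrow> real) \<Rightarrow> ('b \<Rightarrow> real) \<Rightarrow> real) \<Rightarrow> bool" where
  "symmetric_form M D Q \<longleftrightarrow>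
     D \<subseteq> L2_space M \<and>
     (\<lambda>x. 0) \<in> D \<and>
     (\<forall>F\<in>D. \<forall>G\<in>D. (\<lambda>x. F x + G x) \<in> D) \<and>
     (\<forall>c. \<forall>F\<in>D. (\<lambda>x. c * F x) \<in> D) \<and>
     (\<forall>F\<in>D. \<forall>G\<in>borel_measurable M. (AE x in M. F x = G x) \<longrightarrow> G \<in> D \<and> (\<forall>H\<in>D. Q F H = Q G H)) \<and>
     (\<forall>F\<in>D. \<forall>G\<in>D. Q F G = Q G F) \<and>
     (\<forall>F\<in>D. \<forall>G\<in>D. \<forall>H\<in>D. Q (\<lambda>x. F x + G x) H = Q F H + Q G H) \<and>
     (\<forall>c. \<forall>F\<in>D. \<forall>H\<in>D. Q (\<lambda>x. c * F x) H = c * Q F H) \<and>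
     (\<forall>F\<in>D. 0 \<le> Q F F)"

definition lower_semicontinuous_form ::
    "'b measure \<Rightarrow> ('b \<Rightarrow> real) set \<Rightarrow> (('b \<Rightarrow> real) \<Rightarrow> ('b \<Rightarrow> real) \<Rightarrow> real) \<Rightarrow> bool" where
  "lower_semicontinuous_form M D Q \<longleftrightarrow>
     (\<forall>u F. (\<forall>n. u n \<in> L2_space M) \<longrightarrow> F \<in> L2_space M \<longrightarrow> L2_converges M u F \<longrightarrow>
        extended_form D Q F \<le> liminf (\<lambda>n. extended_form D Q (u n)))"

definition minorant :: "'a::topological_space measure measure \<Rightarrow> ('a measure \<Rightarrow> real) set \<Rightarrow>
    (('a measure \<Rightarrow> real) \<Rightarrow> ('a measure \<Rightarrow> real) \<Rightarrow> real) \<Rightarrow> bool" where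
  "minorant P D Q \<longleftrightarrow> (\<forall>(F, DF) \<in> smooth_cyl. F \<in> D \<and> Q F F \<le> energy P DF DF)"

definition is_relaxation :: "'a::topological_space measure measure \<Rightarrow> ('a measure \<Rightarrow> real) set \<Rightarrow>
    (('a measure \<Rightarrow> real) \<Rightarrow> ('a measure \<Rightarrow> real) \<Rightarrow> real) \<Rightarrow> bool" where
  "is_relaxation P D Q \<longleftrightarrow>
     symmetric_form P D Q \<and> lower_semicontinuous_form P D Q \<and> minorant P D Q \<and>
     (\<forall>D' Q'. symmetric_form P D' Q' \<and> lower_semicontinuous_form P D' Q' \<and> minorant P D' Q' \<longrightarrow>
        D \<subseteq> D' \<and> (\<forall>F\<in>D. Q' F F \<le> Q F F))"

text \<open>
  The form on projection cylinder functions, extended by \<open>\<infinity>\<close>: the infimum runs over the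
  representatives, within the domain, of the \<open>L\<^sup>2\<close>-class of \<open>u\<close>.  It is empty, with value
  \<open>\<infinity>\<close>, outside the domain; inside, closability makes all values in it equal.
\<close>

definition proj_form :: "'a measure measure \<Rightarrow> (nat \<Rightarrow> nat \<Rightarrow> 'a set) \<Rightarrow> nat \<Rightarrow>
    ('a measure \<Rightarrow> real) \<Rightarrow> ereal" where
  "proj_form P B k u =
     Inf {ereal (energy P DF DF) | F DF. (F, DF) \<in> proj_cyl B k \<and> (AE \<mu> in P. F \<mu> = u \<mu>)}"

definition mosco_converges ::
    "'b measure \<Rightarrow> (nat \<Rightarrow> ('b \<Rightarrow> real) \<Rightarrow> ereal) \<Rightarrow> (('b \<Rightarrow> real) \<Rightarrow> ereal) \<Rightarrow> bool" where
  "mosco_converges M q Q \<longleftrightarrow>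
     (\<forall>u F. (\<forall>k. u k \<in> L2_space M) \<longrightarrow> F \<in> L2_space M \<longrightarrow> L2_converges_weakly M u F \<longrightarrow>
        Q F \<le> liminf (\<lambda>k. q k (u k))) \<and>
     (\<forall>F \<in> L2_space M. \<exists>u. (\<forall>k. u k \<in> L2_space M) \<and> L2_converges M u F \<and>
        limsup (\<lambda>k. q k (u k)) \<le> Q F)"

end

theory Submission
  imports Defs
begin

text \<open>
The projection forms decrease with \<open>k\<close>, as forms with value \<open>\<infinity>\<close> outside their domains: a smooth function
of the masses of the cells of generation \<open>k\<close> is a smooth function of the masses of their halves, with
the same gradient. A decreasing sequence of nonnegative quadratic forms converges in the sense of Mosco to the
lower semicontinuous envelope of its pointwise infimum. The theorem therefore says that the relaxation
\<open>\<Xi>\<close> of \<open>\<E>\<close> can be computed from the projection cylinder functions alone.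

For the lower bound, projection cylinder functions are cylinder functions, so \<open>\<Xi>\<close> is below all projection
forms (\<open>relaxation_le_proj_form\<close>). A lower semicontinuous quadratic form has convex and strongly closed
sublevel sets, which in a Hilbert space are weakly closed; so \<open>\<Xi>\<close> is lower semicontinuous also along
weakly convergent sequences (\<open>weakly_lower_semicontinuous\<close>).

For the upper bound, let \<open>R\<close> be the lower semicontinuous envelope of the energy restricted to projection
cylinder functions. It inherits the parallelogram law from the energy, hence comes from a symmetric bilinear form by the
theorem of Jordan and von Neumann (\<open>relaxed_symmetric_form\<close>). It is also a minorant of \<open>\<E>\<close> on
\<^emph>\<open>all\<close> smooth cylinder functions (\<open>smooth_cyl_relaxed_le\<close>): by the maximality of \<open>\<Xi>\<close> then
\<open>R \<le> \<Xi>\<close>. Functions that nearly attain \<open>R\<close> are projection cylinder functions, and repeating each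
of them until the next one lies in the domain gives a recovery sequence (\<open>recovery_sequence\<close>).

The minorant property is where the Dirichlet process enters, through the identity
\<open>\<integral>\<langle>\<phi>,\<mu>\<rangle> \<Pi>(d\<mu>) = \<integral>\<phi> d\<nu>\<close> (\<open>mean_dirichlet_process\<close>). Since the cells generate the Borel sets up to
null sets, the test functions \<open>\<phi>\<^sub>i\<close> are limits in \<open>L\<^sup>1(\<nu>)\<close> of uniformly bounded step functions. By the
identity these converge, along a subsequence, in \<open>L\<^sup>1(\<mu>)\<close> for almost every \<open>\<mu>\<close>. So the functions
\<open>f(\<langle>\<phi>\<^sub>1,\<mu>\<rangle>, \<dots>, \<langle>\<phi>\<^sub>d,\<mu>\<rangle>)\<close> and their gradients converge almost everywhere and boundedly, and dominated convergence
gives convergence in \<open>L\<^sup>2\<close> and of the energies.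
\<close>

section \<open>Square-integrable functions\<close>

definition sqdist :: "'b measure \<Rightarrow> ('b \<Rightarrow> real) \<Rightarrow> ('b \<Rightarrow> real) \<Rightarrow> real" where
  "sqdist M F G = (\<integral>x. (F x - G x)\<^sup>2 \<partial>M)"

lemma L2_converges_iff_sqdist: "L2_converges M u F \<longleftrightarrow> (\<lambda>n. sqdist M (u n) F) \<longlonglongrightarrow> 0"
  by (simp add: L2_converges_def sqdist_def)

lemma sqdist_nonneg: "0 \<le> sqdist M F G"
  by (simp add: sqdist_def)

lemma sqdist_commute: "sqdist M F G = sqdist M G F"
  by (simp add: sqdist_def power2_commute)

lemma sqdist_self [simp]: "sqdist M F F = 0"
  by (simp add: sqdist_def)

lemma L2_measurable: "F \<in> L2_space M \<Longrightarrow> F \<in> borel_measurable M"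
  by (simp add: L2_space_def)

lemma L2_integrable_mult:
  assumes "F \<in> L2_space M" "G \<in> L2_space M"
  shows "integrable M (\<lambda>x. F x * G x)"
proof (rule Bochner_Integration.integrable_bound)
  show "integrable M (\<lambda>x. (F x)\<^sup>2 + (G x)\<^sup>2)"
    using assms by (auto simp: L2_space_def)
  show "(\<lambda>x. F x * G x) \<in> borel_measurable M"
    using assms by (auto simp: L2_space_def)
  have "\<bar>a * b\<bar> \<le> \<bar>a\<^sup>2 + b\<^sup>2\<bar>" for a b :: real
  proof -
    have "0 \<le> (\<bar>a\<bar> - \<bar>b\<bar>)\<^sup>2" by simp
    then have "2 * (\<bar>a\<bar> * \<bar>b\<bar>) \<le> a\<^sup>2 + b\<^sup>2" by (simp add: power2_diff)
    moreover have "0 \<le> \<bar>a\<bar> * \<bar>b\<bar>" by simp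
    ultimately have "\<bar>a\<bar> * \<bar>b\<bar> \<le> a\<^sup>2 + b\<^sup>2" by linarith
    then show ?thesis by (simp add: abs_mult)
  qed
  then show "AE x in M. norm (F x * G x) \<le> norm ((F x)\<^sup>2 + (G x)\<^sup>2)"
    by auto
qed

lemma L2_lincomb:
  assumes "F \<in> L2_space M" "G \<in> L2_space M"
  shows "(\<lambda>x. a * F x + b * G x) \<in> L2_space M"
proof -
  have "integrable M (\<lambda>x. a\<^sup>2 * (F x * F x) + 2 * a * b * (F x * G x) + b\<^sup>2 * (G x * G x))"
    using L2_integrable_mult assms by (intro Bochner_Integration.integrable_add integrable_mult_right) auto
  also have "(\<lambda>x. a\<^sup>2 * (F x * F x) + 2 * a * b * (F x * G x) + b\<^sup>2 * (G x * G x)) =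
      (\<lambda>x. (a * F x + b * G x)\<^sup>2)"
    by (auto simp: power2_eq_square algebra_simps)
  finally show ?thesis
    using assms by (auto simp: L2_space_def)
qed

lemma L2_add: "F \<in> L2_space M \<Longrightarrow> G \<in> L2_space M \<Longrightarrow> (\<lambda>x. F x + G x) \<in> L2_space M"
  using L2_lincomb[of F M G 1 1] by simp

lemma L2_diff: "F \<in> L2_space M \<Longrightarrow> G \<in> L2_space M \<Longrightarrow> (\<lambda>x. F x - G x) \<in> L2_space M"
  using L2_lincomb[of F M G 1 "-1"] by simp

lemma L2_mult: "F \<in> L2_space M \<Longrightarrow> (\<lambda>x. c * F x) \<in> L2_space M"
  using L2_lincomb[of F M F c 0] by simp

lemma L2_zero: "(\<lambda>x. 0) \<in> L2_space M"
  by (simp add: L2_space_def)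

lemma L2_integrable_square: "F \<in> L2_space M \<Longrightarrow> integrable M (\<lambda>x. (F x)\<^sup>2)"
  by (simp add: L2_space_def)

lemma L2_AE_cong:
  assumes "F \<in> L2_space M" "G \<in> borel_measurable M" "AE x in M. F x = G x"
  shows "G \<in> L2_space M"
proof -
  have "integrable M (\<lambda>x. (F x)\<^sup>2) \<longleftrightarrow> integrable M (\<lambda>x. (G x)\<^sup>2)"
    using assms by (intro integrable_cong_AE) (auto simp: L2_space_def)
  then show ?thesis using assms by (auto simp: L2_space_def)
qed

lemma sqdist_cong_AE:
  assumes "AE x in M. F x = F' x" "AE x in M. G x = G' x"
    and [measurable]: "F \<in> borel_measurable M" "F' \<in> borel_measurable M" 
      "G \<in> borel_measurable M" "G' \<in> borel_measurable M"
  shows "sqdist M F G = sqdist M F' G'"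
  unfolding sqdist_def using assms(1,2) by (intro integral_cong_AE) auto

text \<open>
The pointwise estimate \<open>(a + b)\<^sup>2 \<le> (1 + \<eta>) a\<^sup>2 + (1 + 1/\<eta>) b\<^sup>2\<close> replaces the triangle inequality for squared
distances: \<open>\<eta> = 1\<close> suffices for smallness, and \<open>\<eta> \<rightarrow> 0\<close> gives continuity of the distance.
\<close>

lemma sqdist_add_le:
  assumes "F \<in> L2_space M" "G \<in> L2_space M" "F' \<in> L2_space M" "G' \<in> L2_space M" "0 < (\<eta>::real)"
  shows "sqdist M (\<lambda>x. F x + F' x) (\<lambda>x. G x + G' x)
    \<le> (1 + \<eta>) * sqdist M F G + (1 + 1 / \<eta>) * sqdist M F' G'"
proof -
  have pointwise: "(a + b)\<^sup>2 \<le> (1 + \<eta>) * a\<^sup>2 + (1 + 1 / \<eta>) * b\<^sup>2" for a b :: real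
  proof -
    have "0 \<le> (\<eta> * a - b)\<^sup>2 / \<eta>" using \<open>0 < \<eta>\<close> by simp
    also have "\<dots> = \<eta> * a\<^sup>2 - 2 * a * b + b\<^sup>2 / \<eta>"
      using \<open>0 < \<eta>\<close> by (simp add: power2_eq_square field_simps)
    finally show ?thesis by (simp add: power2_sum algebra_simps)
  qed
  have i: "integrable M (\<lambda>x. (F x - G x)\<^sup>2)" "integrable M (\<lambda>x. (F' x - G' x)\<^sup>2)"
    "integrable M (\<lambda>x. (F x + F' x - (G x + G' x))\<^sup>2)"
    using assms by (auto intro!: L2_integrable_square L2_diff L2_add)
  have "sqdist M (\<lambda>x. F x + F' x) (\<lambda>x. G x + G' x)
      \<le> (\<integral>x. (1 + \<eta>) * (F x - G x)\<^sup>2 + (1 + 1 / \<eta>) * (F' x - G' x)\<^sup>2 \<partial>M)"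
    unfolding sqdist_def
    using i pointwise[of "F _ - G _" "F' _ - G' _"]
    by (intro integral_mono Bochner_Integration.integrable_add integrable_mult_right) (auto simp: algebra_simps)
  also have "\<dots> = (1 + \<eta>) * sqdist M F G + (1 + 1 / \<eta>) * sqdist M F' G'"
    unfolding sqdist_def using i
    by (subst Bochner_Integration.integral_add) (auto intro!: integrable_mult_right)
  finally show ?thesis .
qed

lemma sqdist_triangle:
  assumes "F \<in> L2_space M" "G \<in> L2_space M" "H \<in> L2_space M" "0 < (\<eta>::real)"
  shows "sqdist M F H \<le> (1 + \<eta>) * sqdist M F G + (1 + 1 / \<eta>) * sqdist M G H"
proof -
  have "sqdist M F H = sqdist M (\<lambda>x. F x + (G x - H x)) (\<lambda>x. G x + 0)"
    by (simp add: sqdist_def)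
  also have "\<dots> \<le> (1 + \<eta>) * sqdist M F G + (1 + 1 / \<eta>) * sqdist M (\<lambda>x. G x - H x) (\<lambda>x. 0)"
    using assms by (intro sqdist_add_le L2_diff L2_zero)
  finally show ?thesis by (simp add: sqdist_def)
qed

lemma sqdist_mult: "sqdist M (\<lambda>x. c * F x) (\<lambda>x. c * G x) = c\<^sup>2 * sqdist M F G"
proof -
  have "(\<lambda>x. (c * F x - c * G x)\<^sup>2) = (\<lambda>x. c\<^sup>2 * (F x - G x)\<^sup>2)"
    by (simp add: power_mult_distrib flip: right_diff_distrib)
  then show ?thesis by (simp add: sqdist_def)
qed

text \<open>
Either \<open>\<bar>a\<bar> \<le> e\<close> or \<open>\<bar>a\<bar> \<le> a\<^sup>2 / e\<close>. This bounds the \<open>L\<^sup>1\<close> distance by the squared \<open>L\<^sup>2\<close> distance without roots.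
\<close>

lemma (in prob_space) L1_le_sqdist:
  assumes "F \<in> L2_space M" "G \<in> L2_space M" "0 < (e::real)"
  shows "integrable M (\<lambda>x. F x - G x)" 
    and "(\<integral>x. norm (F x - G x) \<partial>M) \<le> e + sqdist M F G / e"
proof -
  have one: "(\<lambda>x. 1) \<in> L2_space M" by (simp add: L2_space_def)
  show int: "integrable M (\<lambda>x. F x - G x)"
    using L2_integrable_mult[OF L2_diff[OF assms(1,2)] one] by simp
  have pw: "norm a \<le> e + a\<^sup>2 / e" for a :: real
  proof (cases "norm a \<le> e")
    case False
    then have "\<bar>a\<bar> * e \<le> \<bar>a\<bar> * \<bar>a\<bar>" by (intro mult_left_mono) auto
    then have "\<bar>a\<bar> \<le> a\<^sup>2 / e" using \<open>0 < e\<close> by (simp add: field_simps power2_eq_square)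
    then show ?thesis using \<open>0 < e\<close> by simp
  qed (use \<open>0 < e\<close> in \<open>simp add: add_increasing2\<close>)
  have sq: "integrable M (\<lambda>x. (F x - G x)\<^sup>2 / e)"
    using assms by (auto intro!: L2_integrable_square L2_diff)
  have "(\<integral>x. norm (F x - G x) \<partial>M) \<le> (\<integral>x. e + (F x - G x)\<^sup>2 / e \<partial>M)"
    using int sq pw by (intro integral_mono) auto
  also have "\<dots> = e + sqdist M F G / e"
    using sq by (simp add: sqdist_def prob_space)
  finally show "(\<integral>x. norm (F x - G x) \<partial>M) \<le> e + sqdist M F G / e" .
qed

text \<open>
The theorem of Riesz and Fischer. A Cauchy sequence in \<open>L\<^sup>2\<close> is Cauchy in \<open>L\<^sup>1\<close>, so a subsequence converges almost
everywhere; by Fatou's lemma its pointwise limit is the limit in \<open>L\<^sup>2\<close> of the whole sequence.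
\<close>

lemma (in prob_space) L2_complete:
  assumes v: "\<And>n. v n \<in> L2_space M"
    and cauchy: "\<And>e. 0 < e \<Longrightarrow> \<exists>N. \<forall>i\<ge>N. \<forall>j\<ge>N. sqdist M (v i) (v j) < e"
  obtains p where "p \<in> L2_space M" "L2_converges M v p"
proof -
  note [measurable] = v[THEN L2_measurable]
  have one: "(\<lambda>x. 1) \<in> L2_space M" by (simp add: L2_space_def)
  have int: "integrable M (v n)" for n
    using L2_integrable_mult[OF v[of n] one] by simp
  have "\<exists>N. \<forall>i\<ge>N. \<forall>j\<ge>N. (\<integral>x. norm (v i x - v j x) \<partial>M) < e" if "0 < e" for e
  proof -
    obtain N where N: "\<And>i j. i \<ge> N \<Longrightarrow> j \<ge> N \<Longrightarrow> sqdist M (v i) (v j) < (e / 2)\<^sup>2"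
      using cauchy[of "(e / 2)\<^sup>2"] \<open>0 < e\<close> by auto
    have "(\<integral>x. norm (v i x - v j x) \<partial>M) < e" if "i \<ge> N" "j \<ge> N" for i j
    proof -
      have "(\<integral>x. norm (v i x - v j x) \<partial>M) \<le> e / 2 + sqdist M (v i) (v j) / (e / 2)"
        using \<open>0 < e\<close> by (intro L1_le_sqdist v) auto
      also have "sqdist M (v i) (v j) / (e / 2) < (e / 2)\<^sup>2 / (e / 2)"
        using N[OF that] \<open>0 < e\<close> by (intro divide_strict_right_mono) auto
      finally show ?thesis using \<open>0 < e\<close> by (simp add: power2_eq_square)
    qed
    then show ?thesis by blast
  qed
  from cauchy_L1_AE_cauchy_subseq[OF int this] obtain r
    where r: "strict_mono r" "AE x in M. Cauchy (\<lambda>i. v (r i) x)" by blast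
  define p where "p x = lim (\<lambda>i. v (r i) x)" for x
  have [measurable]: "p \<in> borel_measurable M"
    unfolding p_def by (intro borel_measurable_lim_metric) auto
  have lim: "AE x in M. (\<lambda>i. v (r i) x) \<longlonglongrightarrow> p x"
    using r(2) by eventually_elim (simp add: p_def Cauchy_convergent_iff convergent_LIMSEQ_iff)
  have fatou: "(\<integral>\<^sup>+x. ennreal ((v m x - p x)\<^sup>2) \<partial>M) \<le> ennreal e"
    if "0 < e" "\<And>i j. i \<ge> N \<Longrightarrow> j \<ge> N \<Longrightarrow> sqdist M (v i) (v j) < e" "m \<ge> N" for m N e
  proof -
    have "(\<integral>\<^sup>+x. ennreal ((v m x - p x)\<^sup>2) \<partial>M) =
        (\<integral>\<^sup>+x. liminf (\<lambda>i. ennreal ((v m x - v (r i) x)\<^sup>2)) \<partial>M)"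
    proof (rule nn_integral_cong_AE)
      show "AE x in M. ennreal ((v m x - p x)\<^sup>2) = liminf (\<lambda>i. ennreal ((v m x - v (r i) x)\<^sup>2))"
        using lim
      proof eventually_elim
        case (elim x)
        then have "(\<lambda>i. ennreal ((v m x - v (r i) x)\<^sup>2)) \<longlonglongrightarrow> ennreal ((v m x - p x)\<^sup>2)"
          by (intro tendsto_intros) auto
        then show ?case by (rule lim_imp_Liminf[symmetric, rotated]) simp
      qed
    qed
    also have "\<dots> \<le> liminf (\<lambda>i. \<integral>\<^sup>+x. ennreal ((v m x - v (r i) x)\<^sup>2) \<partial>M)"
      by (intro nn_integral_liminf) auto
    also have "\<dots> \<le> ennreal e"
    proof -
      have "eventually (\<lambda>i. (\<integral>\<^sup>+x. ennreal ((v m x - v (r i) x)\<^sup>2) \<partial>M) \<le> ennreal e) sequentially"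
        using eventually_ge_at_top[of N]
      proof eventually_elim
        case (elim i)
        then have "r i \<ge> N" using seq_suble[OF r(1), of i] by simp
        then have "sqdist M (v m) (v (r i)) < e" using that by auto
        moreover have "(\<integral>\<^sup>+x. ennreal ((v m x - v (r i) x)\<^sup>2) \<partial>M) = ennreal (sqdist M (v m) (v (r i)))"
          unfolding sqdist_def using v
          by (intro nn_integral_eq_integral L2_integrable_square L2_diff) auto
        ultimately show ?case by (simp add: ennreal_leI)
      qed
      then have "liminf (\<lambda>i. \<integral>\<^sup>+x. ennreal ((v m x - v (r i) x)\<^sup>2) \<partial>M) \<le> liminf (\<lambda>i. ennreal e)"
        by (rule Liminf_mono)
      also have "\<dots> = ennreal e" by (simp add: Liminf_const)
      finally show ?thesis .
    qed
    finally show ?thesis .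
  qed
  have pv: "integrable M (\<lambda>x. (v m x - p x)\<^sup>2)" and pv_le: "sqdist M (v m) p \<le> e"
    if "0 < e" "\<And>i j. i \<ge> N \<Longrightarrow> j \<ge> N \<Longrightarrow> sqdist M (v i) (v j) < e" "m \<ge> N" for m N e
  proof -
    show i: "integrable M (\<lambda>x. (v m x - p x)\<^sup>2)"
      using fatou[OF that] by (intro integrableI_bounded) (auto intro: le_less_trans)
    have "ennreal (sqdist M (v m) p) \<le> ennreal e"
      unfolding sqdist_def using fatou[OF that] i by (subst nn_integral_eq_integral[symmetric]) auto
    then show "sqdist M (v m) p \<le> e" using \<open>0 < e\<close> by (simp add: ennreal_le_iff)
  qed
  obtain N where N: "\<And>i j. i \<ge> N \<Longrightarrow> j \<ge> N \<Longrightarrow> sqdist M (v i) (v j) < 1"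
    using cauchy[of 1] by auto
  have "(\<lambda>x. v N x - p x) \<in> L2_space M"
    using pv[OF _ N] by (auto simp: L2_space_def)
  from L2_diff[OF v[of N] this] have "p \<in> L2_space M" by simp
  moreover have "L2_converges M v p"
    unfolding L2_converges_iff_sqdist
  proof (rule LIMSEQ_I)
    fix e :: real assume "0 < e"
    then obtain N where N: "\<And>i j. i \<ge> N \<Longrightarrow> j \<ge> N \<Longrightarrow> sqdist M (v i) (v j) < e / 2"
      using cauchy[of "e / 2"] by auto
    have "norm (sqdist M (v n) p - 0) < e" if "n \<ge> N" for n
      using pv_le[OF _ N that] \<open>0 < e\<close> sqdist_nonneg[of M "v n" p] by simp
    then show "\<exists>no. \<forall>n\<ge>no. norm (sqdist M (v n) p - 0) < e" by blast
  qed
  ultimately show ?thesis by (rule that)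
qed

text \<open>
Project \<open>F\<close> onto \<open>C\<close>. By the parallelogram identity a minimizing sequence is Cauchy, and its limit \<open>p\<close> is a
nearest point. The vectors \<open>F - p\<close> and \<open>u - p\<close> make an obtuse angle for every \<open>u \<in> C\<close>, in particular for the members of
the weakly convergent sequence. As \<open>F - p\<close> is a fixed vector, weak convergence applies to this inequality, and in the limit the
squared distance of \<open>F\<close> and \<open>p\<close> is at most \<open>0\<close>.
\<close>

lemma (in prob_space) convex_closed_imp_weakly_closed:
  assumes C: "C \<subseteq> L2_space M"
    and convex: "\<And>u v t. u \<in> C \<Longrightarrow> v \<in> C \<Longrightarrow> 0 \<le> t \<Longrightarrow> t \<le> 1 \<Longrightarrow> (\<lambda>x. (1 - t) * u x + t * v x) \<in> C"
    and closed: "\<And>u G. (\<And>n. u n \<in> C) \<Longrightarrow> G \<in> L2_space M \<Longrightarrow> L2_converges M u G \<Longrightarrow> G \<in> C"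
    and w: "\<And>n. w n \<in> C" and F: "F \<in> L2_space M" and weak: "L2_converges_weakly M w F"
  shows "F \<in> C"
proof -
  have CL2: "\<And>u. u \<in> C \<Longrightarrow> u \<in> L2_space M" using C by auto
  define \<delta> where "\<delta> = Inf (sqdist M F ` C)"
  have bdd: "bdd_below (sqdist M F ` C)"
    by (rule bdd_belowI[of _ 0]) (auto simp: sqdist_nonneg)
  have \<delta>_le: "\<delta> \<le> sqdist M F u" if "u \<in> C" for u
    unfolding \<delta>_def using that bdd by (intro cInf_lower) auto
  have ne: "sqdist M F ` C \<noteq> {}" using w by auto
  have "\<exists>u\<in>C. sqdist M F u < \<delta> + 1 / real (Suc n)" for n
    using cInf_lessD[OF ne, of "\<delta> + 1 / real (Suc n)"] by (auto simp: \<delta>_def)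
  then obtain v where v: "\<And>n. v n \<in> C" and v_less: "\<And>n. sqdist M F (v n) < \<delta> + 1 / real (Suc n)"
    by metis
  have par: "sqdist M (v i) (v j) \<le> 2 / real (Suc i) + 2 / real (Suc j)" for i j
  proof -
    let ?m = "\<lambda>x. (1 - 1/2) * v i x + 1/2 * v j x"
    have m: "?m \<in> C" by (intro convex v) auto
    have i: "integrable M (\<lambda>x. (F x - v i x)\<^sup>2)" "integrable M (\<lambda>x. (F x - v j x)\<^sup>2)"
      "integrable M (\<lambda>x. (F x - ?m x)\<^sup>2)"
      using F CL2[OF v] CL2[OF m] by (auto intro!: L2_integrable_square L2_diff)
    have "sqdist M (v i) (v j) = (\<integral>x. 2 * (F x - v i x)\<^sup>2 + 2 * (F x - v j x)\<^sup>2 - 4 * (F x - ?m x)\<^sup>2 \<partial>M)"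
      unfolding sqdist_def by (intro Bochner_Integration.integral_cong) (auto simp: power2_eq_square algebra_simps)
    also have "\<dots> = 2 * sqdist M F (v i) + 2 * sqdist M F (v j) - 4 * sqdist M F ?m"
      unfolding sqdist_def using i
      by (subst Bochner_Integration.integral_diff Bochner_Integration.integral_add;
          (intro Bochner_Integration.integrable_add integrable_mult_right)?; simp)+
    also have "\<dots> \<le> 2 / real (Suc i) + 2 / real (Suc j)"
      using v_less[of i] v_less[of j] \<delta>_le[OF m] by simp
    finally show ?thesis .
  qed
  have "\<exists>N. \<forall>i\<ge>N. \<forall>j\<ge>N. sqdist M (v i) (v j) < e" if e: "0 < e" for e
  proof -
    obtain N where N: "inverse (real (Suc N)) < e / 4"
      using reals_Archimedean[of "e / 4"] e by auto
    have small: "2 / real (Suc i) < e / 2" if "i \<ge> N" for i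
    proof -
      have "2 / real (Suc i) \<le> 2 * inverse (real (Suc N))"
        using that by (simp add: field_simps)
      then show ?thesis using N by simp
    qed
    have "sqdist M (v i) (v j) < e" if "i \<ge> N" "j \<ge> N" for i j
      using par[of i j] small[OF that(1)] small[OF that(2)] by linarith
    then show ?thesis by blast
  qed
  from L2_complete[OF CL2[OF v] this] obtain p where p: "p \<in> L2_space M" "L2_converges M v p"
    by blast
  have pC: "p \<in> C" using closed[OF v p] .
  \<comment> \<open>The limit \<open>n \<rightarrow> \<infinity>\<close> is taken first, for fixed \<open>\<eta>\<close>, then \<open>\<eta> \<rightarrow> 0\<close>.\<close>
  have p_min: "sqdist M F p \<le> \<delta>"
  proof -
    have le: "sqdist M F p \<le> (1 + \<eta>) * \<delta>" if "0 < \<eta>" for \<eta>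
    proof (rule LIMSEQ_le_const)
      have "(\<lambda>n. 1 / real (Suc n)) \<longlonglongrightarrow> 0"
        using LIMSEQ_inverse_real_of_nat by (simp add: inverse_eq_divide)
      then have "(\<lambda>n. (1 + \<eta>) * (\<delta> + 1 / real (Suc n)) + (1 + 1 / \<eta>) * sqdist M (v n) p)
          \<longlonglongrightarrow> (1 + \<eta>) * (\<delta> + 0) + (1 + 1 / \<eta>) * 0"
        using p(2) unfolding L2_converges_iff_sqdist by (intro tendsto_add tendsto_mult tendsto_const)
      then show "(\<lambda>n. (1 + \<eta>) * (\<delta> + 1 / real (Suc n)) + (1 + 1 / \<eta>) * sqdist M (v n) p) \<longlonglongrightarrow> (1 + \<eta>) * \<delta>"
        by simp
      have "sqdist M F p \<le> (1 + \<eta>) * (\<delta> + 1 / real (Suc n)) + (1 + 1 / \<eta>) * sqdist M (v n) p" for n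
      proof -
        have "sqdist M F p \<le> (1 + \<eta>) * sqdist M F (v n) + (1 + 1 / \<eta>) * sqdist M (v n) p"
          using F p(1) CL2[OF v] that by (intro sqdist_triangle)
        also have "(1 + \<eta>) * sqdist M F (v n) \<le> (1 + \<eta>) * (\<delta> + 1 / real (Suc n))"
          using v_less[of n] that by (intro mult_left_mono) auto
        finally show ?thesis by simp
      qed
      then show "\<exists>N. \<forall>n\<ge>N. sqdist M F p \<le> (1 + \<eta>) * (\<delta> + 1 / real (Suc n)) + (1 + 1 / \<eta>) * sqdist M (v n) p"
        by blast
    qed
    have "((\<lambda>\<eta>. (1 + \<eta>) * \<delta>) \<longlongrightarrow> (1 + 0) * \<delta>) (at_right 0)"
      by (intro tendsto_intros)
    moreover have "eventually (\<lambda>\<eta>. sqdist M F p \<le> (1 + \<eta>) * \<delta>) (at_right (0::real))"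
      using le by (auto simp: eventually_at_right_less eventually_at_filter)
    ultimately show ?thesis
      using tendsto_lowerbound[of "\<lambda>\<eta>. (1 + \<eta>) * \<delta>" "(1 + 0) * \<delta>" "at_right (0::real)" "sqdist M F p"] by simp
  qed
  \<comment> \<open>Points of the segment from \<open>p\<close> to \<open>u\<close> are not nearer to \<open>F\<close> than \<open>p\<close>; let them tend to \<open>p\<close>.\<close>
  have obtuse: "(\<integral>x. (F x - p x) * (u x - p x) \<partial>M) \<le> 0" if u: "u \<in> C" for u
  proof -
    let ?I = "\<integral>x. (F x - p x) * (u x - p x) \<partial>M" and ?S = "sqdist M u p"
    have le: "?I \<le> t * ?S / 2" if t: "0 < t" "t \<le> 1" for t
    proof -
      let ?q = "\<lambda>x. (1 - t) * p x + t * u x"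
      have q: "?q \<in> C" using pC u t by (intro convex) auto
      have i: "integrable M (\<lambda>x. (F x - p x)\<^sup>2)" "integrable M (\<lambda>x. (u x - p x)\<^sup>2)"
        "integrable M (\<lambda>x. (F x - p x) * (u x - p x))"
        using F CL2[OF u] p(1) by (auto intro!: L2_integrable_square L2_diff L2_integrable_mult)
      have "sqdist M F ?q = (\<integral>x. (F x - p x)\<^sup>2 + t\<^sup>2 * (u x - p x)\<^sup>2 - 2 * t * ((F x - p x) * (u x - p x)) \<partial>M)"
        unfolding sqdist_def by (intro Bochner_Integration.integral_cong) (auto simp: power2_eq_square algebra_simps)
      also have "\<dots> = sqdist M F p + t\<^sup>2 * ?S - 2 * t * ?I"
        unfolding sqdist_def using i
        by (subst Bochner_Integration.integral_diff Bochner_Integration.integral_add;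
            (intro Bochner_Integration.integrable_add integrable_mult_right)?; simp)+
      finally have "0 \<le> t * (t * ?S - 2 * ?I)"
        using \<delta>_le[OF q] p_min by (simp add: power2_eq_square algebra_simps)
      then show ?thesis using t by (simp add: zero_le_mult_iff)
    qed
    have "((\<lambda>t. t * ?S / 2) \<longlongrightarrow> 0 * ?S / 2) (at_right 0)"
      by (intro tendsto_intros) auto
    moreover have "eventually (\<lambda>t. ?I \<le> t * ?S / 2) (at_right (0::real))"
      unfolding eventually_at_right_field using le by (intro exI[of _ 1]) auto
    ultimately show ?thesis
      using tendsto_lowerbound[of "\<lambda>t. t * ?S / 2" "0 * ?S / 2" "at_right (0::real)" ?I] by simp
  qed
  have "sqdist M F p \<le> 0"
  proof -
    have FpL: "(\<lambda>x. F x - p x) \<in> L2_space M" using F p by (intro L2_diff)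
    let ?G = "\<lambda>x. F x - p x"
    have "(\<lambda>n. (\<integral>x. w n x * ?G x \<partial>M) - (\<integral>x. p x * ?G x \<partial>M)) \<longlonglongrightarrow> (\<integral>x. F x * ?G x \<partial>M) - (\<integral>x. p x * ?G x \<partial>M)"
      using weak FpL unfolding L2_converges_weakly_def by (intro tendsto_intros) auto
    moreover have diff: "(\<integral>x. u x * ?G x \<partial>M) - (\<integral>x. p x * ?G x \<partial>M) = (\<integral>x. (F x - p x) * (u x - p x) \<partial>M)"
      if "u \<in> L2_space M" for u
    proof -
      have "(\<integral>x. u x * ?G x \<partial>M) - (\<integral>x. p x * ?G x \<partial>M) = (\<integral>x. u x * ?G x - p x * ?G x \<partial>M)"
        using L2_integrable_mult[OF that FpL] L2_integrable_mult[OF p(1) FpL]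
        by (rule Bochner_Integration.integral_diff[symmetric])
      also have "\<dots> = (\<integral>x. (F x - p x) * (u x - p x) \<partial>M)"
        by (intro Bochner_Integration.integral_cong refl) (simp add: algebra_simps)
      finally show ?thesis .
    qed
    moreover have "(\<integral>x. (F x - p x) * (F x - p x) \<partial>M) = sqdist M F p"
      by (simp add: sqdist_def power2_eq_square)
    ultimately have "(\<lambda>n. \<integral>x. (F x - p x) * (w n x - p x) \<partial>M) \<longlonglongrightarrow> sqdist M F p"
      using CL2[OF w] F by simp
    then show ?thesis
      by (rule LIMSEQ_le_const2) (use obtuse[OF w] in auto)
  qed
  then have "L2_converges M (\<lambda>n. p) F"
    using sqdist_nonneg[of M F p] by (simp add: L2_converges_iff_sqdist sqdist_commute[of M p])
  then show ?thesis using closed[of "\<lambda>n. p" F] pC F by auto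
qed

section \<open>Quadratic forms and their lower semicontinuous envelopes\<close>

text \<open>
The function \<open>g x - x g(1)\<close> is additive and vanishes at the integers. So it is periodic, hence bounded, and a bounded
additive function is zero.
\<close>

lemma additive_bounded_imp_linear:
  fixes g :: "real \<Rightarrow> real"
  assumes add: "\<And>x y. g (x + y) = g x + g y" and bound: "\<And>x. 0 \<le> x \<Longrightarrow> x \<le> 1 \<Longrightarrow> \<bar>g x\<bar> \<le> K"
  shows "g c = c * g 1"
proof -
  define h where "h x = g x - x * g 1" for x
  have h_add: "h (x + y) = h x + h y" for x y
    by (simp add: h_def add algebra_simps)
  have h_nat: "h (real n * x) = real n * h x" for n x
  proof (induction n)
    case 0
    show ?case using h_add[of 0 0] by simp
  next
    case (Suc n)
    then show ?case using h_add[of x "real n * x"] by (simp add: algebra_simps)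
  qed
  have h_minus: "h (- x) = - h x" for x
    using h_add[of x "- x"] h_nat[of 0 x] by simp
  have h_int: "h (of_int m) = 0" for m
  proof -
    have "h (real n) = 0" for n using h_nat[of n 1] by (simp add: h_def)
    then show ?thesis
      by (cases m rule: int_cases2) (auto simp: h_minus)
  qed
  have h_bound: "\<bar>h x\<bar> \<le> K + \<bar>g 1\<bar>" for x
  proof -
    have "h x = h (of_int \<lfloor>x\<rfloor> + frac x)" by (simp add: frac_def)
    also have "\<dots> = h (frac x)" by (simp only: h_add h_int)
    also have "\<bar>\<dots>\<bar> \<le> \<bar>g (frac x)\<bar> + \<bar>frac x * g 1\<bar>" unfolding h_def by simp
    also have "\<dots> \<le> K + 1 * \<bar>g 1\<bar>"
      unfolding abs_mult using frac_ge_0[of x] less_imp_le[OF frac_lt_1[of x]] 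
      by (intro add_mono bound mult_right_mono) auto
    finally show ?thesis by simp
  qed
  have "h c = 0"
  proof (rule ccontr)
    assume "h c \<noteq> 0"
    then obtain n where "(K + \<bar>g 1\<bar>) / \<bar>h c\<bar> < real n" using reals_Archimedean2 by blast
    then have "K + \<bar>g 1\<bar> < real n * \<bar>h c\<bar>"
      using \<open>h c \<noteq> 0\<close> by (simp add: field_simps)
    also have "\<dots> = \<bar>h (real n * c)\<bar>"
      by (simp only: h_nat abs_mult abs_of_nat)
    finally have "K + \<bar>g 1\<bar> < \<bar>h (real n * c)\<bar>" .
    then show False using h_bound[of "real n * c"] by simp
  qed
  then show ?thesis by (simp add: h_def)
qed

text \<open>
The theorem of Jordan and von Neumann: a nonnegative functional with the parallelogram law that is homogeneous of
degree \<open>2\<close> is the diagonal of its polarization, which is bilinear.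
\<close>

definition polarization :: "(('b \<Rightarrow> real) \<Rightarrow> real) \<Rightarrow> ('b \<Rightarrow> real) \<Rightarrow> ('b \<Rightarrow> real) \<Rightarrow> real" where
  "polarization R F G = (R (\<lambda>x. F x + G x) - R (\<lambda>x. F x - G x)) / 4"

context
  fixes D :: "('b \<Rightarrow> real) set" and R :: "('b \<Rightarrow> real) \<Rightarrow> real"
  assumes add: "\<And>F G. F \<in> D \<Longrightarrow> G \<in> D \<Longrightarrow> (\<lambda>x. F x + G x) \<in> D"
    and scale: "\<And>c F. F \<in> D \<Longrightarrow> (\<lambda>x. c * F x) \<in> D"
    and parallelogram: "\<And>F G. F \<in> D \<Longrightarrow> G \<in> D \<Longrightarrow>
      R (\<lambda>x. F x + G x) + R (\<lambda>x. F x - G x) = 2 * R F + 2 * R G"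
    and homogeneous: "\<And>c F. F \<in> D \<Longrightarrow> R (\<lambda>x. c * F x) = c\<^sup>2 * R F"
    and nonneg: "\<And>F. F \<in> D \<Longrightarrow> 0 \<le> R F"
begin

lemma quadratic_diff: "F \<in> D \<Longrightarrow> G \<in> D \<Longrightarrow> (\<lambda>x. F x - G x) \<in> D"
  using add[of F "\<lambda>x. -1 * G x"] scale[of G "-1"] by simp

lemma polarization_diag: "F \<in> D \<Longrightarrow> polarization R F F = R F"
  using homogeneous[of F 2] homogeneous[of F 0] by (simp add: polarization_def flip: mult_2)

lemma polarization_commute:
  assumes "F \<in> D" "G \<in> D"
  shows "polarization R F G = polarization R G F"
proof -
  have "R (\<lambda>x. F x - G x) = R (\<lambda>x. G x - F x)"
    using homogeneous[of "\<lambda>x. F x - G x" "-1"] quadratic_diff[OF assms] by simp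
  then show ?thesis by (simp add: polarization_def add.commute)
qed

text \<open>
This is the difference of the parallelogram laws for the pairs \<open>F + H, G\<close> and \<open>F - H, G\<close>. With \<open>(F + G) / 2\<close> and
\<open>(F - G) / 2\<close> in place of \<open>F\<close> and \<open>G\<close> it becomes additivity.
\<close>

lemma polarization_sum_diff:
  assumes "F \<in> D" "G \<in> D" "H \<in> D"
  shows "polarization R (\<lambda>x. F x + G x) H + polarization R (\<lambda>x. F x - G x) H = 2 * polarization R F H"
proof -
  have eqs: "(\<lambda>x. (F x + H x) + G x) = (\<lambda>x. (F x + G x) + H x)"
    "(\<lambda>x. (F x + H x) - G x) = (\<lambda>x. (F x - G x) + H x)"
    "(\<lambda>x. (F x - H x) + G x) = (\<lambda>x. (F x + G x) - H x)"
    "(\<lambda>x. (F x - H x) - G x) = (\<lambda>x. (F x - G x) - H x)"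
    by auto
  have "R (\<lambda>x. (F x + H x) + G x) + R (\<lambda>x. (F x + H x) - G x) = 2 * R (\<lambda>x. F x + H x) + 2 * R G"
    by (intro parallelogram add assms)
  moreover have "R (\<lambda>x. (F x - H x) + G x) + R (\<lambda>x. (F x - H x) - G x) = 2 * R (\<lambda>x. F x - H x) + 2 * R G"
    by (intro parallelogram quadratic_diff assms)
  moreover have "p + q = 2 * t + 2 * v \<Longrightarrow> r + s = 2 * u + 2 * v \<Longrightarrow> (p - r) / 4 + (q - s) / 4 = 2 * ((t - u) / 4)"
    for p q r s t u v :: real by (simp add: field_simps)
  ultimately show ?thesis unfolding polarization_def eqs by blast
qed

lemma polarization_zero: "H \<in> D \<Longrightarrow> polarization R (\<lambda>x. 0) H = 0"
  using homogeneous[of H "-1"] by (simp add: polarization_def)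

lemma polarization_double:
  assumes "F \<in> D" "H \<in> D"
  shows "polarization R (\<lambda>x. 2 * F x) H = 2 * polarization R F H"
  using polarization_sum_diff[of F F H] polarization_zero[of H] assms by (simp flip: mult_2)

lemma polarization_add:
  assumes "F \<in> D" "G \<in> D" "H \<in> D"
  shows "polarization R (\<lambda>x. F x + G x) H = polarization R F H + polarization R G H"
proof -
  let ?U = "\<lambda>x. 1/2 * (F x + G x)" and ?V = "\<lambda>x. 1/2 * (F x - G x)"
  have U: "?U \<in> D" "?V \<in> D" using assms by (auto intro!: scale add quadratic_diff simp del: times_divide_eq_left)
  have "(\<lambda>x. ?U x + ?V x) = F" "(\<lambda>x. ?U x - ?V x) = G" by (auto simp: field_simps)
  then have "polarization R F H + polarization R G H = 2 * polarization R ?U H"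
    using polarization_sum_diff[OF U assms(3)] by simp
  also have "\<dots> = polarization R (\<lambda>x. 2 * ?U x) H"
    using polarization_double[OF U(1) assms(3)] by simp
  also have "(\<lambda>x. 2 * ?U x) = (\<lambda>x. F x + G x)" by auto
  finally show ?thesis by simp
qed

text \<open>
Additivity gives only rational multiples; for real ones, the parallelogram law bounds the polarization for \<open>c\<close> in
\<open>[0, 1]\<close>.
\<close>

lemma polarization_mult:
  assumes "F \<in> D" "H \<in> D"
  shows "polarization R (\<lambda>x. c * F x) H = c * polarization R F H"
proof -
  define g where "g c = polarization R (\<lambda>x. c * F x) H" for c
  have "g c = c * g 1"
  proof (rule additive_bounded_imp_linear)
    show "g (x + y) = g x + g y" for x y
      using polarization_add[OF scale[OF assms(1), of x] scale[OF assms(1), of y] assms(2)]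
      by (simp add: g_def algebra_simps)
    fix c :: real assume c: "0 \<le> c" "c \<le> 1"
    have cF: "(\<lambda>x. c * F x) \<in> D" using assms by (intro scale)
    have "\<bar>g c\<bar> \<le> R (\<lambda>x. c * F x + H x) + R (\<lambda>x. c * F x - H x)"
      using nonneg[OF add[OF cF assms(2)]] nonneg[OF quadratic_diff[OF cF assms(2)]]
      by (auto simp: g_def polarization_def)
    also have "\<dots> = 2 * (c\<^sup>2 * R F) + 2 * R H"
      using parallelogram[OF cF assms(2)] homogeneous[OF assms(1)] by simp
    also have "\<dots> \<le> 2 * (1 * R F) + 2 * R H"
      using nonneg[OF assms(1)] power_le_one[OF c] by (intro add_mono mult_left_mono mult_right_mono) auto
    finally show "\<bar>g c\<bar> \<le> 2 * (1 * R F) + 2 * R H" .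
  qed
  then show ?thesis by (simp add: g_def)
qed

end

text \<open>
The lower semicontinuous envelope of an energy on \<open>L\<^sup>2\<close>. The energy is given as a relation, \<open>T G a\<close> meaning that \<open>a\<close> is an
energy of \<open>G\<close>, because it is computed from gradients and these belong to representations of functions. The envelope is
introduced through its sublevels, \<open>relaxed_le M T F c\<close> meaning that it is at most \<open>c\<close> at \<open>F\<close>, so that finiteness is part
of the definition.
\<close>

definition relaxed_le ::
    "'b measure \<Rightarrow> (('b \<Rightarrow> real) \<Rightarrow> real \<Rightarrow> bool) \<Rightarrow> ('b \<Rightarrow> real) \<Rightarrow> real \<Rightarrow> bool" where
  "relaxed_le M T F c \<longleftrightarrow> (\<forall>\<epsilon>>0. \<exists>G a. T G a \<and> sqdist M G F < \<epsilon> \<and> a < c + \<epsilon>)"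

definition relaxed_dom :: "'b measure \<Rightarrow> (('b \<Rightarrow> real) \<Rightarrow> real \<Rightarrow> bool) \<Rightarrow> ('b \<Rightarrow> real) set" where
  "relaxed_dom M T = {F \<in> L2_space M. \<exists>c. relaxed_le M T F c}"

definition relaxed :: "'b measure \<Rightarrow> (('b \<Rightarrow> real) \<Rightarrow> real \<Rightarrow> bool) \<Rightarrow> ('b \<Rightarrow> real) \<Rightarrow> real" where
  "relaxed M T F = Inf {c. relaxed_le M T F c}"

locale quadratic_relation =
  fixes M :: "'b measure" and T :: "('b \<Rightarrow> real) \<Rightarrow> real \<Rightarrow> bool"
  assumes rel_L2: "T F a \<Longrightarrow> F \<in> L2_space M"
    and rel_nonneg: "T F a \<Longrightarrow> 0 \<le> a"
    and rel_zero: "T (\<lambda>x. 0) 0"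
    and rel_scale: "T F a \<Longrightarrow> T (\<lambda>x. c * F x) (c\<^sup>2 * a)"
    and rel_parallelogram: "T F a \<Longrightarrow> T G b \<Longrightarrow>
      \<exists>a' b'. T (\<lambda>x. F x + G x) a' \<and> T (\<lambda>x. F x - G x) b' \<and> a' + b' = 2 * a + 2 * b"
begin

lemma relaxed_le_nonneg: "relaxed_le M T F c \<Longrightarrow> 0 \<le> c"
proof (rule ccontr)
  assume "relaxed_le M T F c" "\<not> 0 \<le> c"
  then obtain G a where "T G a" "a < c + (- c)" unfolding relaxed_le_def
    by (metis neg_0_less_iff_less not_le)
  then show False using rel_nonneg[of G a] by simp
qed

lemma rel_imp_relaxed_le: "T F a \<Longrightarrow> relaxed_le M T F a"
  unfolding relaxed_le_def by (auto intro!: exI[of _ F] exI[of _ a])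

lemma relaxed_le_mono: "relaxed_le M T F c \<Longrightarrow> c \<le> d \<Longrightarrow> relaxed_le M T F d"
  unfolding relaxed_le_def by (meson add_right_mono less_le_trans)

lemma relaxed_least: "relaxed_le M T F c \<Longrightarrow> relaxed M T F \<le> c"
  unfolding relaxed_def by (rule cInf_lower) (auto intro!: bdd_belowI[of _ 0] relaxed_le_nonneg)

lemma relaxed_le_relaxed:
  assumes "F \<in> relaxed_dom M T"
  shows "relaxed_le M T F (relaxed M T F)"
  unfolding relaxed_le_def
proof (intro allI impI)
  fix \<epsilon> :: real assume "0 < \<epsilon>"
  have "{c. relaxed_le M T F c} \<noteq> {}" using assms by (auto simp: relaxed_dom_def)
  then obtain c where c: "relaxed_le M T F c" "c < relaxed M T F + \<epsilon> / 2"
    using cInf_lessD[of "{c. relaxed_le M T F c}" "relaxed M T F + \<epsilon> / 2"] \<open>0 < \<epsilon>\<close>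
    by (auto simp: relaxed_def)
  then obtain G a where "T G a" "sqdist M G F < \<epsilon> / 2" "a < c + \<epsilon> / 2"
    using \<open>0 < \<epsilon>\<close> unfolding relaxed_le_def by (meson half_gt_zero)
  then show "\<exists>G a. T G a \<and> sqdist M G F < \<epsilon> \<and> a < relaxed M T F + \<epsilon>"
    using c \<open>0 < \<epsilon>\<close> by (intro exI[of _ G] exI[of _ a]) auto
qed

lemma relaxed_nonneg: "F \<in> relaxed_dom M T \<Longrightarrow> 0 \<le> relaxed M T F"
  by (rule relaxed_le_nonneg[OF relaxed_le_relaxed])

lemma relaxed_domI: "F \<in> L2_space M \<Longrightarrow> relaxed_le M T F c \<Longrightarrow> F \<in> relaxed_dom M T"
  by (auto simp: relaxed_dom_def)

lemma relaxed_dom_L2: "F \<in> relaxed_dom M T \<Longrightarrow> F \<in> L2_space M"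
  by (auto simp: relaxed_dom_def)

lemma relaxed_le_closed:
  assumes F: "F \<in> L2_space M"
    and approx: "\<And>\<epsilon>. 0 < \<epsilon> \<Longrightarrow> \<exists>G\<in>L2_space M. relaxed_le M T G (c + \<epsilon>) \<and> sqdist M G F < \<epsilon>"
  shows "relaxed_le M T F c"
  unfolding relaxed_le_def
proof (intro allI impI)
  fix \<epsilon> :: real assume "0 < \<epsilon>"
  define \<delta> where "\<delta> = \<epsilon> / 4"
  have "0 < \<delta>" using \<open>0 < \<epsilon>\<close> by (simp add: \<delta>_def)
  then obtain G where G: "G \<in> L2_space M" "relaxed_le M T G (c + \<delta>)" "sqdist M G F < \<delta>"
    using approx by blast
  then obtain H a where H: "T H a" "sqdist M H G < \<delta>" "a < c + \<delta> + \<delta>"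
    using \<open>0 < \<delta>\<close> unfolding relaxed_le_def by blast
  have "sqdist M H F \<le> (1 + 1) * sqdist M H G + (1 + 1 / 1) * sqdist M G F"
    using rel_L2[OF H(1)] G F by (intro sqdist_triangle) auto
  also have "\<dots> < \<epsilon>" using H G by (simp add: \<delta>_def)
  finally show "\<exists>G a. T G a \<and> sqdist M G F < \<epsilon> \<and> a < c + \<epsilon>"
    using H \<open>0 < \<epsilon>\<close> by (intro exI[of _ H] exI[of _ a]) (auto simp: \<delta>_def)
qed

lemma relaxed_le_cong_AE:
  assumes "AE x in M. F x = F' x" "F \<in> borel_measurable M" "F' \<in> borel_measurable M"
  shows "relaxed_le M T F c \<longleftrightarrow> relaxed_le M T F' c"
proof -
  have "T G a \<Longrightarrow> sqdist M G F = sqdist M G F'" for G a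
    using assms rel_L2[of G a] by (intro sqdist_cong_AE) (auto dest: L2_measurable)
  then show ?thesis unfolding relaxed_le_def by metis
qed

lemma relaxed_le_scale:
  assumes "relaxed_le M T F r"
  shows "relaxed_le M T (\<lambda>x. c * F x) (c\<^sup>2 * r)"
  unfolding relaxed_le_def
proof (intro allI impI)
  fix \<epsilon> :: real assume "0 < \<epsilon>"
  have pos: "0 < 1 + c\<^sup>2" by (simp add: add_pos_nonneg)
  define \<delta> where "\<delta> = \<epsilon> / (1 + c\<^sup>2)"
  have \<delta>: "0 < \<delta>" "c\<^sup>2 * \<delta> < \<epsilon>"
    using \<open>0 < \<epsilon>\<close> pos by (simp_all add: \<delta>_def field_simps)
  then obtain G a where G: "T G a" "sqdist M G F < \<delta>" "a < r + \<delta>"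
    using assms unfolding relaxed_le_def by blast
  have "c\<^sup>2 * sqdist M G F \<le> c\<^sup>2 * \<delta>" "c\<^sup>2 * a \<le> c\<^sup>2 * (r + \<delta>)"
    using G by (auto intro!: mult_left_mono)
  then show "\<exists>G a. T G a \<and> sqdist M G (\<lambda>x. c * F x) < \<epsilon> \<and> a < c\<^sup>2 * r + \<epsilon>"
    using \<delta> rel_scale[OF G(1), of c]
    by (intro exI[of _ "\<lambda>x. c * G x"] exI[of _ "c\<^sup>2 * a"]) (auto simp: sqdist_mult algebra_simps)
qed

lemma relaxed_scale:
  assumes F: "F \<in> relaxed_dom M T"
  shows relaxed_dom_scale: "(\<lambda>x. c * F x) \<in> relaxed_dom M T"
    and "relaxed M T (\<lambda>x. c * F x) = c\<^sup>2 * relaxed M T F"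
proof -
  have dom: "(\<lambda>x. c * F x) \<in> relaxed_dom M T" 
    and le: "relaxed M T (\<lambda>x. c * F x) \<le> c\<^sup>2 * relaxed M T F" 
    if "F \<in> relaxed_dom M T" for c F
    using relaxed_le_scale[OF relaxed_le_relaxed[OF that]] relaxed_dom_L2[OF that]
    by (auto intro: relaxed_domI relaxed_least L2_mult)
  show cF: "(\<lambda>x. c * F x) \<in> relaxed_dom M T" by (rule dom[OF F])
  show "relaxed M T (\<lambda>x. c * F x) = c\<^sup>2 * relaxed M T F"
  proof (cases "c = 0")
    case True
    then show ?thesis using le[OF F, of 0] relaxed_nonneg[OF cF] by simp
  next
    case False
    have "relaxed M T (\<lambda>x. inverse c * (c * F x)) \<le> (inverse c)\<^sup>2 * relaxed M T (\<lambda>x. c * F x)"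
      by (rule le[OF cF])
    then have "relaxed M T F \<le> (inverse c)\<^sup>2 * relaxed M T (\<lambda>x. c * F x)"
      using False by (simp add: mult.assoc[symmetric])
    then have "c\<^sup>2 * relaxed M T F \<le> relaxed M T (\<lambda>x. c * F x)"
      using False by (simp add: field_simps)
    then show ?thesis using le[OF F, of c] by simp
  qed
qed

lemma relaxed_lower_bound:
  assumes "c < relaxed M T F"
  obtains \<epsilon> where "0 < \<epsilon>" "\<And>G a. T G a \<Longrightarrow> sqdist M G F < \<epsilon> \<Longrightarrow> c + \<epsilon> \<le> a"
proof -
  have "\<not> relaxed_le M T F c" using assms relaxed_least by fastforce
  then show ?thesis using that unfolding relaxed_le_def by (metis not_le)
qed

text \<open>
Approximating \<open>F\<close> and \<open>G\<close> separately by functions of nearly optimal energy approximates their sum and difference; the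
parallelogram law of the energy controls the two energies together, though neither of them alone.
\<close>

lemma relaxed_approx_pair:
  assumes F: "F \<in> relaxed_dom M T" and G: "G \<in> relaxed_dom M T" and "0 < \<epsilon>"
  obtains u v a b where "T (\<lambda>x. u x + v x) a" "T (\<lambda>x. u x - v x) b"
    "a + b < 2 * relaxed M T F + 2 * relaxed M T G + \<epsilon>"
    "sqdist M (\<lambda>x. u x + v x) (\<lambda>x. F x + G x) < \<epsilon>" "sqdist M (\<lambda>x. u x - v x) (\<lambda>x. F x - G x) < \<epsilon>"
proof -
  have "0 < \<epsilon> / 4" using \<open>0 < \<epsilon>\<close> by simp
  then obtain u a v b where u: "T u a" "sqdist M u F < \<epsilon> / 4" "a < relaxed M T F + \<epsilon> / 4"
    and v: "T v b" "sqdist M v G < \<epsilon> / 4" "b < relaxed M T G + \<epsilon> / 4"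
    using relaxed_le_relaxed[OF F] relaxed_le_relaxed[OF G] unfolding relaxed_le_def by metis
  obtain a' b' where ab: "T (\<lambda>x. u x + v x) a'" "T (\<lambda>x. u x - v x) b'" "a' + b' = 2 * a + 2 * b"
    using rel_parallelogram[OF u(1) v(1)] by blast
  have L2: "u \<in> L2_space M" "v \<in> L2_space M" "F \<in> L2_space M" "G \<in> L2_space M"
    using rel_L2 u v relaxed_dom_L2 F G by auto
  have "sqdist M (\<lambda>x. u x + v x) (\<lambda>x. F x + G x) \<le> (1 + 1) * sqdist M u F + (1 + 1 / 1) * sqdist M v G"
    by (intro sqdist_add_le L2) auto
  then have sum: "sqdist M (\<lambda>x. u x + v x) (\<lambda>x. F x + G x) < \<epsilon>" using u v by simp
  have "sqdist M (\<lambda>x. u x + - 1 * v x) (\<lambda>x. F x + - 1 * G x)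
      \<le> (1 + 1) * sqdist M u F + (1 + 1 / 1) * sqdist M (\<lambda>x. - 1 * v x) (\<lambda>x. - 1 * G x)"
    by (intro sqdist_add_le L2 L2_mult) auto
  moreover have "sqdist M (\<lambda>x. - 1 * v x) (\<lambda>x. - 1 * G x) = sqdist M v G"
    by (simp only: sqdist_mult) simp
  ultimately have "sqdist M (\<lambda>x. u x + - 1 * v x) (\<lambda>x. F x + - 1 * G x) < \<epsilon>"
    using u v by simp
  then have diff: "sqdist M (\<lambda>x. u x - v x) (\<lambda>x. F x - G x) < \<epsilon>" by simp
  have "a' + b' < 2 * relaxed M T F + 2 * relaxed M T G + \<epsilon>"
    using ab(3) u(3) v(3) by linarith
  from that[OF ab(1,2) this sum diff] show ?thesis .
qed

lemma relaxed_add_dom: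
  assumes F: "F \<in> relaxed_dom M T" and G: "G \<in> relaxed_dom M T"
  shows "(\<lambda>x. F x + G x) \<in> relaxed_dom M T"
proof (rule relaxed_domI)
  show "(\<lambda>x. F x + G x) \<in> L2_space M" using F G relaxed_dom_L2 by (intro L2_add) auto
  show "relaxed_le M T (\<lambda>x. F x + G x) (2 * relaxed M T F + 2 * relaxed M T G)"
    unfolding relaxed_le_def
  proof (intro allI impI)
    fix \<epsilon> :: real assume "0 < \<epsilon>"
    obtain u v a b where "T (\<lambda>x. u x + v x) a" "T (\<lambda>x. u x - v x) b"
      "a + b < 2 * relaxed M T F + 2 * relaxed M T G + \<epsilon>"
      "sqdist M (\<lambda>x. u x + v x) (\<lambda>x. F x + G x) < \<epsilon>" "sqdist M (\<lambda>x. u x - v x) (\<lambda>x. F x - G x) < \<epsilon>"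
      by (rule relaxed_approx_pair[OF F G \<open>0 < \<epsilon>\<close>])
    moreover have "0 \<le> b" using rel_nonneg calculation(2) .
    ultimately show "\<exists>H a. T H a \<and> sqdist M H (\<lambda>x. F x + G x) < \<epsilon> \<and> a < 2 * relaxed M T F + 2 * relaxed M T G + \<epsilon>"
      by (intro exI[of _ "\<lambda>x. u x + v x"] exI[of _ a] conjI) linarith+
  qed
qed

lemma relaxed_diff_dom:
  assumes F: "F \<in> relaxed_dom M T" and G: "G \<in> relaxed_dom M T"
  shows "(\<lambda>x. F x - G x) \<in> relaxed_dom M T"
  using relaxed_add_dom[OF F relaxed_dom_scale[OF G, of "-1"]] by simp

lemma relaxed_parallelogram_le:
  assumes F: "F \<in> relaxed_dom M T" and G: "G \<in> relaxed_dom M T"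
  shows "relaxed M T (\<lambda>x. F x + G x) + relaxed M T (\<lambda>x. F x - G x)
    \<le> 2 * relaxed M T F + 2 * relaxed M T G"
proof (rule field_le_epsilon)
  fix e :: real assume "0 < e"
  define S where "S = relaxed M T (\<lambda>x. F x + G x)"
  define Df where "Df = relaxed M T (\<lambda>x. F x - G x)"
  obtain \<epsilon>1 where \<epsilon>1: "0 < \<epsilon>1" "\<And>H a. T H a \<Longrightarrow> sqdist M H (\<lambda>x. F x + G x) < \<epsilon>1 \<Longrightarrow> S - e / 4 + \<epsilon>1 \<le> a"
    using relaxed_lower_bound[of "S - e / 4" "\<lambda>x. F x + G x"] \<open>0 < e\<close> by (auto simp: S_def)
  obtain \<epsilon>2 where \<epsilon>2: "0 < \<epsilon>2" "\<And>H a. T H a \<Longrightarrow> sqdist M H (\<lambda>x. F x - G x) < \<epsilon>2 \<Longrightarrow> Df - e / 4 + \<epsilon>2 \<le> a"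
    using relaxed_lower_bound[of "Df - e / 4" "\<lambda>x. F x - G x"] \<open>0 < e\<close> by (auto simp: Df_def)
  define \<epsilon> where "\<epsilon> = min (min \<epsilon>1 \<epsilon>2) (e / 2)"
  have "0 < \<epsilon>" using \<epsilon>1 \<epsilon>2 \<open>0 < e\<close> by (simp add: \<epsilon>_def)
  obtain u v a b where
    uv: "T (\<lambda>x. u x + v x) a" "T (\<lambda>x. u x - v x) b"
    "a + b < 2 * relaxed M T F + 2 * relaxed M T G + \<epsilon>"
    "sqdist M (\<lambda>x. u x + v x) (\<lambda>x. F x + G x) < \<epsilon>" "sqdist M (\<lambda>x. u x - v x) (\<lambda>x. F x - G x) < \<epsilon>"
    by (rule relaxed_approx_pair[OF F G \<open>0 < \<epsilon>\<close>])
  have "S - e / 4 + \<epsilon>1 \<le> a" "Df - e / 4 + \<epsilon>2 \<le> b"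
    using \<epsilon>1(2)[OF uv(1)] \<epsilon>2(2)[OF uv(2)] uv by (auto simp: \<epsilon>_def)
  moreover have "\<epsilon> \<le> e / 2" by (simp add: \<epsilon>_def)
  ultimately have "S + Df \<le> 2 * relaxed M T F + 2 * relaxed M T G + e"
    using uv \<epsilon>1 \<epsilon>2 by linarith
  then show "relaxed M T (\<lambda>x. F x + G x) + relaxed M T (\<lambda>x. F x - G x)
      \<le> 2 * relaxed M T F + 2 * relaxed M T G + e" by (simp add: S_def Df_def)
qed

text \<open>
Applied to \<open>F + G\<close> and \<open>F - G\<close>, the inequality turns into its own converse.
\<close>

lemma relaxed_parallelogram:
  assumes F: "F \<in> relaxed_dom M T" and G: "G \<in> relaxed_dom M T"
  shows "relaxed M T (\<lambda>x. F x + G x) + relaxed M T (\<lambda>x. F x - G x)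
    = 2 * relaxed M T F + 2 * relaxed M T G"
proof -
  have "relaxed M T (\<lambda>x. (F x + G x) + (F x - G x)) + relaxed M T (\<lambda>x. (F x + G x) - (F x - G x))
      \<le> 2 * relaxed M T (\<lambda>x. F x + G x) + 2 * relaxed M T (\<lambda>x. F x - G x)"
    by (intro relaxed_parallelogram_le relaxed_add_dom relaxed_diff_dom F G)
  moreover have "(\<lambda>x. (F x + G x) + (F x - G x)) = (\<lambda>x. 2 * F x)" 
    "(\<lambda>x. (F x + G x) - (F x - G x)) = (\<lambda>x. 2 * G x)" by auto
  ultimately show ?thesis
    using relaxed_parallelogram_le[OF F G] relaxed_scale(2)[OF F, of 2] relaxed_scale(2)[OF G, of 2] by simp
qed

lemmas jordan_von_neumann_premises =
  relaxed_add_dom relaxed_dom_scale relaxed_parallelogram relaxed_scale(2) relaxed_nonneg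

lemma relaxed_polarization_diag:
  "F \<in> relaxed_dom M T \<Longrightarrow> polarization (relaxed M T) F F = relaxed M T F"
  by (rule polarization_diag[of "relaxed_dom M T", OF jordan_von_neumann_premises])

lemma relaxed_symmetric_form:
  "symmetric_form M (relaxed_dom M T) (polarization (relaxed M T))"
  unfolding symmetric_form_def
proof (intro conjI ballI allI impI)
  let ?D = "relaxed_dom M T" and ?Q = "polarization (relaxed M T)"
  note jvn = jordan_von_neumann_premises
  show "?D \<subseteq> L2_space M" using relaxed_dom_L2 by auto
  show "(\<lambda>x. 0) \<in> ?D" by (rule relaxed_domI[OF L2_zero rel_imp_relaxed_le[OF rel_zero]])
  fix F assume F: "F \<in> ?D"
  show "(\<lambda>x. c * F x) \<in> ?D" for c by (rule relaxed_dom_scale[OF F])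
  show "0 \<le> ?Q F F" using relaxed_polarization_diag[OF F] relaxed_nonneg[OF F] by simp
  show "?Q (\<lambda>x. c * F x) H = c * ?Q F H" if "H \<in> ?D" for c H
    by (rule polarization_mult[of ?D, OF jvn]) (use F that in auto)
  {
    fix G assume G: "G \<in> borel_measurable M" "AE x in M. F x = G x"
    have L2: "F \<in> L2_space M" "G \<in> L2_space M"
      using relaxed_dom_L2[OF F] L2_AE_cong[OF _ G] by auto
    show "G \<in> ?D"
      using relaxed_le_cong_AE[OF G(2) L2_measurable[OF L2(1)] G(1)] relaxed_le_relaxed[OF F] L2(2)
      by (auto intro: relaxed_domI)
    fix H assume H: "H \<in> ?D"
    have "relaxed_le M T (\<lambda>x. F x + H x) = relaxed_le M T (\<lambda>x. G x + H x)"
      "relaxed_le M T (\<lambda>x. F x - H x) = relaxed_le M T (\<lambda>x. G x - H x)"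
      using G L2[THEN L2_measurable] relaxed_dom_L2[OF H, THEN L2_measurable]
      by (intro ext relaxed_le_cong_AE; auto)+
    then show "?Q F H = ?Q G H" by (simp add: polarization_def relaxed_def)
  }
  fix G assume G: "G \<in> ?D"
  show "(\<lambda>x. F x + G x) \<in> ?D" by (rule relaxed_add_dom[OF F G])
  show "?Q F G = ?Q G F" by (rule polarization_commute[of ?D, OF jvn]) (use F G in auto)
  show "?Q (\<lambda>x. F x + G x) H = ?Q F H + ?Q G H" if "H \<in> ?D" for H
    by (rule polarization_add[of ?D, OF jvn]) (use F G that in auto)
qed

text \<open>
If the envelope is frequently below \<open>c\<close> along a convergent sequence, near its members there are functions of energy almost
\<open>c\<close>, and these are near the limit as well.
\<close>

lemma relaxed_lower_semicontinuous:
  "lower_semicontinuous_form M (relaxed_dom M T) (polarization (relaxed M T))"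
  unfolding lower_semicontinuous_form_def
proof (intro allI impI)
  let ?E = "extended_form (relaxed_dom M T) (polarization (relaxed M T))"
  fix u F assume u: "\<forall>n. u n \<in> L2_space M" and F: "F \<in> L2_space M" and conv: "L2_converges M u F"
  show "?E F \<le> liminf (\<lambda>n. ?E (u n))"
  proof (rule ccontr)
    assume "\<not> ?thesis"
    then have "liminf (\<lambda>n. ?E (u n)) < ?E F" by simp
    then obtain c where c: "liminf (\<lambda>n. ?E (u n)) < ereal c" "ereal c < ?E F"
      using ereal_dense2 by blast
    have "relaxed_le M T F c"
    proof (rule relaxed_le_closed[OF F])
      fix \<epsilon> :: real assume "0 < \<epsilon>"
      have "frequently (\<lambda>n. ?E (u n) < ereal c) sequentially"
        using c(1) by (rule contrapos_pp) (simp add: not_frequently not_less Liminf_bounded)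
      moreover have "eventually (\<lambda>n. sqdist M (u n) F < \<epsilon>) sequentially"
        using conv \<open>0 < \<epsilon>\<close> unfolding L2_converges_iff_sqdist by (rule order_tendstoD)
      ultimately have "frequently (\<lambda>n. ?E (u n) < ereal c \<and> sqdist M (u n) F < \<epsilon>) sequentially"
        by (rule frequently_eventually_frequently)
      from frequently_ex[OF this] obtain n where n: "?E (u n) < ereal c" "sqdist M (u n) F < \<epsilon>"
        by blast
      from n(1) have un: "u n \<in> relaxed_dom M T" unfolding extended_form_def by (rule contrapos_pp) simp
      then have "relaxed M T (u n) < c"
        using n relaxed_polarization_diag[OF un] by (simp add: extended_form_def)
      then have "relaxed_le M T (u n) (c + \<epsilon>)"
        using relaxed_le_mono[OF relaxed_le_relaxed[OF un]] \<open>0 < \<epsilon>\<close> by simp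
      then show "\<exists>G\<in>L2_space M. relaxed_le M T G (c + \<epsilon>) \<and> sqdist M G F < \<epsilon>"
        using n u by blast
    qed
    then have "F \<in> relaxed_dom M T" "relaxed M T F \<le> c"
      using F by (auto intro: relaxed_domI relaxed_least)
    then have "?E F \<le> ereal c" by (simp add: extended_form_def relaxed_polarization_diag)
    then show False using c(2) by simp
  qed
qed

end

text \<open>
The sublevel sets of the form are closed by lower semicontinuity and convex because it is quadratic and nonnegative.
\<close>

lemma (in prob_space) weakly_lower_semicontinuous:
  assumes form: "symmetric_form M D Q" and lsc: "lower_semicontinuous_form M D Q"
    and u: "\<And>n. u n \<in> L2_space M" and F: "F \<in> L2_space M" and weak: "L2_converges_weakly M u F"
  shows "extended_form D Q F \<le> liminf (\<lambda>n. extended_form D Q (u n))"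
proof (rule ccontr)
  assume "\<not> ?thesis"
  then have "liminf (\<lambda>n. extended_form D Q (u n)) < extended_form D Q F" by simp
  then obtain c where c: "liminf (\<lambda>n. extended_form D Q (u n)) < ereal c" "ereal c < extended_form D Q F"
    using ereal_dense2 by blast
  define C where "C = {v \<in> D. Q v v \<le> c}"
  have DL2: "\<And>v. v \<in> D \<Longrightarrow> v \<in> L2_space M" using form unfolding symmetric_form_def by blast
  have freq: "frequently (\<lambda>n. u n \<in> C) sequentially"
  proof -
    have "frequently (\<lambda>n. extended_form D Q (u n) < ereal c) sequentially"
      using c(1) by (rule contrapos_pp) (simp add: not_frequently not_less Liminf_bounded)
    then show ?thesis
      by (rule frequently_elim1) (auto simp: extended_form_def C_def split: if_splits)
  qed
  have "infinite {n. u n \<in> C}" 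
    using freq by (metis cofinite_eq_sequentially frequently_cofinite)
  from infinite_enumerate[OF this] obtain r
    where r: "strict_mono (r :: nat \<Rightarrow> nat)" and "\<forall>n. r n \<in> {n. u n \<in> C}" by blast
  then have rC: "u (r n) \<in> C" for n by simp
  have "F \<in> C"
  proof (rule convex_closed_imp_weakly_closed[where w = "\<lambda>n. u (r n)"])
    show "C \<subseteq> L2_space M" using DL2 by (auto simp: C_def)
    show "F \<in> L2_space M" by (rule F)
    show "u (r n) \<in> C" for n by (rule rC)
    show "L2_converges_weakly M (\<lambda>n. u (r n)) F"
      unfolding L2_converges_weakly_def
    proof
      fix G assume "G \<in> L2_space M"
      then have "(\<lambda>n. \<integral>x. u n x * G x \<partial>M) \<longlonglongrightarrow> (\<integral>x. F x * G x \<partial>M)"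
        using weak by (auto simp: L2_converges_weakly_def)
      from LIMSEQ_subseq_LIMSEQ[OF this r]
      show "(\<lambda>n. \<integral>x. u (r n) x * G x \<partial>M) \<longlonglongrightarrow> (\<integral>x. F x * G x \<partial>M)" by (simp add: comp_def)
    qed
    show "G \<in> C" if v: "\<And>n. v n \<in> C" and G: "G \<in> L2_space M" and conv: "L2_converges M v G" for v G
    proof -
      have "extended_form D Q G \<le> liminf (\<lambda>n. extended_form D Q (v n))"
        using lsc[unfolded lower_semicontinuous_form_def, rule_format, OF _ G conv] v DL2
        by (auto simp: C_def)
      also have "\<dots> \<le> liminf (\<lambda>n. ereal c)"
        using v by (intro Liminf_mono) (auto simp: C_def extended_form_def)
      also have "\<dots> = ereal c" by (simp add: Liminf_const)
      finally show ?thesis by (auto simp: C_def extended_form_def split: if_splits)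
    qed
    fix v w and t :: real assume v: "v \<in> C" and w: "w \<in> C" and t: "0 \<le> t" "t \<le> 1"
    have vw: "v \<in> D" "w \<in> D" using v w by (auto simp: C_def)
    note form' = form[unfolded symmetric_form_def]
    have add: "\<And>F G. F \<in> D \<Longrightarrow> G \<in> D \<Longrightarrow> (\<lambda>x. F x + G x) \<in> D" using form' by blast
    have scale: "\<And>c F. F \<in> D \<Longrightarrow> (\<lambda>x. c * F x) \<in> D" using form' by blast
    have Q_comm: "\<And>F G. F \<in> D \<Longrightarrow> G \<in> D \<Longrightarrow> Q F G = Q G F" using form' by blast
    have Q_add: "\<And>F G H. F \<in> D \<Longrightarrow> G \<in> D \<Longrightarrow> H \<in> D \<Longrightarrow> Q (\<lambda>x. F x + G x) H = Q F H + Q G H"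
      using form' by blast
    have Q_mult: "\<And>c F H. F \<in> D \<Longrightarrow> H \<in> D \<Longrightarrow> Q (\<lambda>x. c * F x) H = c * Q F H" using form' by blast
    have Q_nonneg: "\<And>F. F \<in> D \<Longrightarrow> 0 \<le> Q F F" using form' by blast
    have expand: "Q (\<lambda>x. a * v x + b * w x) (\<lambda>x. a * v x + b * w x) = a\<^sup>2 * Q v v + 2 * a * b * Q v w + b\<^sup>2 * Q w w"
      and comb: "(\<lambda>x. a * v x + b * w x) \<in> D" for a b
    proof -
      show s: "(\<lambda>x. a * v x + b * w x) \<in> D" by (intro add scale vw)
      have lin: "Q (\<lambda>x. a * v x + b * w x) H = a * Q v H + b * Q w H" if "H \<in> D" for H
        using that by (simp add: Q_add Q_mult scale vw)
      have "Q v (\<lambda>x. a * v x + b * w x) = a * Q v v + b * Q v w"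
        "Q w (\<lambda>x. a * v x + b * w x) = a * Q v w + b * Q w w"
        using Q_comm[OF vw(1) s] Q_comm[OF vw(2) s] lin[OF vw(1)] lin[OF vw(2)] Q_comm[OF vw] by auto
      then show "Q (\<lambda>x. a * v x + b * w x) (\<lambda>x. a * v x + b * w x) = a\<^sup>2 * Q v v + 2 * a * b * Q v w + b\<^sup>2 * Q w w"
        using lin[OF s] by (simp add: power2_eq_square algebra_simps)
    qed
    have "0 \<le> Q v v - 2 * Q v w + Q w w"
      using expand[of 1 "-1"] Q_nonneg[OF comb[of 1 "-1"]] by simp
    then have "2 * ((1 - t) * t) * Q v w \<le> ((1 - t) * t) * (Q v v + Q w w)"
      using t by (subst mult.commute[of 2], subst mult.assoc) (intro mult_left_mono, auto)
    then have "Q (\<lambda>x. (1 - t) * v x + t * w x) (\<lambda>x. (1 - t) * v x + t * w x)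
        \<le> (1 - t)\<^sup>2 * Q v v + ((1 - t) * t) * (Q v v + Q w w) + t\<^sup>2 * Q w w"
      unfolding expand by (simp only: mult.assoc)
    also have "\<dots> = (1 - t) * Q v v + t * Q w w"
      by (simp add: power2_eq_square algebra_simps)
    also have "\<dots> \<le> (1 - t) * c + t * c"
      using v w t by (intro add_mono mult_left_mono) (auto simp: C_def)
    also have "\<dots> = c" by (simp add: algebra_simps)
    finally show "(\<lambda>x. (1 - t) * v x + t * w x) \<in> C"
      using comb[of "1 - t" t] unfolding C_def by blast
  qed
  then show False using c(2) by (auto simp: C_def extended_form_def)
qed

section \<open>Smooth functions of finitely many variables\<close>

lemma C_infinity_cong_coords: "f \<in> C_infinity d \<Longrightarrow> (\<And>i. i < d \<Longrightarrow> x i = y i) \<Longrightarrow> f x = f y"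
  unfolding C_infinity_def by blast

lemma C_infinity_continuous: "f \<in> C_infinity d \<Longrightarrow> continuous_on UNIV f"
  unfolding C_infinity_def by (auto dest: bspec[of _ _ "[]"])

lemma C_infinity_differentiable:
  "f \<in> C_infinity d \<Longrightarrow> i < d \<Longrightarrow> (\<lambda>t. f (x(i := t))) differentiable (at (x i))"
  unfolding C_infinity_def by (auto dest!: bspec[of _ _ "[]"])

lemma C_infinity_DERIV:
  assumes "f \<in> C_infinity d" "i < d"
  shows "((\<lambda>t. f (x(i := t))) has_real_derivative pderivative i f (x(i := s))) (at s)"
  using C_infinity_differentiable[OF assms, of "x(i := s)"]
  by (simp add: pderivative_def DERIV_deriv_iff_real_differentiable)

lemma C_infinity_pderivative:
  assumes f: "f \<in> C_infinity d" and "i < d"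
  shows "pderivative i f \<in> C_infinity d"
proof -
  have "pderivative i f x = pderivative i f y" if "\<And>j. j < d \<Longrightarrow> x j = y j" for x y
  proof -
    have "(\<lambda>t. f (x(i := t))) = (\<lambda>t. f (y(i := t)))"
      using that by (intro ext C_infinity_cong_coords[OF f]) auto
    then show ?thesis using that[OF \<open>i < d\<close>] by (simp add: pderivative_def)
  qed
  moreover have "continuous_on UNIV (foldr pderivative is (pderivative i f)) \<and>
      (\<forall>j<d. \<forall>x. (\<lambda>t. foldr pderivative is (pderivative i f) (x(j := t))) differentiable (at (x j)))"
    if "is \<in> lists {..<d}" for "is"
  proof -
    have "is @ [i] \<in> lists {..<d}" using that \<open>i < d\<close> by auto
    then have "continuous_on UNIV (foldr pderivative (is @ [i]) f) \<and>
      (\<forall>j<d. \<forall>x. (\<lambda>t. foldr pderivative (is @ [i]) f (x(j := t))) differentiable (at (x j)))"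
      using f unfolding C_infinity_def by blast
    then show ?thesis by simp
  qed
  ultimately show ?thesis unfolding C_infinity_def by blast
qed

text \<open>
Iterated partial derivatives never leave a set that is closed under partial derivatives, so membership in such a set of
continuous and partially differentiable functions proves smoothness of all orders at once.
\<close>

lemma C_infinity_coinduct [consumes 1, case_names coords continuous differentiable pderivative]:
  assumes "f \<in> X"
    and coords: "\<And>f x y. f \<in> X \<Longrightarrow> (\<And>i. i < d \<Longrightarrow> x i = y i) \<Longrightarrow> f x = f y"
    and cont: "\<And>f. f \<in> X \<Longrightarrow> continuous_on UNIV f"
    and diff: "\<And>f i x. f \<in> X \<Longrightarrow> i < d \<Longrightarrow> (\<lambda>t. f (x(i := t))) differentiable (at (x i))"
    and pderiv: "\<And>f i. f \<in> X \<Longrightarrow> i < d \<Longrightarrow> pderivative i f \<in> X"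
  shows "f \<in> C_infinity d"
proof -
  have "foldr pderivative is f \<in> X" if "is \<in> lists {..<d}" for "is"
    using that by (induction "is") (auto simp: \<open>f \<in> X\<close> pderiv)
  then show ?thesis
    unfolding C_infinity_def using coords[OF \<open>f \<in> X\<close>] cont diff by blast
qed

lemma pderivative_eqI:
  "((\<lambda>t. f (x(i := t))) has_real_derivative D) (at (x i)) \<Longrightarrow> pderivative i f x = D"
  unfolding pderivative_def by (rule DERIV_imp_deriv)

lemma pderivative_const: "pderivative i (\<lambda>x. c) = (\<lambda>x. 0)"
  by (intro ext pderivative_eqI) auto

lemma C_infinity_const: "(\<lambda>x. c) \<in> C_infinity d"
proof -
  have "(\<lambda>x. c) \<in> range (\<lambda>c x. c)" by simp
  then show ?thesis by (rule C_infinity_coinduct) (auto simp: pderivative_const)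
qed

lemma pderivative_lincomb:
  assumes "f \<in> C_infinity d" "g \<in> C_infinity d" "i < d"
  shows "pderivative i (\<lambda>x. a * f x + b * g x) = (\<lambda>x. a * pderivative i f x + b * pderivative i g x)"
proof (intro ext pderivative_eqI)
  fix x
  show "((\<lambda>t. a * f (x(i := t)) + b * g (x(i := t))) has_real_derivative
      a * pderivative i f x + b * pderivative i g x) (at (x i))"
    using C_infinity_DERIV[OF assms(1,3), of x "x i"] C_infinity_DERIV[OF assms(2,3), of x "x i"]
    by (auto intro!: derivative_eq_intros)
qed

lemma C_infinity_lincomb:
  assumes "f \<in> C_infinity d" "g \<in> C_infinity d"
  shows "(\<lambda>x. a * f x + b * g x) \<in> C_infinity d"
proof -
  let ?X = "{\<lambda>x. a * f x + b * g x | f g. f \<in> C_infinity d \<and> g \<in> C_infinity d}"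
  have "(\<lambda>x. a * f x + b * g x) \<in> ?X" using assms by blast
  then show ?thesis
  proof (rule C_infinity_coinduct)
    fix h assume "h \<in> ?X"
    then obtain f g where f: "f \<in> C_infinity d" and g: "g \<in> C_infinity d"
      and h: "h = (\<lambda>x. a * f x + b * g x)" by auto
    show "h x = h y" if "\<And>i. i < d \<Longrightarrow> x i = y i" for x y
      using C_infinity_cong_coords[OF f that] C_infinity_cong_coords[OF g that] by (simp add: h)
    show "continuous_on UNIV h"
      unfolding h by (intro continuous_intros C_infinity_continuous[OF f] C_infinity_continuous[OF g])
    fix i assume i: "i < d"
    show "(\<lambda>t. h (x(i := t))) differentiable (at (x i))" for x
      unfolding h using C_infinity_differentiable[OF f i] C_infinity_differentiable[OF g i]
      by (intro derivative_intros) auto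
    have "pderivative i h = (\<lambda>x. a * pderivative i f x + b * pderivative i g x)"
      unfolding h by (rule pderivative_lincomb[OF f g i])
    then show "pderivative i h \<in> ?X"
      using C_infinity_pderivative[OF f i] C_infinity_pderivative[OF g i] by blast
  qed
qed

lemma C_infinity_sum:
  assumes "\<And>k. k \<in> A \<Longrightarrow> f k \<in> C_infinity d"
  shows "(\<lambda>x. \<Sum>k\<in>A. c k * f k x) \<in> C_infinity d"
  using assms
proof (induction A rule: infinite_finite_induct)
  case (insert k A)
  then show ?case using C_infinity_lincomb[of "f k" d "\<lambda>x. \<Sum>k\<in>A. c k * f k x" "c k" 1] by simp
qed (auto intro: C_infinity_const)

lemma tendsto_coordinatewise:
  fixes f :: "'a \<Rightarrow> 'b \<Rightarrow> 'c::topological_space"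
  assumes "\<And>i. ((\<lambda>x. f x i) \<longlongrightarrow> l i) F"
  shows "(f \<longlongrightarrow> l) F"
proof -
  have "limitin (product_topology (\<lambda>_. euclidean) UNIV) f l F"
    using assms by (subst limitin_componentwise) auto
  then show ?thesis by (simp add: euclidean_product_topology)
qed

text \<open>
The coordinates are moved one at a time. By the mean value theorem, moving the coordinate \<open>n\<close> contributes
\<open>s * v n\<close> times the partial derivative at an intermediate point, which tends to \<open>x\<close> as \<open>s \<rightarrow> 0\<close>.
\<close>

lemma C_infinity_directional_derivative:
  assumes f: "f \<in> C_infinity d"
  shows "((\<lambda>s. f (\<lambda>i. x i + s * v i)) has_real_derivative (\<Sum>i<d. v i * pderivative i f x)) (at 0)"
proof -
  define y where "y n s i = (if i < n then x i + s * v i else x i)" for n s and i :: nat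
  have "((\<lambda>s. f (y n s)) has_real_derivative (\<Sum>i<n. v i * pderivative i f x)) (at 0)" if "n \<le> d" for n
    using that
  proof (induction n)
    case 0
    then show ?case by (simp add: y_def)
  next
    case (Suc n)
    then have n: "n < d" by simp
    define \<phi> where "\<phi> s \<tau> = f ((y n s)(n := x n + \<tau> * (s * v n)))" for s \<tau>
    have \<phi>': "(\<phi> s has_real_derivative s * v n * pderivative n f ((y n s)(n := x n + \<tau> * (s * v n)))) (at \<tau>)" for s \<tau>
    proof -
      have "((\<lambda>\<tau>. x n + \<tau> * (s * v n)) has_real_derivative s * v n) (at \<tau>)"
        by (auto intro!: derivative_eq_intros)
      from DERIV_chain2[where f = "\<lambda>t. f ((y n s)(n := t))", OF C_infinity_DERIV[OF f n] this]
      show ?thesis by (simp add: \<phi>_def[abs_def] mult.commute)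
    qed
    have "\<exists>z. 0 < z \<and> z < 1 \<and> \<phi> s 1 - \<phi> s 0 = s * v n * pderivative n f ((y n s)(n := x n + z * (s * v n)))" for s
      using MVT2[of 0 1 "\<phi> s", OF _ \<phi>'] by auto
    then obtain z where z: "\<And>s. 0 < z s" "\<And>s. z s < 1"
      "\<And>s. \<phi> s 1 - \<phi> s 0 = s * v n * pderivative n f ((y n s)(n := x n + z s * (s * v n)))" by metis
    have \<phi>1: "\<phi> s 1 = f (y (Suc n) s)" for s
      unfolding \<phi>_def by (rule arg_cong[of _ _ f]) (auto simp: y_def)
    have \<phi>0: "\<phi> s 0 = f (y n s)" for s
      unfolding \<phi>_def by (rule arg_cong[of _ _ f]) (auto simp: y_def)
    have lim: "((\<lambda>s. (y n s)(n := x n + z s * (s * v n))) \<longlongrightarrow> x) (at 0)"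
    proof (rule tendsto_coordinatewise)
      fix i
      have "((\<lambda>s. x i + s * v i) \<longlongrightarrow> x i + 0 * v i) (at 0)" by (intro tendsto_intros)
      moreover have "((\<lambda>s. x n + z s * (s * v n)) \<longlongrightarrow> x n + 0) (at 0)"
      proof (intro tendsto_intros Lim_null_comparison[of "\<lambda>s. z s * (s * v n)" "\<lambda>s. \<bar>s * v n\<bar>"] always_eventually allI)
        show "norm (z s * (s * v n)) \<le> \<bar>s * v n\<bar>" for s
          using z(1)[of s] z(2)[of s] by (simp add: abs_mult mult_left_le_one_le)
        have "((\<lambda>s. \<bar>s * v n\<bar>) \<longlongrightarrow> \<bar>0 * v n\<bar>) (at 0)" by (intro tendsto_intros)
        then show "((\<lambda>s. \<bar>s * v n\<bar>) \<longlongrightarrow> 0) (at 0)" by simp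
      qed
      ultimately show "((\<lambda>s. ((y n s)(n := x n + z s * (s * v n))) i) \<longlongrightarrow> x i) (at 0)"
        by (cases "i = n"; cases "i < n") (simp_all add: y_def)
    qed
    have cont: "isCont (pderivative n f) x"
      using C_infinity_continuous[OF C_infinity_pderivative[OF f n]]
      by (simp add: continuous_on_eq_continuous_at)
    have "((\<lambda>s. \<phi> s 1 - \<phi> s 0) has_real_derivative v n * pderivative n f x) (at 0)"
      unfolding has_field_derivative_iff
    proof (rule Lim_transform_eventually)
      show "((\<lambda>s. v n * pderivative n f ((y n s)(n := x n + z s * (s * v n)))) \<longlongrightarrow> v n * pderivative n f x) (at 0)"
        by (intro tendsto_intros isCont_tendsto_compose[OF cont] lim)
      show "\<forall>\<^sub>F s in at 0. v n * pderivative n f ((y n s)(n := x n + z s * (s * v n))) =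
          (\<phi> s 1 - \<phi> s 0 - (\<phi> 0 1 - \<phi> 0 0)) / (s - 0)"
        unfolding z(3) by (auto simp: eventually_at_filter)
    qed
    from DERIV_add[OF Suc.IH this] n show ?case by (simp add: \<phi>0 \<phi>1 add.commute)
  qed
  from this[of d] have "((\<lambda>s. f (y d s)) has_real_derivative (\<Sum>i<d. v i * pderivative i f x)) (at 0)" by simp
  also have "(\<lambda>s. f (y d s)) = (\<lambda>s. f (\<lambda>i. x i + s * v i))"
    by (intro ext C_infinity_cong_coords[OF f]) (simp add: y_def)
  finally show ?thesis .
qed

definition linear_map :: "(nat \<Rightarrow> nat \<Rightarrow> real) \<Rightarrow> nat \<Rightarrow> (nat \<Rightarrow> real) \<Rightarrow> nat \<Rightarrow> real" where
  "linear_map c m y i = (\<Sum>j<m. c i j * y j)"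

lemma C_infinity_chain_rule:
  assumes f: "f \<in> C_infinity d" and j: "j < m"
  shows "((\<lambda>t. f (linear_map c m (y(j := t)))) has_real_derivative
      (\<Sum>i<d. c i j * pderivative i f (linear_map c m y))) (at (y j))"
proof -
  have upd: "linear_map c m (y(j := t)) = (\<lambda>i. linear_map c m y i + (t - y j) * c i j)" for t
  proof
    fix i
    have "linear_map c m (y(j := t)) i = (\<Sum>k<m. c i k * y k + (if k = j then (t - y j) * c i j else 0))"
      unfolding linear_map_def by (rule sum.cong) (auto simp: algebra_simps)
    also have "\<dots> = linear_map c m y i + (t - y j) * c i j"
      using j by (simp add: linear_map_def sum.distrib)
    finally show "linear_map c m (y(j := t)) i = linear_map c m y i + (t - y j) * c i j" .
  qed
  have sub: "((\<lambda>t. t - y j) has_real_derivative 1) (at (y j))"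
    by (auto intro!: derivative_eq_intros)
  have "((\<lambda>s. f (\<lambda>i. linear_map c m y i + s * c i j)) has_real_derivative
      (\<Sum>i<d. c i j * pderivative i f (linear_map c m y))) (at (y j - y j))"
    using C_infinity_directional_derivative[OF f] by simp
  from DERIV_chain2[where g = "\<lambda>t. t - y j", OF this sub] show ?thesis by (simp add: upd)
qed

lemma pderivative_linear_map:
  assumes "f \<in> C_infinity d" "j < m"
  shows "pderivative j (\<lambda>y. f (linear_map c m y)) =
    (\<lambda>y. \<Sum>i<d. c i j * pderivative i f (linear_map c m y))"
  by (intro ext pderivative_eqI C_infinity_chain_rule assms)

lemma continuous_linear_map: "continuous_on UNIV (linear_map c m)"
  unfolding linear_map_def
  by (intro continuous_on_coordinatewise_then_product continuous_on_sum continuous_on_mult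
      continuous_on_const continuous_on_product_coordinates)

text \<open>
By the chain rule a partial derivative of \<open>f \<circ> L\<close>, with \<open>L\<close> linear, is a linear combination of partial derivatives of
\<open>f\<close>, composed with \<open>L\<close>. So the functions of the form \<open>f \<circ> L\<close> are closed under partial derivatives.
\<close>

lemma C_infinity_linear_map:
  assumes "f \<in> C_infinity d"
  shows "(\<lambda>y. f (linear_map c m y)) \<in> C_infinity m"
proof -
  let ?X = "{\<lambda>y. f (linear_map c m y) | f. f \<in> C_infinity d}"
  have "(\<lambda>y. f (linear_map c m y)) \<in> ?X" using assms by blast
  then show ?thesis
  proof (rule C_infinity_coinduct)
    fix h x y assume "h \<in> ?X" "\<And>i. i < m \<Longrightarrow> x i = (y i :: real)"
    moreover from this(2) have "linear_map c m x = linear_map c m y"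
      by (auto simp: linear_map_def intro!: sum.cong)
    ultimately show "h x = h y" by auto
  next
    fix h assume "h \<in> ?X"
    then obtain f where f: "f \<in> C_infinity d" and h: "h = (\<lambda>y. f (linear_map c m y))" by auto
    show "continuous_on UNIV h"
      unfolding h by (rule continuous_on_compose2[OF C_infinity_continuous[OF f] continuous_linear_map]) simp
    fix j assume j: "j < m"
    show "(\<lambda>t. h (x(j := t))) differentiable (at (x j))" for x
      unfolding h real_differentiable_def using C_infinity_chain_rule[OF f j] by blast
    have "pderivative j h = (\<lambda>y. (\<lambda>z. \<Sum>i<d. c i j * pderivative i f z) (linear_map c m y))"
      unfolding h by (rule pderivative_linear_map[OF f j])
    moreover have "(\<lambda>z. \<Sum>i<d. c i j * pderivative i f z) \<in> C_infinity d"
      by (intro C_infinity_sum C_infinity_pderivative f) auto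
    ultimately show "pderivative j h \<in> ?X" by (intro CollectI exI conjI)
  qed
qed

section \<open>The mean measure of the Dirichlet process\<close>

lemma prob_space_beta_distribution:
  assumes "0 < a" "0 < b"
  shows "prob_space (beta_distribution a b)"
proof
  let ?f = "\<lambda>x::real. indicator {0<..<1} x * (x powr (a - 1) * (1 - x) powr (b - 1) / Beta a b)"
  have B: "0 < Beta a b"
    using assms by (simp add: Beta_def Gamma_real_pos)
  have "((\<lambda>t. t powr (a - 1) * (1 - t) powr (b - 1)) has_integral Beta a b) {0<..<1}"
    using has_integral_Beta_real[OF assms] by (simp add: has_integral_Icc_iff_Ioo)
  then have "((\<lambda>t. t powr (a - 1) * (1 - t) powr (b - 1) / Beta a b) has_integral Beta a b / Beta a b) {0<..<1}"
    by (rule has_integral_divide)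
  moreover have "?f = (\<lambda>t. if t \<in> {0<..<1} then t powr (a - 1) * (1 - t) powr (b - 1) / Beta a b else 0)"
    by auto
  ultimately have "(?f has_integral 1) UNIV"
    using B by (simp only: has_integral_restrict_UNIV) simp
  then have "(\<integral>\<^sup>+x. ennreal (?f x) \<partial>lborel) = ennreal 1"
    using B by (intro nn_integral_has_integral_lborel) (auto simp: indicator_def)
  then show "emeasure (beta_distribution a b) (space (beta_distribution a b)) = 1"
    unfolding beta_distribution_def by (subst emeasure_density) auto
qed

text \<open>
Order the indices by decreasing value, equal values by the index itself. Since the values are positive and tend to \<open>0\<close>, every
index has finitely many predecessors; their number is its position in the rearrangement.
\<close>

lemma ex_decreasing_rearrangement:
  fixes v :: "nat \<Rightarrow> real"
  assumes pos: "\<And>n. 0 < v n" and lim: "v \<longlonglongrightarrow> 0"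
  shows "\<exists>\<sigma>. bij \<sigma> \<and> decseq (v \<circ> \<sigma>)"
proof -
  define before where "before j i \<longleftrightarrow> v j > v i \<or> (v j = v i \<and> j < i)" for j i
  define rank where "rank i = card {j. before j i}" for i
  have fin: "finite {j. before j i}" for i
  proof -
    obtain N where "\<And>n. n \<ge> N \<Longrightarrow> v n < v i"
      using order_tendstoD(2)[OF lim pos[of i]] by (auto simp: eventually_sequentially)
    then have "{j. before j i} \<subseteq> {..<N}"
      by (force simp: before_def not_le[symmetric])
    then show ?thesis using finite_subset by blast
  qed
  have rank_less: "rank j < rank i" if "before j i" for i j
    unfolding rank_def
  proof (rule psubset_card_mono[OF fin])
    show "{k. before k j} \<subset> {k. before k i}"
      using that by (auto simp: before_def)
  qed
  have total: "i = j \<or> before i j \<or> before j i" for i j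
    by (auto simp: before_def)
  have inj: "inj rank"
    by (rule injI) (metis rank_less total less_irrefl)
  have seg: "rank ` {j. before j i} = {..<rank i}" for i
  proof (rule card_subset_eq)
    show "rank ` {j. before j i} \<subseteq> {..<rank i}" using rank_less by auto
    have "card (rank ` {j. before j i}) = card {j. before j i}"
      by (intro card_image inj_on_subset[OF inj]) simp
    then show "card (rank ` {j. before j i}) = card {..<rank i}"
      by (simp only: rank_def card_lessThan)
  qed simp
  have "surj rank"
  proof (rule ccontr)
    assume "\<not> surj rank"
    then obtain n where n: "n \<notin> range rank" by auto
    have "range rank \<subseteq> {..<n}"
    proof
      fix m assume "m \<in> range rank"
      then obtain i where i: "m = rank i" by auto
      have "n \<notin> {..<rank i}" unfolding seg[symmetric] using n by auto
      then have "m \<le> n" using i by simp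
      moreover have "m \<noteq> n" using n \<open>m \<in> range rank\<close> by auto
      ultimately show "m \<in> {..<n}" by simp
    qed
    then have "finite (range rank)" using finite_subset by blast
    then show False using inj finite_imageD by blast
  qed
  then have bij: "bij rank" using inj by (simp add: bij_def)
  have "decseq (v \<circ> inv rank)"
  proof (rule decseq_SucI, rule ccontr)
    fix n assume "\<not> (v \<circ> inv rank) (Suc n) \<le> (v \<circ> inv rank) n"
    then have "before (inv rank (Suc n)) (inv rank n)" by (simp add: before_def)
    from rank_less[OF this] show False
      using surj_f_inv_f[OF \<open>surj rank\<close>] by simp
  qed
  then show ?thesis using bij bij_imp_bij_inv by blast
qed

text \<open>
The right-hand side does not mention the rearrangement. It therefore shows both that the decreasing rearrangement is unique
and, quantifying over countably many lists only, that it depends measurably on \<open>v\<close>.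
\<close>

lemma less_decreasing_rearrangement_iff:
  fixes v p :: "nat \<Rightarrow> real"
  assumes p: "decseq p" "bij \<sigma>" "p = v \<circ> \<sigma>"
  shows "t < p n \<longleftrightarrow> (\<exists>ks. distinct ks \<and> length ks = Suc n \<and> (\<forall>k\<in>set ks. t < v k))"
proof
  assume t: "t < p n"
  let ?ks = "map \<sigma> [0..<Suc n]"
  have "distinct ?ks" "length ?ks = Suc n"
    using p(2) by (auto simp: distinct_map bij_def simp del: upt_Suc intro: inj_on_subset)
  moreover have "\<forall>k\<in>set ?ks. t < v k"
  proof
    fix k assume "k \<in> set ?ks"
    then obtain i where i: "k = \<sigma> i" "i \<le> n" by (auto simp: less_Suc_eq_le simp del: upt_Suc)
    then have "p n \<le> p i" using p(1) by (auto simp: decseq_def)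
    then show "t < v k" using t p(3) i by simp
  qed
  ultimately show "\<exists>ks. distinct ks \<and> length ks = Suc n \<and> (\<forall>k\<in>set ks. t < v k)" by blast
next
  assume "\<exists>ks. distinct ks \<and> length ks = Suc n \<and> (\<forall>k\<in>set ks. t < v k)"
  then obtain ks where ks: "distinct ks" "length ks = Suc n" "\<And>k. k \<in> set ks \<Longrightarrow> t < v k" by blast
  have inj: "inj_on (inv \<sigma>) (set ks)"
    using bij_is_inj[OF bij_imp_bij_inv[OF p(2)]] by (rule inj_on_subset) simp
  have "card (inv \<sigma> ` set ks) = Suc n"
    using ks by (simp add: card_image[OF inj] distinct_card)
  then have "\<not> inv \<sigma> ` set ks \<subseteq> {..<n}"
    using card_mono[of "{..<n}" "inv \<sigma> ` set ks"] by auto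
  then obtain k where k: "k \<in> set ks" "n \<le> inv \<sigma> k"
    by (meson image_subsetI lessThan_iff not_le)
  have "t < v k" using ks k by simp
  also have "v k = p (inv \<sigma> k)" using p(2,3) by (simp add: bij_is_surj surj_f_inv_f)
  also have "\<dots> \<le> p n" using p(1) k(2) by (auto simp: decseq_def)
  finally show "t < p n" .
qed

lemma descending_rearrangement:
  assumes pos: "\<And>n. 0 < v n" and lim: "v \<longlonglongrightarrow> 0"
  shows "decseq (descending v) \<and> (\<exists>\<sigma>. bij \<sigma> \<and> descending v = v \<circ> \<sigma>)"
  unfolding descending_def
proof (rule theI'[of "\<lambda>p. decseq p \<and> (\<exists>\<sigma>. bij \<sigma> \<and> p = v \<circ> \<sigma>)"])
  obtain \<sigma> where \<sigma>: "bij \<sigma>" "decseq (v \<circ> \<sigma>)"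
    using ex_decreasing_rearrangement[OF assms] by blast
  show "\<exists>!p. decseq p \<and> (\<exists>\<sigma>. bij \<sigma> \<and> p = v \<circ> \<sigma>)"
  proof (rule ex1I[of _ "v \<circ> \<sigma>"])
    show "decseq (v \<circ> \<sigma>) \<and> (\<exists>\<sigma>'. bij \<sigma>' \<and> v \<circ> \<sigma> = v \<circ> \<sigma>')" using \<sigma> by blast
    fix p assume "decseq p \<and> (\<exists>\<sigma>. bij \<sigma> \<and> p = v \<circ> \<sigma>)"
    then obtain \<tau> where "decseq p" "bij \<tau>" "p = v \<circ> \<tau>" by blast
    then have "t < p n \<longleftrightarrow> t < (v \<circ> \<sigma>) n" for t n
      using less_decreasing_rearrangement_iff \<sigma> by metis
    then show "p = v \<circ> \<sigma>" by (intro ext) (metis less_irrefl linorder_neqE)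
  qed
qed

lemma descending_properties:
  assumes pos: "\<And>n. 0 < v n" and sums: "v sums 1"
  shows "t < descending v n \<longleftrightarrow> (\<exists>ks. distinct ks \<and> length ks = Suc n \<and> (\<forall>k\<in>set ks. t < v k))"
    and "0 < descending v n"
    and "(\<Sum>k. ennreal (descending v k)) = 1"
proof -
  have lim: "v \<longlonglongrightarrow> 0" using sums by (intro summable_LIMSEQ_zero) (auto simp: sums_iff)
  obtain \<sigma> where \<sigma>: "decseq (descending v)" "bij \<sigma>" "descending v = v \<circ> \<sigma>"
    using descending_rearrangement[OF pos lim] by blast
  show "t < descending v n \<longleftrightarrow> (\<exists>ks. distinct ks \<and> length ks = Suc n \<and> (\<forall>k\<in>set ks. t < v k))"
    by (rule less_decreasing_rearrangement_iff[OF \<sigma>])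
  show "0 < descending v n" using pos \<sigma>(3) by simp
  have "(\<Sum>k. ennreal (descending v k)) = (\<integral>\<^sup>+k. ennreal (v (\<sigma> k)) \<partial>count_space UNIV)"
    using \<sigma>(3) by (simp add: nn_integral_count_space_nat)
  also have "\<dots> = (\<integral>\<^sup>+k. ennreal (v k) \<partial>count_space UNIV)"
    using \<sigma>(2) by (rule nn_integral_bij_count_space)
  also have "\<dots> = ennreal 1"
    unfolding nn_integral_count_space_nat using less_imp_le[OF pos] sums by (intro suminf_ennreal_eq) auto
  finally show "(\<Sum>k. ennreal (descending v k)) = 1" by simp
qed

text \<open>
Measurability of the event that the sticks exhaust the unit interval is immediate for the sum in \<open>[0, \<infinity>]\<close>.
\<close>

lemma positive_sums_1_iff:
  fixes v :: "nat \<Rightarrow> real"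
  assumes "\<And>n. 0 < v n"
  shows "v sums 1 \<longleftrightarrow> (\<Sum>n. ennreal (v n)) = 1"
proof
  have nonneg: "0 \<le> v n" for n using assms[of n] by simp
  show "(\<Sum>n. ennreal (v n)) = 1" if "v sums 1"
    using suminf_ennreal_eq[OF nonneg that] by simp
  assume sum: "(\<Sum>n. ennreal (v n)) = 1"
  have summable: "summable v"
    by (rule summable_suminf_not_top[OF nonneg]) (simp add: sum)
  have "ennreal (\<Sum>n. v n) = ennreal 1"
    using suminf_ennreal2[OF nonneg summable] sum by simp
  then have "(\<Sum>n. v n) = 1"
    by (subst (asm) ennreal_inj) (use suminf_nonneg[OF summable nonneg] in auto)
  then show "v sums 1" using summable by (simp add: sums_iff)
qed

lemma nn_integral_atomic_measure:
  assumes "\<psi> \<in> borel_measurable borel"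
  shows "(\<integral>\<^sup>+x. \<psi> x \<partial>atomic_measure p \<xi>) = (\<Sum>k. ennreal (p k) * \<psi> (\<xi> k))"
proof -
  have "(\<integral>\<^sup>+x. \<psi> x \<partial>atomic_measure p \<xi>) = (\<integral>\<^sup>+k. \<psi> (\<xi> k) \<partial>density (count_space UNIV) (\<lambda>k. ennreal (p k)))"
    unfolding atomic_measure_def using assms by (intro nn_integral_distr) auto
  also have "\<dots> = (\<integral>\<^sup>+k. ennreal (p k) * \<psi> (\<xi> k) \<partial>count_space UNIV)"
    by (intro nn_integral_density) auto
  finally show ?thesis by (simp add: nn_integral_count_space_nat)
qed

lemma measurable_nn_integral_prob_algebra:
  "f \<in> borel_measurable N \<Longrightarrow> (\<lambda>\<mu>. \<integral>\<^sup>+x. f x \<partial>\<mu>) \<in> borel_measurable (prob_algebra N)"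
  unfolding prob_algebra_def
  by (intro measurable_restrict_space1 nn_integral_measurable_subprob_algebra)

text \<open>
The random measure has the atoms \<open>\<xi>\<^sub>k\<close>, of law \<open>\<nu>\<close>, with weights that are independent of them. Integrating over the atoms
first gives \<open>\<nu>\<close> times the sum of the weights, which is \<open>1\<close>. On the exceptional event the random measure is
\<open>\<nu>\<close> itself, so its mean there is \<open>\<nu>\<close> as well.
\<close>

lemma
  fixes \<nu> :: "'a::topological_space measure"
  assumes \<alpha>: "0 \<le> \<alpha>" "\<alpha> < 1" and \<theta>: "- \<alpha> < \<theta>" and "prob_space \<nu>" and sets_\<nu>: "sets \<nu> = sets borel"
  shows prob_space_dirichlet_process: "prob_space (dirichlet_process \<alpha> \<theta> \<nu>)"
    and sets_dirichlet_process: "sets (dirichlet_process \<alpha> \<theta> \<nu>) = sets (prob_algebra borel)"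
    and mean_dirichlet_process: "\<psi> \<in> borel_measurable borel \<Longrightarrow>
      (\<integral>\<^sup>+\<mu>. (\<integral>\<^sup>+x. \<psi> x \<partial>\<mu>) \<partial>dirichlet_process \<alpha> \<theta> \<nu>) = (\<integral>\<^sup>+x. \<psi> x \<partial>\<nu>)"
proof -
  interpret \<nu>: prob_space \<nu> by fact
  define b where "b k = beta_distribution (1 - \<alpha>) (\<theta> + real (Suc k) * \<alpha>)" for k
  define U where "U = (\<Pi>\<^sub>M k\<in>UNIV. b k)"
  define X where "X = (\<Pi>\<^sub>M k\<in>(UNIV :: nat set). \<nu>)"
  have b: "prob_space (b k)" for k
    unfolding b_def
  proof (rule prob_space_beta_distribution)
    have "1 * \<alpha> \<le> real (Suc k) * \<alpha>" using \<alpha> by (intro mult_right_mono) auto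
    then show "0 < \<theta> + real (Suc k) * \<alpha>" using \<theta> by simp
  qed (use \<alpha> in simp)
  have [measurable_cong]: "sets (b k) = sets borel" for k
    by (simp add: b_def beta_distribution_def)
  note sets_\<nu>[measurable_cong]
  interpret U: prob_space U unfolding U_def by (intro prob_space_PiM b)
  interpret X: prob_space X unfolding X_def by (intro prob_space_PiM \<nu>.prob_space_axioms)
  interpret UX: pair_prob_space U X ..
  have u_meas [measurable]: "(\<lambda>u. u n) \<in> borel_measurable U" for n
  proof -
    have "(\<lambda>u. u n) \<in> measurable U (b n)" unfolding U_def by (rule measurable_component_singleton) simp
    then show ?thesis by (simp cong: measurable_cong_sets add: \<open>\<And>k. sets (b k) = sets borel\<close>)
  qed
  have x_meas [measurable]: "(\<lambda>\<xi>. \<xi> n) \<in> borel_measurable X" for n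
  proof -
    have "(\<lambda>\<xi>. \<xi> n) \<in> measurable X \<nu>" unfolding X_def by (rule measurable_component_singleton) simp
    then show ?thesis by (simp cong: measurable_cong_sets add: sets_\<nu>)
  qed
  have [measurable]: "(\<lambda>u. stick_breaking u n) \<in> borel_measurable U" for n
    unfolding stick_breaking_def by measurable
  define good where "good u \<longleftrightarrow> (\<forall>n. 0 < stick_breaking u n) \<and> stick_breaking u sums 1" for u
  have good_iff: "good u \<longleftrightarrow> (\<forall>n. 0 < stick_breaking u n) \<and> (\<Sum>n. ennreal (stick_breaking u n)) = 1" for u
    unfolding good_def using positive_sums_1_iff[of "stick_breaking u"] by blast
  have [measurable]: "Measurable.pred U good"
    unfolding good_iff[abs_def] by measurable
  \<comment> \<open>Off the good event, where \<open>descending\<close> may be arbitrary, the weights are set to \<open>0\<close> to be measurable.\<close>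
  define w where "w k u = (if good u then descending (stick_breaking u) k else 0)" for k u
  have [measurable]: "w k \<in> borel_measurable U" for k
  proof (rule borel_measurableI_greater)
    fix t
    have iff: "t < w k u \<longleftrightarrow>
      (good u \<and> (\<exists>ks. distinct ks \<and> length ks = Suc k \<and> (\<forall>i\<in>set ks. t < stick_breaking u i))) \<or> (\<not> good u \<and> t < 0)" for u
    proof (cases "good u")
      case True
      then have "t < descending (stick_breaking u) k \<longleftrightarrow>
          (\<exists>ks. distinct ks \<and> length ks = Suc k \<and> (\<forall>i\<in>set ks. t < stick_breaking u i))"
        by (intro descending_properties(1)) (auto simp: good_def)
      then show ?thesis using True by (simp add: w_def)
    qed (simp add: w_def)
    show "{u \<in> space U. t < w k u} \<in> sets U"
      unfolding iff by measurable
  qed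
  have w_sum: "(\<Sum>k. ennreal (w k u)) = 1" if "good u" for u
    using that descending_properties(3)[of "stick_breaking u"] by (simp add: w_def good_def)
  define \<Phi> where "\<Phi> = (\<lambda>(u, \<xi>). if good u then atomic_measure (descending (stick_breaking u)) \<xi> else \<nu>)"
  have nn_\<Phi>: "(\<integral>\<^sup>+x. \<psi> x \<partial>\<Phi> (u, \<xi>)) = (if good u then (\<Sum>k. ennreal (w k u) * \<psi> (\<xi> k)) else (\<integral>\<^sup>+x. \<psi> x \<partial>\<nu>))"
    if "\<psi> \<in> borel_measurable borel" for \<psi> u \<xi>
    using nn_integral_atomic_measure[OF that] by (simp add: \<Phi>_def w_def)
  have sets_\<Phi>: "sets (\<Phi> z) = sets borel" for z
    by (auto simp: \<Phi>_def atomic_measure_def sets_\<nu> split: prod.split)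
  have \<Phi>_emeasure: "emeasure (\<Phi> (u, \<xi>)) A = (if good u then (\<Sum>k. ennreal (w k u) * indicator A (\<xi> k)) else emeasure \<nu> A)"
    if A: "A \<in> sets borel" for A u \<xi>
    using nn_\<Phi>[of "indicator A" u \<xi>] A nn_integral_indicator[of A "\<Phi> (u, \<xi>)"] nn_integral_indicator[of A \<nu>]
    by (simp add: sets_\<Phi> sets_\<nu>)
  have \<Phi>_prob: "prob_space (\<Phi> z)" for z
  proof
    obtain u \<xi> where z: "z = (u, \<xi>)" by (cases z)
    have "space (\<Phi> z) = UNIV" "space \<nu> = UNIV" using sets_eq_imp_space_eq[OF sets_\<Phi>] sets_eq_imp_space_eq[OF sets_\<nu>] by auto
    then show "emeasure (\<Phi> z) (space (\<Phi> z)) = 1"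
      using \<Phi>_emeasure[of UNIV u \<xi>] w_sum[of u] \<nu>.emeasure_space_1 by (simp add: z)
  qed
  have \<Phi>_meas: "\<Phi> \<in> measurable (U \<Otimes>\<^sub>M X) (prob_algebra borel)"
  proof (rule measurable_prob_algebraI)
    show "prob_space (\<Phi> z)" for z by (rule \<Phi>_prob)
    show "\<Phi> \<in> measurable (U \<Otimes>\<^sub>M X) (subprob_algebra borel)"
    proof (rule measurable_subprob_algebra)
      show "subprob_space (\<Phi> z)" for z by (rule prob_space_imp_subprob_space[OF \<Phi>_prob])
      show "sets (\<Phi> z) = sets borel" for z by (rule sets_\<Phi>)
      fix A :: "'a set" assume [measurable]: "A \<in> sets borel"
      have "(\<lambda>z. emeasure (\<Phi> z) A) = (\<lambda>z. if good (fst z) then (\<Sum>k. ennreal (w k (fst z)) * indicator A (snd z k)) else emeasure \<nu> A)"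
        using \<Phi>_emeasure[OF \<open>A \<in> sets borel\<close>] by (auto simp: fun_eq_iff)
      also have "\<dots> \<in> borel_measurable (U \<Otimes>\<^sub>M X)"
        by measurable
      finally show "(\<lambda>z. emeasure (\<Phi> z) A) \<in> borel_measurable (U \<Otimes>\<^sub>M X)" .
    qed
  qed
  have dir: "dirichlet_process \<alpha> \<theta> \<nu> = distr (U \<Otimes>\<^sub>M X) (prob_algebra borel) \<Phi>"
    unfolding dirichlet_process_def U_def X_def b_def \<Phi>_def good_def ..
  show "prob_space (dirichlet_process \<alpha> \<theta> \<nu>)"
    unfolding dir by (rule UX.prob_space_distr[OF \<Phi>_meas])
  show "sets (dirichlet_process \<alpha> \<theta> \<nu>) = sets (prob_algebra borel)"
    unfolding dir by simp
  assume \<psi> [measurable]: "\<psi> \<in> borel_measurable borel"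
  have X_marginal: "(\<integral>\<^sup>+\<xi>. \<psi> (\<xi> k) \<partial>X) = (\<integral>\<^sup>+x. \<psi> x \<partial>\<nu>)" for k
  proof -
    have "distr X \<nu> (\<lambda>\<xi>. \<xi> k) = \<nu>"
      unfolding X_def using distr_PiM_component[of UNIV "\<lambda>_. \<nu>" k] \<nu>.prob_space_axioms by simp
    then have "(\<integral>\<^sup>+x. \<psi> x \<partial>\<nu>) = (\<integral>\<^sup>+x. \<psi> x \<partial>distr X \<nu> (\<lambda>\<xi>. \<xi> k))" by simp
    also have "\<dots> = (\<integral>\<^sup>+\<xi>. \<psi> (\<xi> k) \<partial>X)"
    proof (rule nn_integral_distr)
      show "(\<lambda>\<xi>. \<xi> k) \<in> measurable X \<nu>" unfolding X_def by (rule measurable_component_singleton) simp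
      show "\<psi> \<in> borel_measurable (distr X \<nu> (\<lambda>\<xi>. \<xi> k))" using \<psi> by (simp cong: measurable_cong_sets add: sets_\<nu>)
    qed
    finally show ?thesis by simp
  qed
  have "(\<integral>\<^sup>+\<mu>. (\<integral>\<^sup>+x. \<psi> x \<partial>\<mu>) \<partial>dirichlet_process \<alpha> \<theta> \<nu>) = (\<integral>\<^sup>+z. (\<integral>\<^sup>+x. \<psi> x \<partial>\<Phi> z) \<partial>(U \<Otimes>\<^sub>M X))"
    unfolding dir
  proof (rule nn_integral_distr[OF \<Phi>_meas])
    show "(\<lambda>\<mu>. \<integral>\<^sup>+x. \<psi> x \<partial>\<mu>) \<in> borel_measurable (distr (U \<Otimes>\<^sub>M X) (prob_algebra borel) \<Phi>)"
      using measurable_nn_integral_prob_algebra[OF \<psi>] by simp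
  qed
  also have "\<dots> = (\<integral>\<^sup>+z. (if good (fst z) then (\<Sum>k. ennreal (w k (fst z)) * \<psi> (snd z k)) else (\<integral>\<^sup>+x. \<psi> x \<partial>\<nu>)) \<partial>(U \<Otimes>\<^sub>M X))"
    using nn_\<Phi>[OF \<psi>] by (intro nn_integral_cong) (auto split: prod.split)
  also have "\<dots> = (\<integral>\<^sup>+u. (\<integral>\<^sup>+\<xi>. (if good u then (\<Sum>k. ennreal (w k u) * \<psi> (\<xi> k)) else (\<integral>\<^sup>+x. \<psi> x \<partial>\<nu>)) \<partial>X) \<partial>U)"
    by (subst X.nn_integral_fst[symmetric]) (auto cong: if_cong)
  also have "\<dots> = (\<integral>\<^sup>+u. (\<integral>\<^sup>+x. \<psi> x \<partial>\<nu>) \<partial>U)"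
  proof (rule nn_integral_cong)
    fix u
    show "(\<integral>\<^sup>+\<xi>. (if good u then (\<Sum>k. ennreal (w k u) * \<psi> (\<xi> k)) else (\<integral>\<^sup>+x. \<psi> x \<partial>\<nu>)) \<partial>X) = (\<integral>\<^sup>+x. \<psi> x \<partial>\<nu>)"
    proof (cases "good u")
      case True
      have "(\<integral>\<^sup>+\<xi>. (\<Sum>k. ennreal (w k u) * \<psi> (\<xi> k)) \<partial>X) = (\<Sum>k. ennreal (w k u) * (\<integral>\<^sup>+\<xi>. \<psi> (\<xi> k) \<partial>X))"
        by (subst nn_integral_suminf) (auto simp: nn_integral_cmult)
      also have "\<dots> = (\<Sum>k. ennreal (w k u)) * (\<integral>\<^sup>+x. \<psi> x \<partial>\<nu>)"
        by (simp add: X_marginal)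
      finally show ?thesis using True w_sum by simp
    qed (simp add: X.emeasure_space_1)
  qed
  also have "\<dots> = (\<integral>\<^sup>+x. \<psi> x \<partial>\<nu>)" by (simp add: U.emeasure_space_1)
  finally show "(\<integral>\<^sup>+\<mu>. (\<integral>\<^sup>+x. \<psi> x \<partial>\<mu>) \<partial>dirichlet_process \<alpha> \<theta> \<nu>) = (\<integral>\<^sup>+x. \<psi> x \<partial>\<nu>)" .
qed

section \<open>Approximation by step functions\<close>

locale generating_partitions =
  fixes \<nu> :: "'a::topological_space measure" and B :: "nat \<Rightarrow> nat \<Rightarrow> 'a set"
  assumes prob: "prob_space \<nu>" and sets_\<nu>: "sets \<nu> = sets borel"
    and partitions: "dyadic_partitions \<nu> B"
    and generating: "\<And>A. A \<in> sets borel \<Longrightarrow>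
      \<exists>A' \<in> sigma_sets UNIV {B k j | k j. 1 \<le> k \<and> j \<in> {1..2 ^ k}}.
        emeasure \<nu> ((A - A') \<union> (A' - A)) = 0"
begin

sublocale \<nu>: prob_space \<nu> by (rule prob)

lemma space_\<nu>: "space \<nu> = UNIV"
  using sets_eq_imp_space_eq[OF sets_\<nu>] by simp

lemma borel_measurable_\<nu>: "borel_measurable \<nu> = borel_measurable borel"
  by (rule measurable_cong_sets[OF sets_\<nu> refl])

lemma cell_disjoint: "1 \<le> k \<Longrightarrow> i \<in> {1..2 ^ k} \<Longrightarrow> j \<in> {1..2 ^ k} \<Longrightarrow> x \<in> B k i \<Longrightarrow> x \<in> B k j \<Longrightarrow> i = j"
  using partitions unfolding dyadic_partitions_def disjoint_family_on_def by blast

lemma cell_cover: "1 \<le> k \<Longrightarrow> \<exists>j\<in>{1..2 ^ k}. x \<in> B k j"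
  using partitions unfolding dyadic_partitions_def by blast

lemma cell_measurable: "1 \<le> k \<Longrightarrow> j \<in> {1..2 ^ k} \<Longrightarrow> B k j \<in> sets borel"
  using partitions unfolding dyadic_partitions_def by blast

lemma cell_measure: "1 \<le> k \<Longrightarrow> j \<in> {1..2 ^ k} \<Longrightarrow> measure \<nu> (B k j) = 1 / 2 ^ k"
  using partitions unfolding dyadic_partitions_def by blast

lemma cell_split: "1 \<le> k \<Longrightarrow> j \<in> {1..2 ^ k} \<Longrightarrow> B k j = B (Suc k) (2 * j - 1) \<union> B (Suc k) (2 * j)"
  using partitions unfolding dyadic_partitions_def by blast

text \<open>
Step functions are described by their values, not as combinations of indicators: in this form it is evident that they form
an algebra and grow with the generation \<open>k\<close>.
\<close>

definition step :: "nat \<Rightarrow> ('a \<Rightarrow> real) \<Rightarrow> bool" where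
  "step k \<psi> \<longleftrightarrow> (\<forall>j\<in>{1..2 ^ k}. \<forall>x\<in>B k j. \<forall>y\<in>B k j. \<psi> x = \<psi> y)"

lemma step_Suc:
  assumes k: "1 \<le> k" and "step k \<psi>"
  shows "step (Suc k) \<psi>"
  unfolding step_def
proof (intro ballI)
  fix j x y assume j: "j \<in> {1..2 ^ Suc k}" and xy: "x \<in> B (Suc k) j" "y \<in> B (Suc k) j"
  define i where "i = (j + 1) div 2"
  have i: "i \<in> {1..2 ^ k}" using j by (auto simp: i_def)
  have "j = 2 * i - 1 \<or> j = 2 * i" using j by (auto simp: i_def)
  then have "B (Suc k) j \<subseteq> B k i" using cell_split[OF k i] by auto
  then show "\<psi> x = \<psi> y" using \<open>step k \<psi>\<close> i xy unfolding step_def by blast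
qed

lemma step_mono:
  assumes "1 \<le> k" "step k \<psi>" "k \<le> k'"
  shows "step k' \<psi>"
  using assms(3)
proof (induction k' rule: dec_induct)
  case (step n)
  then show ?case using assms(1) by (intro step_Suc) auto
qed (rule assms(2))

lemma step_comp2: "step k \<psi> \<Longrightarrow> step k \<psi>' \<Longrightarrow> step k (\<lambda>x. h (\<psi> x) (\<psi>' x))"
  unfolding step_def by (intro ballI arg_cong2[where f = h]) blast+

lemma step_cell:
  assumes "1 \<le> k" "j \<in> {1..2 ^ k}"
  shows "step k (indicator (B k j))"
  unfolding step_def
proof (intro ballI)
  fix i x y assume "i \<in> {1..2 ^ k}" "x \<in> B k i" "y \<in> B k i"
  then have "x \<in> B k j \<longleftrightarrow> y \<in> B k j" using cell_disjoint[OF assms(1)] assms(2) by blast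
  then show "indicator (B k j) x = (indicator (B k j) y :: real)" by (simp add: indicator_def)
qed

lemma step_representation:
  assumes k: "1 \<le> k" and \<psi>: "step k \<psi>"
  obtains c where "\<And>x. \<psi> x = (\<Sum>j\<in>{1..2 ^ k}. c j * indicator (B k j) x)"
proof -
  define c where "c j = \<psi> (SOME x. x \<in> B k j)" for j
  have "\<psi> x = (\<Sum>j\<in>{1..2 ^ k}. c j * indicator (B k j) x)" for x
  proof -
    obtain i where i: "i \<in> {1..2 ^ k}" "x \<in> B k i" using cell_cover[OF k] by blast
    have "(SOME x. x \<in> B k i) \<in> B k i" using i(2) by (rule someI)
    then have c: "c i = \<psi> x" unfolding c_def using \<psi> i unfolding step_def by blast
    have "(\<Sum>j\<in>{1..2 ^ k}. c j * indicator (B k j) x) = (\<Sum>j\<in>{1..2 ^ k}. if j = i then c i else 0)"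
      using cell_disjoint[OF k] i by (intro sum.cong) (auto simp: indicator_def)
    then show ?thesis using i c by simp
  qed
  then show ?thesis by (rule that)
qed

lemma step_measurable:
  assumes "1 \<le> k" "step k \<psi>"
  shows "\<psi> \<in> borel_measurable borel"
proof -
  obtain c where c: "\<And>x. \<psi> x = (\<Sum>j\<in>{1..2 ^ k}. c j * indicator (B k j) x)"
    using step_representation[OF assms] by blast
  have "(\<lambda>x. \<Sum>j\<in>{1..2 ^ k}. c j * indicator (B k j) x) \<in> borel_measurable borel"
    using cell_measurable[OF assms(1)]
    by (intro borel_measurable_sum borel_measurable_times borel_measurable_indicator) auto
  moreover have "\<psi> = (\<lambda>x. \<Sum>j\<in>{1..2 ^ k}. c j * indicator (B k j) x)" by (rule ext) (rule c)
  ultimately show ?thesis by (simp only:)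
qed

lemma step_integrable:
  assumes "1 \<le> k" "step k \<psi>"
  shows "integrable \<nu> \<psi>"
proof -
  obtain c where c: "\<And>x. \<psi> x = (\<Sum>j\<in>{1..2 ^ k}. c j * indicator (B k j) x)"
    using step_representation[OF assms] by blast
  have "norm (\<psi> x) \<le> (\<Sum>j\<in>{1..2 ^ k}. norm (c j))" for x
    unfolding c by (rule sum_norm_le) (simp add: indicator_def)
  then show ?thesis
    using step_measurable[OF assms] by (intro \<nu>.integrable_const_bound) (auto simp: borel_measurable_\<nu>)
qed

definition step_approximable :: "('a \<Rightarrow> real) \<Rightarrow> bool" where
  "step_approximable \<phi> \<longleftrightarrow> integrable \<nu> \<phi> \<and>
     (\<forall>\<epsilon>>0. \<exists>k\<ge>1. \<exists>\<psi>. step k \<psi> \<and> (\<integral>x. \<bar>\<phi> x - \<psi> x\<bar> \<partial>\<nu>) < \<epsilon>)"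

lemma step_approximable_step: "1 \<le> k \<Longrightarrow> step k \<psi> \<Longrightarrow> step_approximable \<psi>"
  unfolding step_approximable_def
  by (intro conjI step_integrable allI impI exI[of _ k] exI[of _ \<psi>]) auto

lemma L1_triangle:
  fixes f g h :: "'a \<Rightarrow> real"
  assumes "integrable \<nu> f" "integrable \<nu> g" "integrable \<nu> h"
  shows "(\<integral>x. \<bar>f x - h x\<bar> \<partial>\<nu>) \<le> (\<integral>x. \<bar>f x - g x\<bar> \<partial>\<nu>) + (\<integral>x. \<bar>g x - h x\<bar> \<partial>\<nu>)"
proof -
  have "(\<integral>x. \<bar>f x - h x\<bar> \<partial>\<nu>) \<le> (\<integral>x. \<bar>f x - g x\<bar> + \<bar>g x - h x\<bar> \<partial>\<nu>)"
    using assms by (intro integral_mono) auto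
  also have "\<dots> = (\<integral>x. \<bar>f x - g x\<bar> \<partial>\<nu>) + (\<integral>x. \<bar>g x - h x\<bar> \<partial>\<nu>)"
    using assms by (intro Bochner_Integration.integral_add) auto
  finally show ?thesis .
qed

lemma step_approximable_close:
  assumes \<phi>: "integrable \<nu> \<phi>"
    and close: "\<And>\<epsilon>. 0 < \<epsilon> \<Longrightarrow> \<exists>\<phi>'. step_approximable \<phi>' \<and> (\<integral>x. \<bar>\<phi> x - \<phi>' x\<bar> \<partial>\<nu>) < \<epsilon>"
  shows "step_approximable \<phi>"
  unfolding step_approximable_def
proof (intro conjI \<phi> allI impI)
  fix \<epsilon> :: real assume "0 < \<epsilon>"
  then have "0 < \<epsilon> / 2" by simp
  then obtain \<phi>' where \<phi>': "step_approximable \<phi>'" "(\<integral>x. \<bar>\<phi> x - \<phi>' x\<bar> \<partial>\<nu>) < \<epsilon> / 2"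
    using close by blast
  then obtain k \<psi> where k: "1 \<le> k" "step k \<psi>" "(\<integral>x. \<bar>\<phi>' x - \<psi> x\<bar> \<partial>\<nu>) < \<epsilon> / 2"
    using \<open>0 < \<epsilon> / 2\<close> unfolding step_approximable_def by blast
  have "integrable \<nu> \<phi>'" using \<phi>'(1) by (simp add: step_approximable_def)
  from L1_triangle[OF \<phi> this step_integrable[OF k(1,2)]] \<phi>'(2) k(3)
  have "(\<integral>x. \<bar>\<phi> x - \<psi> x\<bar> \<partial>\<nu>) < \<epsilon>" by linarith
  then show "\<exists>k\<ge>1. \<exists>\<psi>. step k \<psi> \<and> (\<integral>x. \<bar>\<phi> x - \<psi> x\<bar> \<partial>\<nu>) < \<epsilon>" using k by blast
qed

lemma step_approximable_limit:
  assumes s: "\<And>n. step_approximable (s n)" and \<phi>: "\<phi> \<in> borel_measurable borel"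
    and lim: "\<And>x. (\<lambda>n. s n x) \<longlonglongrightarrow> \<phi> x"
    and w: "integrable \<nu> w" and bound: "\<And>n x. \<bar>s n x\<bar> \<le> w x"
  shows "step_approximable \<phi>"
proof -
  have int_s: "integrable \<nu> (s n)" for n using s by (simp add: step_approximable_def)
  have int: "integrable \<nu> \<phi>"
  proof (rule integrable_dominated_convergence)
    show "\<phi> \<in> borel_measurable \<nu>" using \<phi> by (simp add: borel_measurable_\<nu>)
    show "s n \<in> borel_measurable \<nu>" for n by (rule borel_measurable_integrable[OF int_s])
    show "integrable \<nu> w" by (rule w)
    show "AE x in \<nu>. (\<lambda>n. s n x) \<longlonglongrightarrow> \<phi> x" by (intro AE_I2 lim)
    show "AE x in \<nu>. norm (s n x) \<le> w x" for n using bound[of n] by (intro AE_I2) simp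
  qed
  have "(\<lambda>n. \<integral>x. \<bar>\<phi> x - s n x\<bar> \<partial>\<nu>) \<longlonglongrightarrow> (\<integral>x. 0 \<partial>\<nu>)"
  proof (rule integral_dominated_convergence)
    show "integrable \<nu> (\<lambda>x. \<bar>\<phi> x\<bar> + w x)" using int w by auto
    show "AE x in \<nu>. (\<lambda>n. \<bar>\<phi> x - s n x\<bar>) \<longlonglongrightarrow> 0"
    proof (rule AE_I2)
      fix x
      have "(\<lambda>n. \<bar>\<phi> x - s n x\<bar>) \<longlonglongrightarrow> \<bar>\<phi> x - \<phi> x\<bar>" by (intro tendsto_intros lim)
      then show "(\<lambda>n. \<bar>\<phi> x - s n x\<bar>) \<longlonglongrightarrow> 0" by simp
    qed
    show "AE x in \<nu>. norm \<bar>\<phi> x - s n x\<bar> \<le> \<bar>\<phi> x\<bar> + w x" for n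
    proof (rule AE_I2)
      fix x
      show "norm \<bar>\<phi> x - s n x\<bar> \<le> \<bar>\<phi> x\<bar> + w x"
        using abs_triangle_ineq4[of "\<phi> x" "s n x"] bound[of n x] by simp
    qed
    show "(\<lambda>x. \<bar>\<phi> x - s n x\<bar>) \<in> borel_measurable \<nu>" for n
      using borel_measurable_integrable[OF int] borel_measurable_integrable[OF int_s[of n]] by measurable
  qed auto
  then have lim0: "(\<lambda>n. \<integral>x. \<bar>\<phi> x - s n x\<bar> \<partial>\<nu>) \<longlonglongrightarrow> 0" by simp
  show ?thesis
  proof (rule step_approximable_close[OF int])
    fix \<epsilon> :: real assume "0 < \<epsilon>"
    from order_tendstoD(2)[OF lim0 this] have "\<exists>n. (\<integral>x. \<bar>\<phi> x - s n x\<bar> \<partial>\<nu>) < \<epsilon>"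
      by (rule eventually_happens'[rotated]) simp
    then obtain n where "(\<integral>x. \<bar>\<phi> x - s n x\<bar> \<partial>\<nu>) < \<epsilon>" ..
    then show "\<exists>\<phi>'. step_approximable \<phi>' \<and> (\<integral>x. \<bar>\<phi> x - \<phi>' x\<bar> \<partial>\<nu>) < \<epsilon>"
      by (intro exI[of _ "s n"] conjI s)
  qed
qed

lemma step_approximable_lincomb:
  assumes f: "step_approximable f" and g: "step_approximable g"
  shows "step_approximable (\<lambda>x. a * f x + b * g x)"
  unfolding step_approximable_def
proof (intro conjI allI impI)
  have int: "integrable \<nu> f" "integrable \<nu> g" using f g by (auto simp: step_approximable_def)
  then show "integrable \<nu> (\<lambda>x. a * f x + b * g x)" by auto
  fix \<epsilon> :: real assume "0 < \<epsilon>"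
  define \<delta> where "\<delta> = \<epsilon> / (\<bar>a\<bar> + \<bar>b\<bar> + 1)"
  have D: "0 < \<bar>a\<bar> + \<bar>b\<bar> + 1" by linarith
  then have "0 < \<delta>" using \<open>0 < \<epsilon>\<close> by (simp add: \<delta>_def)
  obtain k \<psi> where k: "1 \<le> k" "step k \<psi>" "(\<integral>x. \<bar>f x - \<psi> x\<bar> \<partial>\<nu>) < \<delta>"
    using f \<open>0 < \<delta>\<close> unfolding step_approximable_def by blast
  obtain l \<rho> where l: "1 \<le> l" "step l \<rho>" "(\<integral>x. \<bar>g x - \<rho> x\<bar> \<partial>\<nu>) < \<delta>"
    using g \<open>0 < \<delta>\<close> unfolding step_approximable_def by blast
  let ?h = "\<lambda>x. a * \<psi> x + b * \<rho> x"
  have "step (max k l) \<psi>" "step (max k l) \<rho>"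
    using step_mono[OF k(1,2)] step_mono[OF l(1,2)] by auto
  then have h: "step (max k l) ?h" by (rule step_comp2[where h = "\<lambda>s t. a * s + b * t"])
  note int' = int step_integrable[OF k(1,2)] step_integrable[OF l(1,2)]
  have "(\<integral>x. \<bar>a * f x + b * g x - ?h x\<bar> \<partial>\<nu>) \<le> (\<integral>x. \<bar>a\<bar> * \<bar>f x - \<psi> x\<bar> + \<bar>b\<bar> * \<bar>g x - \<rho> x\<bar> \<partial>\<nu>)"
  proof (intro integral_mono)
    show "\<bar>a * f x + b * g x - ?h x\<bar> \<le> \<bar>a\<bar> * \<bar>f x - \<psi> x\<bar> + \<bar>b\<bar> * \<bar>g x - \<rho> x\<bar>" for x
    proof -
      have eq: "a * f x + b * g x - ?h x = a * (f x - \<psi> x) + b * (g x - \<rho> x)"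
        by (simp add: algebra_simps)
      show ?thesis unfolding eq abs_mult[symmetric] by (rule abs_triangle_ineq)
    qed
  qed (use int' in auto)
  also have "\<dots> = \<bar>a\<bar> * (\<integral>x. \<bar>f x - \<psi> x\<bar> \<partial>\<nu>) + \<bar>b\<bar> * (\<integral>x. \<bar>g x - \<rho> x\<bar> \<partial>\<nu>)"
    using int' by simp
  also have "\<dots> \<le> \<bar>a\<bar> * \<delta> + \<bar>b\<bar> * \<delta>"
    using k l by (intro add_mono mult_left_mono) auto
  also have "\<dots> < (\<bar>a\<bar> + \<bar>b\<bar> + 1) * \<delta>"
    using \<open>0 < \<delta>\<close> by (simp add: distrib_right)
  also have "\<dots> = \<epsilon>" using D by (simp add: \<delta>_def)
  finally show "\<exists>k\<ge>1. \<exists>\<psi>. step k \<psi> \<and> (\<integral>x. \<bar>a * f x + b * g x - \<psi> x\<bar> \<partial>\<nu>) < \<epsilon>"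
    using h k(1) by (intro exI[of _ "max k l"] conjI exI[of _ ?h]) auto
qed

text \<open>
The unions of cells of one generation are stable under intersections, since two of them are unions of cells of a common
generation. The sets whose indicators are approximable form a Dynkin system, so Dynkin's lemma reaches all sets generated by
the cells.
\<close>

lemma step_approximable_generated:
  assumes "A \<in> sigma_sets UNIV {B k j | k j. 1 \<le> k \<and> j \<in> {1..2 ^ k}}"
  shows "step_approximable (indicator A)"
proof -
  define \<A> where "\<A> = {A. \<exists>k\<ge>1. step k (indicator A)}"
  have "{B k j | k j. 1 \<le> k \<and> j \<in> {1..2 ^ k}} \<subseteq> \<A>"
    using step_cell by (auto simp: \<A>_def)
  then have A: "A \<in> sigma_sets UNIV \<A>" using sigma_sets_mono'[of _ \<A> UNIV] assms by blast
  have stable: "Int_stable \<A>"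
  proof (rule Int_stableI)
    fix C C' assume "C \<in> \<A>" "C' \<in> \<A>"
    then obtain k l where k: "1 \<le> k" "step k (indicator C)" and l: "1 \<le> l" "step l (indicator C')"
      by (auto simp: \<A>_def)
    have "step (max k l) (indicator C)" "step (max k l) (indicator C')"
      using step_mono[OF k] step_mono[OF l] by auto
    then have "step (max k l) (\<lambda>x. indicator C x * indicator C' x)" by (rule step_comp2[where h = "(*)"])
    then have "step (max k l) (indicator (C \<inter> C'))" by (simp add: indicator_inter_arith[abs_def])
    then show "C \<inter> C' \<in> \<A>" using k(1) by (auto simp: \<A>_def intro!: exI[of _ "max k l"])
  qed
  have \<A>_borel: "\<A> \<subseteq> sets borel"
  proof
    fix C assume "C \<in> \<A>"
    then obtain k where "1 \<le> k" "step k (indicator C)" by (auto simp: \<A>_def)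
    from step_measurable[OF this] show "C \<in> sets borel" by (simp add: borel_measurable_indicator_iff)
  qed
  have sigma_borel: "sigma_sets UNIV \<A> \<subseteq> sets borel"
    using sets.sigma_sets_subset[of \<A> borel] \<A>_borel by simp
  have "\<A> \<subseteq> Pow UNIV" by simp
  from stable this A show ?thesis
  proof (induction rule: sigma_sets_induct_disjoint)
    case (basic C)
    then show ?case by (auto simp: \<A>_def intro: step_approximable_step)
  next
    case empty
    show ?case by (rule step_approximable_step[of 1]) (auto simp: step_def)
  next
    case (compl C)
    have "step_approximable (\<lambda>x. 1)" by (rule step_approximable_step[of 1]) (auto simp: step_def)
    from step_approximable_lincomb[OF this compl(2), of 1 "-1"] show ?case
      by (simp add: indicator_def[abs_def] of_bool_not_iff)
  next
    case (union A)
    have \<section>: "(\<lambda>n. \<Sum>i<n. indicator (A i) x) \<longlonglongrightarrow> (indicator (\<Union>i. A i) x :: real)" for x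
      using indicator_sums[of A x] union(1) by (auto simp: sums_def disjoint_family_on_def)
    show ?case
    proof (rule step_approximable_limit[where w = "\<lambda>x. 1"])
      show "step_approximable (\<lambda>x. \<Sum>i<n. indicator (A i) x)" for n
      proof (induction n)
        case 0
        show ?case by (rule step_approximable_step[of 1]) (auto simp: step_def)
      next
        case (Suc n)
        then show ?case using step_approximable_lincomb[OF Suc.IH union(3)[of n], of 1 1] by simp
      qed
      show "indicator (\<Union>i. A i) \<in> borel_measurable borel"
        using union(2) sigma_borel by (intro borel_measurable_indicator sets.countable_UN) auto
      show "(\<lambda>n. \<Sum>i<n. indicator (A i) x) \<longlonglongrightarrow> (indicator (\<Union>i. A i) x :: real)" for x by (rule \<section>)
      show "\<bar>\<Sum>i<n. indicator (A i) x :: real\<bar> \<le> 1" for n x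
      proof -
        have "(\<Sum>i<n. indicator (A i) x) \<le> (indicator (\<Union>i. A i) x :: real)"
          using \<section>[of x] by (rule incseq_le[rotated]) (auto intro!: incseq_SucI)
        also have "\<dots> \<le> 1" by (simp add: indicator_def)
        finally show ?thesis by (simp add: sum_nonneg)
      qed
    qed simp
  qed
qed

text \<open>
Every Borel set agrees up to a null set with a set generated by the cells, and approximability survives linear combinations and
dominated limits.
\<close>

lemma step_approximable_integrable:
  assumes "integrable \<nu> \<phi>"
  shows "step_approximable \<phi>"
  using assms
proof (induction rule: integrable_induct)
  case (base A c)
  obtain A' where A': "A' \<in> sigma_sets UNIV {B k j | k j. 1 \<le> k \<and> j \<in> {1..2 ^ k}}"
    "emeasure \<nu> ((A - A') \<union> (A' - A)) = 0"
    using generating base(1) sets_\<nu> by blast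
  have app: "step_approximable (indicator A')" by (rule step_approximable_generated[OF A'(1)])
  then have "integrable \<nu> (indicator A' :: 'a \<Rightarrow> real)" by (simp add: step_approximable_def)
  then have [measurable]: "A' \<in> sets \<nu>"
    using borel_measurable_integrable borel_measurable_indicator_iff space_\<nu> by (metis Int_UNIV_right)
  note base(1)[measurable]
  have "AE x in \<nu>. x \<notin> (A - A') \<union> (A' - A)"
    using A'(2) by (intro AE_not_in null_setsI) auto
  then have ae: "AE x in \<nu>. \<bar>indicator A x - indicator A' x :: real\<bar> = 0"
    by eventually_elim (auto simp: indicator_def)
  have "(\<integral>x. \<bar>indicator A x - indicator A' x :: real\<bar> \<partial>\<nu>) = (\<integral>x. 0 \<partial>\<nu>)"
    using ae by (intro integral_cong_AE) auto
  then have zero: "(\<integral>x. \<bar>indicator A x - indicator A' x :: real\<bar> \<partial>\<nu>) = 0" by simp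
  have "step_approximable (indicator A)"
  proof (rule step_approximable_close)
    show "integrable \<nu> (indicator A :: 'a \<Rightarrow> real)" using base by simp
  qed (use app zero in auto)
  from step_approximable_lincomb[OF this this, of c 0] show ?case by (simp add: mult.commute)
next
  case (add f g)
  then show ?case using step_approximable_lincomb[of f g 1 1] by simp
next
  case (lim f s)
  show ?case
  proof (rule step_approximable_limit[where s = s and w = "\<lambda>x. 2 * norm (f x)"])
    show "f \<in> borel_measurable borel" using borel_measurable_integrable[OF \<open>integrable \<nu> f\<close>] by (simp add: borel_measurable_\<nu>)
  qed (use lim space_\<nu> in auto)
qed

text \<open>
Truncating a step function at \<open>\<plusminus>C\<close> brings it only closer to a function bounded by \<open>C\<close>. Setting it to \<open>0\<close> on the last
cell costs at most \<open>C / 2\<^sup>k\<close>. The last cell is given up because the projection cylinder functions of generation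
\<open>k\<close> depend on the masses of the first \<open>2\<^sup>k - 1\<close> cells.
\<close>

lemma bounded_step_approximation:
  fixes \<phi> :: "'a \<Rightarrow> real" and C \<epsilon> :: real
  assumes \<phi>: "\<phi> \<in> borel_measurable borel" and C: "\<And>x. \<bar>\<phi> x\<bar> \<le> C" and "0 < \<epsilon>"
  obtains K where "1 \<le> K" "\<And>k. K \<le> k \<Longrightarrow> \<exists>c.
    (\<forall>x. \<bar>\<Sum>j<2 ^ k - 1. c j * indicator (B k (Suc j)) x\<bar> \<le> C) \<and>
    (\<integral>x. \<bar>\<phi> x - (\<Sum>j<2 ^ k - 1. c j * indicator (B k (Suc j)) x)\<bar> \<partial>\<nu>) < \<epsilon>"
proof -
  have C0: "0 \<le> C" using C[of undefined] abs_ge_zero[of "\<phi> undefined"] by linarith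
  have int: "integrable \<nu> \<phi>"
    using \<phi> C by (intro \<nu>.integrable_const_bound[of _ C]) (auto simp: borel_measurable_\<nu>)
  have "0 < \<epsilon> / 2" using \<open>0 < \<epsilon>\<close> by simp
  with step_approximable_integrable[OF int] obtain k0 \<psi>
    where k0: "1 \<le> k0" "step k0 \<psi>" "(\<integral>x. \<bar>\<phi> x - \<psi> x\<bar> \<partial>\<nu>) < \<epsilon> / 2"
    unfolding step_approximable_def by blast
  have "(\<lambda>k. C * (1 / 2) ^ k) \<longlonglongrightarrow> C * 0" by (intro tendsto_intros LIMSEQ_power_zero) auto
  then obtain k1 where k1: "\<And>k. k1 \<le> k \<Longrightarrow> C * (1 / 2) ^ k < \<epsilon> / 2"
    using order_tendstoD(2)[of _ "C * 0" sequentially "\<epsilon> / 2"] \<open>0 < \<epsilon>\<close> by (auto simp: eventually_sequentially)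
  show ?thesis
  proof (rule that[of "max k0 k1"])
    show "1 \<le> max k0 k1" using k0(1) by simp
    fix k assume k: "max k0 k1 \<le> k"
    then have k1': "1 \<le> k" using k0(1) by simp
    let ?last = "B k (2 ^ k)"
    define \<rho> where "\<rho> x = (1 - indicator ?last x) * max (- C) (min C (\<psi> x))" for x
    have step_\<psi>: "step k \<psi>" using step_mono[OF k0(1,2)] k by simp
    have last: "step k (indicator ?last)" by (rule step_cell) (use k1' in auto)
    have step_\<rho>: "step k \<rho>"
      unfolding \<rho>_def using step_comp2[OF last step_\<psi>, of "\<lambda>a b. (1 - a) * max (- C) (min C b)"] .
    obtain c where c: "\<And>x. \<rho> x = (\<Sum>j\<in>{1..2 ^ k}. c j * indicator (B k j) x)"
      using step_representation[OF k1' step_\<rho>] by blast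
    have \<rho>_eq: "\<rho> x = (\<Sum>j<2 ^ k - 1. c (Suc j) * indicator (B k (Suc j)) x)" for x
    proof -
      have "\<rho> x = (\<Sum>j\<in>{1..<2 ^ k}. c j * indicator (B k j) x)"
      proof (cases "x \<in> ?last")
        case True
        then have "\<And>j. j \<in> {1..<2 ^ k} \<Longrightarrow> x \<notin> B k j"
          using cell_disjoint[OF k1', of _ "2 ^ k" x] by fastforce
        then show ?thesis using True by (simp add: \<rho>_def)
      next
        case False
        have "i = 2 ^ k" if "i \<in> {1..2 ^ k} - {1..<2 ^ k}" for i :: nat
          using that by auto
        then show ?thesis
          unfolding c using False by (intro sum.mono_neutral_right ballI) auto
      qed
      also have "\<dots> = (\<Sum>j\<in>{Suc 0..<Suc (2 ^ k - 1)}. c j * indicator (B k j) x)"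
        by (rule sum.cong) auto
      also have "\<dots> = (\<Sum>j\<in>{0..<2 ^ k - 1}. c (Suc j) * indicator (B k (Suc j)) x)"
        by (rule sum.shift_bounds_Suc_ivl)
      finally show ?thesis by (simp only: lessThan_atLeast0)
    qed
    have bound: "\<bar>\<rho> x\<bar> \<le> C" for x
      using C0 by (auto simp: \<rho>_def indicator_def)
    have "(\<integral>x. \<bar>\<phi> x - \<rho> x\<bar> \<partial>\<nu>) \<le> (\<integral>x. \<bar>\<phi> x - \<psi> x\<bar> + C * indicator ?last x \<partial>\<nu>)"
    proof (rule integral_mono)
      show "integrable \<nu> (\<lambda>x. \<bar>\<phi> x - \<rho> x\<bar>)"
        using int step_integrable[OF k1' step_\<rho>] by auto
      show "integrable \<nu> (\<lambda>x. \<bar>\<phi> x - \<psi> x\<bar> + C * indicator ?last x)"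
        using int step_integrable[OF k1' step_\<psi>] step_integrable[OF k1' last] by auto
      show "\<bar>\<phi> x - \<rho> x\<bar> \<le> \<bar>\<phi> x - \<psi> x\<bar> + C * indicator ?last x" for x
        using C[of x] C0 by (auto simp: \<rho>_def indicator_def)
    qed
    also have "\<dots> = (\<integral>x. \<bar>\<phi> x - \<psi> x\<bar> \<partial>\<nu>) + C * (1 / 2) ^ k"
      using int step_integrable[OF k1' step_\<psi>] step_integrable[OF k1' last] cell_measure[OF k1', of "2 ^ k"]
      by (simp add: space_\<nu> power_one_over)
    also have "\<dots> < \<epsilon>" using k0(3) k1[of k] k by simp
    finally show "\<exists>c. (\<forall>x. \<bar>\<Sum>j<2 ^ k - 1. c j * indicator (B k (Suc j)) x\<bar> \<le> C) \<and>
        (\<integral>x. \<bar>\<phi> x - (\<Sum>j<2 ^ k - 1. c j * indicator (B k (Suc j)) x)\<bar> \<partial>\<nu>) < \<epsilon>"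
      using bound unfolding \<rho>_eq by (intro exI[of _ "\<lambda>j. c (Suc j)"]) auto
  qed
qed

end

section \<open>Energies of gradient fields\<close>

text \<open>
The infinite cube is compact in the product topology by Tychonoff's theorem.
\<close>

lemma continuous_bounded_on_cube:
  fixes f :: "(nat \<Rightarrow> real) \<Rightarrow> real"
  assumes "continuous_on UNIV f"
  obtains A where "0 \<le> A" "\<And>x. (\<And>i. \<bar>x i\<bar> \<le> C) \<Longrightarrow> \<bar>f x\<bar> \<le> A"
proof -
  let ?K = "PiE UNIV (\<lambda>_ :: nat. {- C..C})"
  have "compactin (product_topology (\<lambda>_. euclidean) UNIV) ?K"
    by (subst compactin_PiE) simp
  then have "compact ?K" by (simp add: euclidean_product_topology)
  then have "compact (f ` ?K)"
    using assms continuous_on_subset by (blast intro: compact_continuous_image)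
  then have "bounded (f ` ?K)" by (rule compact_imp_bounded)
  then obtain A where A: "0 < A" "\<And>y. y \<in> f ` ?K \<Longrightarrow> norm y \<le> A"
    unfolding bounded_pos by blast
  show ?thesis
  proof (rule that[of A])
    fix x :: "nat \<Rightarrow> real" assume "\<And>i. \<bar>x i\<bar> \<le> C"
    then have "x \<in> ?K" by (auto simp: PiE_iff abs_le_iff minus_le_iff)
    then show "\<bar>f x\<bar> \<le> A" using A(2)[of "f x"] by simp
  qed (use A(1) in simp)
qed

lemma (in prob_space) abs_integral_le:
  fixes f :: "'a \<Rightarrow> real"
  assumes "integrable M f" "\<And>x. \<bar>f x\<bar> \<le> C"
  shows "\<bar>integral\<^sup>L M f\<bar> \<le> C"
proof -
  have "\<bar>integral\<^sup>L M f\<bar> \<le> (\<integral>x. \<bar>f x\<bar> \<partial>M)" by (rule integral_abs_bound)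
  also have "\<dots> \<le> (\<integral>x. C \<partial>M)" using assms by (intro integral_mono) auto
  finally show ?thesis by (simp add: prob_space)
qed

lemma (in prob_space) integral_tendsto_L1:
  fixes f :: "nat \<Rightarrow> 'a \<Rightarrow> real"
  assumes "\<And>n. integrable M (f n)" "integrable M g"
    and lim: "(\<lambda>n. \<integral>x. \<bar>f n x - g x\<bar> \<partial>M) \<longlonglongrightarrow> 0"
  shows "(\<lambda>n. integral\<^sup>L M (f n)) \<longlonglongrightarrow> integral\<^sup>L M g"
proof -
  have "(\<lambda>n. integral\<^sup>L M (f n) - integral\<^sup>L M g) \<longlonglongrightarrow> 0"
  proof (rule Lim_null_comparison[OF always_eventually lim], intro allI)
    fix n
    have "integral\<^sup>L M (f n) - integral\<^sup>L M g = (\<integral>x. f n x - g x \<partial>M)"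
      using assms by simp
    then show "norm (integral\<^sup>L M (f n) - integral\<^sup>L M g) \<le> (\<integral>x. \<bar>f n x - g x\<bar> \<partial>M)"
      using integral_abs_bound[of M "\<lambda>x. f n x - g x"] by simp
  qed
  then show ?thesis by (simp add: LIM_zero_iff)
qed

locale random_probability = prob_space P
  for P :: "'a::topological_space measure measure" +
  assumes sets_P: "sets P = sets (prob_algebra borel)"
begin

lemma prob_space_P: "\<mu> \<in> space P \<Longrightarrow> prob_space \<mu>"
  and sets_\<mu>: "\<mu> \<in> space P \<Longrightarrow> sets \<mu> = sets borel"
  using sets_eq_imp_space_eq[OF sets_P] by (auto simp: space_prob_algebra)

lemma borel_measurable_\<mu>: "\<mu> \<in> space P \<Longrightarrow> borel_measurable \<mu> = borel_measurable borel"
  by (rule measurable_cong_sets[OF sets_\<mu> refl])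

lemma integrable_\<mu>:
  fixes f :: "'a \<Rightarrow> real"
  assumes "\<mu> \<in> space P" "f \<in> borel_measurable borel" "\<And>x. \<bar>f x\<bar> \<le> C"
  shows "integrable \<mu> f"
proof -
  interpret \<mu>: prob_space \<mu> by (rule prob_space_P[OF assms(1)])
  show ?thesis
    using assms by (intro \<mu>.integrable_const_bound[of _ C]) (auto simp: borel_measurable_\<mu>)
qed

text \<open>
Gradients are functions of a measure and a point. Joint measurability is what makes their integrals with respect to the
measure itself, and thereby the covariance form, measurable.
\<close>

definition bounded_field :: "('a measure \<Rightarrow> 'a \<Rightarrow> real) \<Rightarrow> bool" where
  "bounded_field X \<longleftrightarrow> case_prod X \<in> borel_measurable (P \<Otimes>\<^sub>M borel) \<and>
     (\<exists>C. \<forall>\<mu>\<in>space P. \<forall>x. \<bar>X \<mu> x\<bar> \<le> C)"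

lemma bounded_field_section:
  assumes "bounded_field X" "\<mu> \<in> space P"
  shows "X \<mu> \<in> borel_measurable borel"
proof -
  have "(\<lambda>x. case_prod X (\<mu>, x)) \<in> borel_measurable borel"
    using assms unfolding bounded_field_def
    by (intro measurable_compose[OF measurable_Pair1'[OF assms(2)]]) blast
  then show ?thesis by simp
qed

lemma bounded_field_integrable:
  assumes "bounded_field X" "\<mu> \<in> space P"
  shows "integrable \<mu> (X \<mu>)"
  using assms integrable_\<mu>[OF assms(2) bounded_field_section[OF assms]]
  unfolding bounded_field_def by blast

lemma bounded_field_lincomb:
  assumes X: "bounded_field X" and Y: "bounded_field Y"
  shows "bounded_field (\<lambda>\<mu> x. a * X \<mu> x + b * Y \<mu> x)"
proof -
  obtain C D where C: "\<And>\<mu> x. \<mu> \<in> space P \<Longrightarrow> \<bar>X \<mu> x\<bar> \<le> C" and D: "\<And>\<mu> x. \<mu> \<in> space P \<Longrightarrow> \<bar>Y \<mu> x\<bar> \<le> D"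
    using X Y unfolding bounded_field_def by blast
  have "\<bar>a * X \<mu> x + b * Y \<mu> x\<bar> \<le> \<bar>a\<bar> * C + \<bar>b\<bar> * D" if "\<mu> \<in> space P" for \<mu> x
  proof -
    have "\<bar>a * X \<mu> x + b * Y \<mu> x\<bar> \<le> \<bar>a\<bar> * \<bar>X \<mu> x\<bar> + \<bar>b\<bar> * \<bar>Y \<mu> x\<bar>"
      unfolding abs_mult[symmetric] by (rule abs_triangle_ineq)
    also have "\<dots> \<le> \<bar>a\<bar> * C + \<bar>b\<bar> * D"
      using C[OF that] D[OF that] by (intro add_mono mult_left_mono) auto
    finally show ?thesis .
  qed
  moreover have "(\<lambda>z. a * case_prod X z + b * case_prod Y z) \<in> borel_measurable (P \<Otimes>\<^sub>M borel)"
    using X Y unfolding bounded_field_def by (intro borel_measurable_add borel_measurable_times) auto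
  ultimately show ?thesis
    unfolding bounded_field_def by (auto simp: case_prod_unfold)
qed

lemma bounded_field_mult:
  assumes X: "bounded_field X" and Y: "bounded_field Y"
  shows "bounded_field (\<lambda>\<mu> x. X \<mu> x * Y \<mu> x)"
proof -
  obtain C D where C: "\<And>\<mu> x. \<mu> \<in> space P \<Longrightarrow> \<bar>X \<mu> x\<bar> \<le> C" and D: "\<And>\<mu> x. \<mu> \<in> space P \<Longrightarrow> \<bar>Y \<mu> x\<bar> \<le> D"
    using X Y unfolding bounded_field_def by blast
  have "\<bar>X \<mu> x * Y \<mu> x\<bar> \<le> C * D" if "\<mu> \<in> space P" for \<mu> x
    unfolding abs_mult using C[OF that, of x] D[OF that, of x] by (intro mult_mono) auto
  moreover have "(\<lambda>z. case_prod X z * case_prod Y z) \<in> borel_measurable (P \<Otimes>\<^sub>M borel)"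
    using X Y unfolding bounded_field_def by (intro borel_measurable_times) auto
  ultimately show ?thesis
    unfolding bounded_field_def by (auto simp: case_prod_unfold)
qed

lemma bounded_field_space:
  fixes \<phi> :: "'a \<Rightarrow> real"
  assumes "\<phi> \<in> borel_measurable borel" "\<And>x. \<bar>\<phi> x\<bar> \<le> C"
  shows "bounded_field (\<lambda>\<mu>. \<phi>)"
proof -
  have "(\<lambda>z. \<phi> (snd z)) \<in> borel_measurable (P \<Otimes>\<^sub>M borel)"
    by (rule measurable_compose[OF measurable_snd assms(1)])
  then show ?thesis using assms(2) unfolding bounded_field_def by (auto simp: case_prod_unfold)
qed

lemma bounded_field_coefficient:
  fixes a :: "'a measure \<Rightarrow> real"
  assumes "a \<in> borel_measurable P" "\<And>\<mu>. \<mu> \<in> space P \<Longrightarrow> \<bar>a \<mu>\<bar> \<le> C"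
  shows "bounded_field (\<lambda>\<mu> x. a \<mu>)"
proof -
  have "(\<lambda>z. a (fst z)) \<in> borel_measurable (P \<Otimes>\<^sub>M (borel :: 'a measure))"
    by (rule measurable_compose[OF measurable_fst assms(1)])
  then show ?thesis using assms(2) unfolding bounded_field_def by (auto simp: case_prod_unfold)
qed

lemma bounded_field_sum:
  "(\<And>i. i \<in> A \<Longrightarrow> bounded_field (X i)) \<Longrightarrow> bounded_field (\<lambda>\<mu> x. \<Sum>i\<in>A. X i \<mu> x)"
proof (induction A rule: infinite_finite_induct)
  case (insert i A)
  then show ?case using bounded_field_lincomb[of "X i" "\<lambda>\<mu> x. \<Sum>i\<in>A. X i \<mu> x" 1 1] by simp
qed (auto intro: bounded_field_coefficient[of "\<lambda>\<mu>. 0" 0])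

lemma integral_measurable:
  assumes X: "bounded_field X"
  shows "(\<lambda>\<mu>. \<integral>x. X \<mu> x \<partial>\<mu>) \<in> borel_measurable P"
proof -
  have id: "(\<lambda>\<mu>. \<mu>) \<in> measurable P (subprob_algebra borel)"
    by (rule measurable_prob_algebraD[OF measurable_ident_sets[OF sets_P]])
  have joint: "case_prod X \<in> borel_measurable (P \<Otimes>\<^sub>M borel)"
    using X by (simp add: bounded_field_def)
  have pos: "(\<lambda>(\<mu>, x). ennreal (X \<mu> x)) \<in> borel_measurable (P \<Otimes>\<^sub>M borel)"
    and neg: "(\<lambda>(\<mu>, x). ennreal (- X \<mu> x)) \<in> borel_measurable (P \<Otimes>\<^sub>M borel)"
    using joint by (auto simp: case_prod_unfold)
  have "(\<lambda>\<mu>. enn2real (\<integral>\<^sup>+x. ennreal (X \<mu> x) \<partial>\<mu>) - enn2real (\<integral>\<^sup>+x. ennreal (- X \<mu> x) \<partial>\<mu>)) \<in> borel_measurable P"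
    using nn_integral_measurable_subprob_algebra2[OF pos id] nn_integral_measurable_subprob_algebra2[OF neg id]
    by (intro borel_measurable_diff borel_measurable_enn2real) auto
  moreover have "(\<integral>x. X \<mu> x \<partial>\<mu>) = enn2real (\<integral>\<^sup>+x. ennreal (X \<mu> x) \<partial>\<mu>) - enn2real (\<integral>\<^sup>+x. ennreal (- X \<mu> x) \<partial>\<mu>)"
    if "\<mu> \<in> space P" for \<mu>
    by (rule real_lebesgue_integral_def[OF bounded_field_integrable[OF X that]])
  ultimately show ?thesis by (subst measurable_cong) auto
qed

lemma cov_form_nonneg:
  assumes X: "bounded_field X" and \<mu>: "\<mu> \<in> space P"
  shows "0 \<le> cov_form \<mu> (X \<mu>) (X \<mu>)"
proof -
  interpret \<mu>: prob_space \<mu> by (rule prob_space_P[OF \<mu>])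
  let ?m = "\<integral>x. X \<mu> x \<partial>\<mu>"
  have i: "integrable \<mu> (X \<mu>)" "integrable \<mu> (\<lambda>x. X \<mu> x * X \<mu> x)"
    using bounded_field_integrable[OF X \<mu>] bounded_field_integrable[OF bounded_field_mult[OF X X] \<mu>] by auto
  have "0 \<le> (\<integral>x. (X \<mu> x - ?m)\<^sup>2 \<partial>\<mu>)" by simp
  also have "\<dots> = (\<integral>x. X \<mu> x * X \<mu> x - 2 * ?m * X \<mu> x + ?m * ?m \<partial>\<mu>)"
    by (intro Bochner_Integration.integral_cong refl) (simp add: power2_eq_square algebra_simps)
  also have "\<dots> = (\<integral>x. X \<mu> x * X \<mu> x \<partial>\<mu>) - 2 * ?m * ?m + ?m * ?m"
    using i by (simp add: \<mu>.prob_space)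
  finally show ?thesis by (simp add: cov_form_def)
qed

lemma cov_form_bound:
  assumes X: "bounded_field X" and \<mu>: "\<mu> \<in> space P" and C: "\<And>x. \<bar>X \<mu> x\<bar> \<le> C"
  shows "\<bar>cov_form \<mu> (X \<mu>) (X \<mu>)\<bar> \<le> C * C"
proof -
  interpret \<mu>: prob_space \<mu> by (rule prob_space_P[OF \<mu>])
  have "\<bar>X \<mu> x * X \<mu> x\<bar> \<le> C * C" for x
    unfolding abs_mult using C[of x] by (intro mult_mono) auto
  then have "\<bar>\<integral>x. X \<mu> x * X \<mu> x \<partial>\<mu>\<bar> \<le> C * C"
    by (intro \<mu>.abs_integral_le bounded_field_integrable[OF bounded_field_mult[OF X X] \<mu>])
  moreover have "0 \<le> (\<integral>x. X \<mu> x \<partial>\<mu>) * (\<integral>x. X \<mu> x \<partial>\<mu>)" by simp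
  ultimately show ?thesis
    using cov_form_nonneg[OF X \<mu>] unfolding cov_form_def by linarith
qed

lemma cov_form_measurable:
  assumes X: "bounded_field X"
  shows "(\<lambda>\<mu>. cov_form \<mu> (X \<mu>) (X \<mu>)) \<in> borel_measurable P"
  unfolding cov_form_def
  by (intro borel_measurable_diff borel_measurable_times integral_measurable X bounded_field_mult)

lemma cov_form_integrable:
  assumes X: "bounded_field X"
  shows "integrable P (\<lambda>\<mu>. cov_form \<mu> (X \<mu>) (X \<mu>))"
proof -
  obtain C where C: "\<And>\<mu> x. \<mu> \<in> space P \<Longrightarrow> \<bar>X \<mu> x\<bar> \<le> C" using X unfolding bounded_field_def by blast
  show ?thesis
    using cov_form_bound[OF X _ C]
    by (intro integrable_const_bound[of _ "C * C"] cov_form_measurable X AE_I2) auto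
qed

lemma energy_nonneg: "bounded_field X \<Longrightarrow> 0 \<le> energy P X X"
  unfolding energy_def using cov_form_nonneg by (intro mult_nonneg_nonneg integral_nonneg_AE AE_I2) auto

lemma energy_cong:
  assumes "\<And>\<mu>. \<mu> \<in> space P \<Longrightarrow> X \<mu> = Y \<mu>"
  shows "energy P X X = energy P Y Y"
  unfolding energy_def using assms by (intro arg_cong[where f = "(*) (1 / 2)"] Bochner_Integration.integral_cong) auto

lemma energy_scale: "energy P (\<lambda>\<mu> x. c * X \<mu> x) (\<lambda>\<mu> x. c * X \<mu> x) = c\<^sup>2 * energy P X X"
proof -
  have "cov_form \<mu> (\<lambda>x. c * X \<mu> x) (\<lambda>x. c * X \<mu> x) = c\<^sup>2 * cov_form \<mu> (X \<mu>) (X \<mu>)" for \<mu>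
  proof -
    have "(\<lambda>x. c * X \<mu> x * (c * X \<mu> x)) = (\<lambda>x. c\<^sup>2 * (X \<mu> x * X \<mu> x))"
      by (auto simp: power2_eq_square)
    then show ?thesis by (simp add: cov_form_def power2_eq_square right_diff_distrib)
  qed
  then show ?thesis by (simp add: energy_def)
qed

lemma energy_parallelogram:
  assumes X: "bounded_field X" and Y: "bounded_field Y"
  shows "energy P (\<lambda>\<mu> x. X \<mu> x + Y \<mu> x) (\<lambda>\<mu> x. X \<mu> x + Y \<mu> x) +
      energy P (\<lambda>\<mu> x. X \<mu> x - Y \<mu> x) (\<lambda>\<mu> x. X \<mu> x - Y \<mu> x) = 2 * energy P X X + 2 * energy P Y Y"
proof -
  let ?c = "\<lambda>X \<mu>. cov_form \<mu> (X \<mu>) (X \<mu>)"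
  let ?S = "\<lambda>\<mu> x. X \<mu> x + Y \<mu> x" and ?D = "\<lambda>\<mu> x. X \<mu> x - Y \<mu> x"
  have S: "bounded_field ?S" and D: "bounded_field ?D"
    using bounded_field_lincomb[OF X Y, of 1 1] bounded_field_lincomb[OF X Y, of 1 "-1"] by auto
  have pw: "?c ?S \<mu> + ?c ?D \<mu> = 2 * ?c X \<mu> + 2 * ?c Y \<mu>" if \<mu>: "\<mu> \<in> space P" for \<mu>
  proof -
    note i = bounded_field_integrable[OF X \<mu>] bounded_field_integrable[OF Y \<mu>]
      bounded_field_integrable[OF bounded_field_mult[OF X X] \<mu>]
      bounded_field_integrable[OF bounded_field_mult[OF X Y] \<mu>]
      bounded_field_integrable[OF bounded_field_mult[OF Y Y] \<mu>]
    have "(\<integral>x. ?S \<mu> x * ?S \<mu> x \<partial>\<mu>) = (\<integral>x. X \<mu> x * X \<mu> x + 2 * (X \<mu> x * Y \<mu> x) + Y \<mu> x * Y \<mu> x \<partial>\<mu>)"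
      by (intro Bochner_Integration.integral_cong refl) (simp add: algebra_simps)
    then have S2: "(\<integral>x. ?S \<mu> x * ?S \<mu> x \<partial>\<mu>) =
        (\<integral>x. X \<mu> x * X \<mu> x \<partial>\<mu>) + 2 * (\<integral>x. X \<mu> x * Y \<mu> x \<partial>\<mu>) + (\<integral>x. Y \<mu> x * Y \<mu> x \<partial>\<mu>)"
      using i by simp
    have "(\<integral>x. ?D \<mu> x * ?D \<mu> x \<partial>\<mu>) = (\<integral>x. X \<mu> x * X \<mu> x - 2 * (X \<mu> x * Y \<mu> x) + Y \<mu> x * Y \<mu> x \<partial>\<mu>)"
      by (intro Bochner_Integration.integral_cong refl) (simp add: algebra_simps)
    then have D2: "(\<integral>x. ?D \<mu> x * ?D \<mu> x \<partial>\<mu>) =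
        (\<integral>x. X \<mu> x * X \<mu> x \<partial>\<mu>) - 2 * (\<integral>x. X \<mu> x * Y \<mu> x \<partial>\<mu>) + (\<integral>x. Y \<mu> x * Y \<mu> x \<partial>\<mu>)"
      using i by simp
    have SD: "(\<integral>x. ?S \<mu> x \<partial>\<mu>) = (\<integral>x. X \<mu> x \<partial>\<mu>) + (\<integral>x. Y \<mu> x \<partial>\<mu>)"
      "(\<integral>x. ?D \<mu> x \<partial>\<mu>) = (\<integral>x. X \<mu> x \<partial>\<mu>) - (\<integral>x. Y \<mu> x \<partial>\<mu>)"
      using i by simp_all
    show ?thesis unfolding cov_form_def S2 D2 SD by (simp add: algebra_simps)
  qed
  have "(\<integral>\<mu>. ?c ?S \<mu> \<partial>P) + (\<integral>\<mu>. ?c ?D \<mu> \<partial>P) = (\<integral>\<mu>. ?c ?S \<mu> + ?c ?D \<mu> \<partial>P)"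
    by (rule Bochner_Integration.integral_add[symmetric]; rule cov_form_integrable; fact)
  also have "\<dots> = (\<integral>\<mu>. 2 * ?c X \<mu> + 2 * ?c Y \<mu> \<partial>P)"
    using pw by (intro Bochner_Integration.integral_cong) auto
  also have "\<dots> = 2 * (\<integral>\<mu>. ?c X \<mu> \<partial>P) + 2 * (\<integral>\<mu>. ?c Y \<mu> \<partial>P)"
    using cov_form_integrable[OF X] cov_form_integrable[OF Y] by simp
  finally show ?thesis unfolding energy_def by simp
qed

lemma cov_form_tendsto:
  assumes \<mu>: "\<mu> \<in> space P" and X: "\<And>n. bounded_field (X n)" and Y: "bounded_field Y"
    and C: "\<And>n x. \<bar>X n \<mu> x\<bar> \<le> C" "\<And>x. \<bar>Y \<mu> x\<bar> \<le> C"
    and lim: "(\<lambda>n. \<integral>x. \<bar>X n \<mu> x - Y \<mu> x\<bar> \<partial>\<mu>) \<longlonglongrightarrow> 0"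
  shows "(\<lambda>n. cov_form \<mu> (X n \<mu>) (X n \<mu>)) \<longlonglongrightarrow> cov_form \<mu> (Y \<mu>) (Y \<mu>)"
proof -
  interpret \<mu>: prob_space \<mu> by (rule prob_space_P[OF \<mu>])
  have iX: "integrable \<mu> (X n \<mu>)" and iXX: "integrable \<mu> (\<lambda>x. X n \<mu> x * X n \<mu> x)" for n
    using bounded_field_integrable[OF X \<mu>] bounded_field_integrable[OF bounded_field_mult[OF X X] \<mu>] by auto
  have iY: "integrable \<mu> (Y \<mu>)" and iYY: "integrable \<mu> (\<lambda>x. Y \<mu> x * Y \<mu> x)"
    using bounded_field_integrable[OF Y \<mu>] bounded_field_integrable[OF bounded_field_mult[OF Y Y] \<mu>] by auto
  have "(\<lambda>n. \<integral>x. \<bar>X n \<mu> x * X n \<mu> x - Y \<mu> x * Y \<mu> x\<bar> \<partial>\<mu>) \<longlonglongrightarrow> 0"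
  proof (rule Lim_null_comparison[OF always_eventually], intro allI)
    have "(\<lambda>n. 2 * C * (\<integral>x. \<bar>X n \<mu> x - Y \<mu> x\<bar> \<partial>\<mu>)) \<longlonglongrightarrow> 2 * C * 0"
      by (intro tendsto_intros lim)
    then show "(\<lambda>n. 2 * C * (\<integral>x. \<bar>X n \<mu> x - Y \<mu> x\<bar> \<partial>\<mu>)) \<longlonglongrightarrow> 0" by simp
    fix n
    have pw: "\<bar>X n \<mu> x * X n \<mu> x - Y \<mu> x * Y \<mu> x\<bar> \<le> 2 * C * \<bar>X n \<mu> x - Y \<mu> x\<bar>" for x
    proof -
      have "X n \<mu> x * X n \<mu> x - Y \<mu> x * Y \<mu> x = (X n \<mu> x + Y \<mu> x) * (X n \<mu> x - Y \<mu> x)"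
        by (simp add: algebra_simps)
      moreover have "\<bar>X n \<mu> x + Y \<mu> x\<bar> \<le> 2 * C" using C(1)[of n x] C(2)[of x] by linarith
      ultimately show ?thesis by (simp only: abs_mult) (rule mult_right_mono, auto)
    qed
    have "(\<integral>x. \<bar>X n \<mu> x * X n \<mu> x - Y \<mu> x * Y \<mu> x\<bar> \<partial>\<mu>) \<le> (\<integral>x. 2 * C * \<bar>X n \<mu> x - Y \<mu> x\<bar> \<partial>\<mu>)"
      using iX iY iXX iYY pw by (intro integral_mono) auto
    then show "norm (\<integral>x. \<bar>X n \<mu> x * X n \<mu> x - Y \<mu> x * Y \<mu> x\<bar> \<partial>\<mu>) \<le> 2 * C * (\<integral>x. \<bar>X n \<mu> x - Y \<mu> x\<bar> \<partial>\<mu>)"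
      by simp
  qed
  from \<mu>.integral_tendsto_L1[OF iXX iYY this] \<mu>.integral_tendsto_L1[OF iX iY lim]
  show ?thesis unfolding cov_form_def by (intro tendsto_diff tendsto_mult)
qed

lemma energy_tendsto:
  assumes X: "\<And>n. bounded_field (X n)" and Y: "bounded_field Y"
    and C: "\<And>n \<mu> x. \<mu> \<in> space P \<Longrightarrow> \<bar>X n \<mu> x\<bar> \<le> C" "\<And>\<mu> x. \<mu> \<in> space P \<Longrightarrow> \<bar>Y \<mu> x\<bar> \<le> C"
    and lim: "AE \<mu> in P. (\<lambda>n. \<integral>x. \<bar>X n \<mu> x - Y \<mu> x\<bar> \<partial>\<mu>) \<longlonglongrightarrow> 0"
  shows "(\<lambda>n. energy P (X n) (X n)) \<longlonglongrightarrow> energy P Y Y"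
  unfolding energy_def
proof (intro tendsto_mult tendsto_const integral_dominated_convergence[where w = "\<lambda>_. C * C"])
  show "AE \<mu> in P. (\<lambda>n. cov_form \<mu> (X n \<mu>) (X n \<mu>)) \<longlonglongrightarrow> cov_form \<mu> (Y \<mu>) (Y \<mu>)"
    using lim AE_space
  proof eventually_elim
    case (elim \<mu>)
    then show ?case using C by (intro cov_form_tendsto[OF _ X Y]) auto
  qed
  show "AE \<mu> in P. norm (cov_form \<mu> (X n \<mu>) (X n \<mu>)) \<le> C * C" for n
    using cov_form_bound[OF X _ C(1)] by (intro AE_I2) auto
qed (auto intro: cov_form_measurable X Y)

text \<open>
A smooth function of \<open>d\<close> variables does not see the coordinates from \<open>d\<close> on. They are set to \<open>0\<close> because the functions
\<open>\<phi> i\<close> with \<open>d \<le> i\<close> are arbitrary, and their integrals neither measurable in \<open>\<mu>\<close> nor bounded.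
\<close>

definition mean_vector :: "nat \<Rightarrow> (nat \<Rightarrow> 'a \<Rightarrow> real) \<Rightarrow> 'a measure \<Rightarrow> nat \<Rightarrow> real" where
  "mean_vector d \<phi> \<mu> i = (if i < d then \<integral>x. \<phi> i x \<partial>\<mu> else 0)"

lemma mean_vector_eq: "f \<in> C_infinity d \<Longrightarrow> f (\<lambda>i. \<integral>x. \<phi> i x \<partial>\<mu>) = f (mean_vector d \<phi> \<mu>)"
  by (rule C_infinity_cong_coords) (auto simp: mean_vector_def)

context
  fixes d :: nat and \<phi> :: "nat \<Rightarrow> 'a \<Rightarrow> real" and C :: real
  assumes \<phi>: "\<And>i. i < d \<Longrightarrow> \<phi> i \<in> borel_measurable borel" "\<And>i x. i < d \<Longrightarrow> \<bar>\<phi> i x\<bar> \<le> C" and C: "0 \<le> C"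
begin

lemma mean_vector_measurable: "mean_vector d \<phi> \<in> borel_measurable P"
proof (rule measurable_coordinatewise_then_product)
  fix i
  have "(\<lambda>\<mu>. \<integral>x. \<phi> i x \<partial>\<mu>) \<in> borel_measurable P" if "i < d"
    using integral_measurable[OF bounded_field_space[OF \<phi>[OF that]]] .
  then show "(\<lambda>\<mu>. mean_vector d \<phi> \<mu> i) \<in> borel_measurable P"
    by (cases "i < d") (simp_all add: mean_vector_def)
qed

lemma mean_vector_bound:
  assumes "\<mu> \<in> space P"
  shows "\<bar>mean_vector d \<phi> \<mu> i\<bar> \<le> C"
proof (cases "i < d")
  case True
  interpret \<mu>: prob_space \<mu> by (rule prob_space_P[OF assms])
  show ?thesis
    using \<mu>.abs_integral_le[OF integrable_\<mu>[OF assms \<phi>[OF True]] \<phi>(2)[OF True]] True by (simp add: mean_vector_def)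
qed (use C in \<open>simp add: mean_vector_def\<close>)

lemma mean_vector_comp_measurable:
  assumes "continuous_on UNIV f"
  shows "(\<lambda>\<mu>. f (mean_vector d \<phi> \<mu>)) \<in> borel_measurable P"
  by (rule measurable_compose[OF mean_vector_measurable borel_measurable_continuous_onI[OF assms]])

lemma cyl_fun_L2:
  assumes "f \<in> C_infinity d"
  shows "cyl_fun \<phi> f \<in> L2_space P"
proof -
  have eq: "cyl_fun \<phi> f = (\<lambda>\<mu>. f (mean_vector d \<phi> \<mu>))"
    unfolding cyl_fun_def[abs_def] mean_vector_eq[OF assms] ..
  have meas: "cyl_fun \<phi> f \<in> borel_measurable P"
    unfolding eq by (rule mean_vector_comp_measurable[OF C_infinity_continuous[OF assms]])
  obtain A where A: "0 \<le> A" "\<And>x. (\<And>i. \<bar>x i\<bar> \<le> C) \<Longrightarrow> \<bar>f x\<bar> \<le> A"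
    using continuous_bounded_on_cube[OF C_infinity_continuous[OF assms]] by blast
  have "integrable P (\<lambda>\<mu>. (cyl_fun \<phi> f \<mu>)\<^sup>2)"
  proof (rule integrable_const_bound[of _ "A\<^sup>2"])
    show "AE \<mu> in P. norm ((cyl_fun \<phi> f \<mu>)\<^sup>2) \<le> A\<^sup>2"
    proof (rule AE_I2)
      fix \<mu> assume "\<mu> \<in> space P"
      then have "\<bar>cyl_fun \<phi> f \<mu>\<bar> \<le> A" unfolding eq by (intro A mean_vector_bound)
      then show "norm ((cyl_fun \<phi> f \<mu>)\<^sup>2) \<le> A\<^sup>2" using power_mono[of "\<bar>cyl_fun \<phi> f \<mu>\<bar>" A 2] by simp
    qed
  qed (use meas in simp)
  then show ?thesis using meas by (simp add: L2_space_def)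
qed

lemma cyl_grad_bounded_field:
  assumes f: "f \<in> C_infinity d"
  shows "bounded_field (cyl_grad d \<phi> f)"
proof -
  have "bounded_field (\<lambda>\<mu> x. \<Sum>i<d. pderivative i f (mean_vector d \<phi> \<mu>) * \<phi> i x)"
  proof (intro bounded_field_sum bounded_field_mult)
    fix i assume "i \<in> {..<d}"
    then have i: "i < d" by simp
    have cont: "continuous_on UNIV (pderivative i f)"
      by (rule C_infinity_continuous[OF C_infinity_pderivative[OF f i]])
    obtain A where A: "\<And>x. (\<And>i. \<bar>x i\<bar> \<le> C) \<Longrightarrow> \<bar>pderivative i f x\<bar> \<le> A"
      using continuous_bounded_on_cube[OF cont] by blast
    show "bounded_field (\<lambda>\<mu> x. pderivative i f (mean_vector d \<phi> \<mu>))"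
      by (intro bounded_field_coefficient[of _ A] mean_vector_comp_measurable cont A mean_vector_bound)
    show "bounded_field (\<lambda>\<mu>. \<phi> i)" by (rule bounded_field_space[OF \<phi>[OF i]])
  qed
  also have "(\<lambda>\<mu> x. \<Sum>i<d. pderivative i f (mean_vector d \<phi> \<mu>) * \<phi> i x) = cyl_grad d \<phi> f"
    unfolding cyl_grad_def[abs_def]
    by (intro ext sum.cong refl arg_cong2[where f = "(*)"] mean_vector_eq[symmetric, OF C_infinity_pderivative[OF f]]) auto
  finally show ?thesis .
qed

end

context
  fixes d :: nat and \<phi> :: "nat \<Rightarrow> 'a \<Rightarrow> real" and \<psi> :: "nat \<Rightarrow> nat \<Rightarrow> 'a \<Rightarrow> real"
    and C :: real and f :: "(nat \<Rightarrow> real) \<Rightarrow> real"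
  assumes C: "0 \<le> C" and f: "f \<in> C_infinity d"
    and \<phi>: "\<And>i. i < d \<Longrightarrow> \<phi> i \<in> borel_measurable borel" "\<And>i x. i < d \<Longrightarrow> \<bar>\<phi> i x\<bar> \<le> C"
    and \<psi>: "\<And>n i. i < d \<Longrightarrow> \<psi> n i \<in> borel_measurable borel" "\<And>n i x. i < d \<Longrightarrow> \<bar>\<psi> n i x\<bar> \<le> C"
    and L1_lim: "AE \<mu> in P. \<forall>i<d. (\<lambda>n. \<integral>x. \<bar>\<psi> n i x - \<phi> i x\<bar> \<partial>\<mu>) \<longlonglongrightarrow> 0"
begin

lemma comp_means_tendsto:
  assumes \<mu>: "\<mu> \<in> space P" and lim: "\<forall>i<d. (\<lambda>n. \<integral>x. \<bar>\<psi> n i x - \<phi> i x\<bar> \<partial>\<mu>) \<longlonglongrightarrow> 0"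
    and g: "g \<in> C_infinity d"
  shows "(\<lambda>n. g (\<lambda>i. \<integral>x. \<psi> n i x \<partial>\<mu>)) \<longlonglongrightarrow> g (\<lambda>i. \<integral>x. \<phi> i x \<partial>\<mu>)"
proof -
  interpret \<mu>: prob_space \<mu> by (rule prob_space_P[OF \<mu>])
  have "(\<lambda>n. mean_vector d (\<psi> n) \<mu>) \<longlonglongrightarrow> mean_vector d \<phi> \<mu>"
  proof (rule tendsto_coordinatewise)
    fix i
    show "(\<lambda>n. mean_vector d (\<psi> n) \<mu> i) \<longlonglongrightarrow> mean_vector d \<phi> \<mu> i"
    proof (cases "i < d")
      case True
      have "(\<lambda>n. \<integral>x. \<psi> n i x \<partial>\<mu>) \<longlonglongrightarrow> (\<integral>x. \<phi> i x \<partial>\<mu>)"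
        by (rule \<mu>.integral_tendsto_L1[OF integrable_\<mu>[OF \<mu> \<psi>[OF True]]
              integrable_\<mu>[OF \<mu> \<phi>[OF True]] lim[rule_format, OF True]])
      then show ?thesis using True by (simp add: mean_vector_def)
    qed (simp add: mean_vector_def)
  qed
  moreover have "isCont g (mean_vector d \<phi> \<mu>)"
    using C_infinity_continuous[OF g] by (simp add: continuous_on_eq_continuous_at)
  ultimately show ?thesis
    unfolding mean_vector_eq[OF g] by (intro isCont_tendsto_compose[of _ g])
qed

lemma comp_means_bound:
  assumes g: "g \<in> C_infinity d"
  shows "\<exists>A\<ge>0. \<forall>\<mu>\<in>space P. \<bar>g (\<lambda>i. \<integral>x. \<phi> i x \<partial>\<mu>)\<bar> \<le> A \<and> (\<forall>n. \<bar>g (\<lambda>i. \<integral>x. \<psi> n i x \<partial>\<mu>)\<bar> \<le> A)"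
proof -
  obtain A where A: "0 \<le> A" "\<And>x. (\<And>i. \<bar>x i\<bar> \<le> C) \<Longrightarrow> \<bar>g x\<bar> \<le> A"
    using continuous_bounded_on_cube[OF C_infinity_continuous[OF g]] by blast
  have "\<bar>g (mean_vector d \<phi> \<mu>)\<bar> \<le> A" "\<bar>g (mean_vector d (\<psi> n) \<mu>)\<bar> \<le> A" if "\<mu> \<in> space P" for \<mu> n
    using mean_vector_bound[OF \<phi> C that] mean_vector_bound[OF \<psi> C that] by (auto intro!: A)
  then show ?thesis using A(1) by (auto simp: mean_vector_eq[OF g])
qed

lemma cyl_fun_tendsto: "(\<lambda>n. sqdist P (cyl_fun (\<psi> n) f) (cyl_fun \<phi> f)) \<longlonglongrightarrow> 0"
proof -
  let ?F = "cyl_fun \<phi> f" and ?G = "\<lambda>n. cyl_fun (\<psi> n) f"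
  obtain A where A: "\<And>\<mu>. \<mu> \<in> space P \<Longrightarrow> \<bar>?F \<mu>\<bar> \<le> A" "\<And>\<mu> n. \<mu> \<in> space P \<Longrightarrow> \<bar>?G n \<mu>\<bar> \<le> A"
    using comp_means_bound[OF f] unfolding cyl_fun_def by blast
  have "(\<lambda>n. \<integral>\<mu>. (?G n \<mu> - ?F \<mu>)\<^sup>2 \<partial>P) \<longlonglongrightarrow> (\<integral>\<mu>. 0 \<partial>P)"
  proof (rule integral_dominated_convergence[where w = "\<lambda>_. (2 * A)\<^sup>2"])
    show "(\<lambda>\<mu>. (?G n \<mu> - ?F \<mu>)\<^sup>2) \<in> borel_measurable P" for n
      using L2_measurable[OF cyl_fun_L2[OF \<psi> C f]] L2_measurable[OF cyl_fun_L2[OF \<phi> C f]] by measurable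
    show "AE \<mu> in P. (\<lambda>n. (?G n \<mu> - ?F \<mu>)\<^sup>2) \<longlonglongrightarrow> 0"
      using L1_lim AE_space
    proof eventually_elim
      case (elim \<mu>)
      have "(\<lambda>n. (?G n \<mu> - ?F \<mu>)\<^sup>2) \<longlonglongrightarrow> (?F \<mu> - ?F \<mu>)\<^sup>2"
        using comp_means_tendsto[OF elim(2,1) f] unfolding cyl_fun_def by (intro tendsto_intros)
      then show ?case by simp
    qed
    show "AE \<mu> in P. norm ((?G n \<mu> - ?F \<mu>)\<^sup>2) \<le> (2 * A)\<^sup>2" for n
    proof (rule AE_I2)
      fix \<mu> assume \<mu>: "\<mu> \<in> space P"
      have "\<bar>?G n \<mu> - ?F \<mu>\<bar> \<le> 2 * A"
        using A(1)[OF \<mu>] A(2)[OF \<mu>, of n] by linarith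
      then show "norm ((?G n \<mu> - ?F \<mu>)\<^sup>2) \<le> (2 * A)\<^sup>2"
        using power_mono[of "\<bar>?G n \<mu> - ?F \<mu>\<bar>" "2 * A" 2] by simp
    qed
  qed simp_all
  then show ?thesis by (simp add: sqdist_def)
qed

text \<open>
The coefficients of the gradients, partial derivatives of \<open>f\<close> at the means, converge together with the means. So the
gradients converge in \<open>L\<^sup>1(\<mu>)\<close> for almost every \<open>\<mu>\<close> under a uniform bound.
\<close>

lemma energy_cyl_grad_tendsto:
  "(\<lambda>n. energy P (cyl_grad d (\<psi> n) f) (cyl_grad d (\<psi> n) f)) \<longlonglongrightarrow> energy P (cyl_grad d \<phi> f) (cyl_grad d \<phi> f)"
proof -
  let ?p = "\<lambda>i \<phi> \<mu>. pderivative i f (\<lambda>i. \<integral>x. \<phi> i x \<partial>\<mu>)"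
  let ?A = "\<lambda>i A. 0 \<le> A \<and> (\<forall>\<mu>\<in>space P. \<bar>?p i \<phi> \<mu>\<bar> \<le> A \<and> (\<forall>n. \<bar>?p i (\<psi> n) \<mu>\<bar> \<le> A))"
  have "\<exists>A. i < d \<longrightarrow> ?A i A" for i
    using comp_means_bound[OF C_infinity_pderivative[OF f, of i]] by (cases "i < d") simp_all
  from choice[OF allI[OF this]] obtain A where A': "\<forall>i. i < d \<longrightarrow> ?A i (A i)" ..
  have A: "0 \<le> A i" if "i < d" for i using A' that by simp
  have A_\<phi>: "\<bar>?p i \<phi> \<mu>\<bar> \<le> A i" and A_\<psi>: "\<bar>?p i (\<psi> n) \<mu>\<bar> \<le> A i" if "i < d" "\<mu> \<in> space P" for i \<mu> n
    using A' that by simp_all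
  have fields: "bounded_field (cyl_grad d (\<psi> n) f)" "bounded_field (cyl_grad d \<phi> f)" for n
    by (rule cyl_grad_bounded_field[OF \<psi> C f] cyl_grad_bounded_field[OF \<phi> C f]; assumption)+
  have grad_bound: "\<bar>cyl_grad d \<theta> f \<mu> x\<bar> \<le> (\<Sum>i<d. A i * C)"
    if p: "\<And>i. i < d \<Longrightarrow> \<bar>?p i \<theta> \<mu>\<bar> \<le> A i" and \<theta>: "\<And>i. i < d \<Longrightarrow> \<bar>\<theta> i x\<bar> \<le> C" for \<theta> \<mu> x
    unfolding cyl_grad_def
  proof (intro order_trans[OF sum_abs] sum_mono)
    fix i assume "i \<in> {..<d}"
    then have i: "i < d" by simp
    show "\<bar>?p i \<theta> \<mu> * \<theta> i x\<bar> \<le> A i * C"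
      unfolding abs_mult by (intro mult_mono p[OF i] \<theta>[OF i] A[OF i] abs_ge_zero)
  qed
  show ?thesis
  proof (rule energy_tendsto)
    show "bounded_field (cyl_grad d (\<psi> n) f)" "bounded_field (cyl_grad d \<phi> f)" for n by (rule fields)+
    show "\<bar>cyl_grad d (\<psi> n) f \<mu> x\<bar> \<le> (\<Sum>i<d. A i * C)" if "\<mu> \<in> space P" for n \<mu> x
      by (rule grad_bound[OF A_\<psi>[OF _ that] \<psi>(2)])
    show "\<bar>cyl_grad d \<phi> f \<mu> x\<bar> \<le> (\<Sum>i<d. A i * C)" if "\<mu> \<in> space P" for \<mu> x
      by (rule grad_bound[OF A_\<phi>[OF _ that] \<phi>(2)])
    show "AE \<mu> in P. (\<lambda>n. \<integral>x. \<bar>cyl_grad d (\<psi> n) f \<mu> x - cyl_grad d \<phi> f \<mu> x\<bar> \<partial>\<mu>) \<longlonglongrightarrow> 0"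
      using L1_lim AE_space
    proof eventually_elim
      case (elim \<mu>)
      interpret \<mu>: prob_space \<mu> by (rule prob_space_P[OF elim(2)])
      let ?a = "\<lambda>n i. ?p i (\<psi> n) \<mu>" and ?b = "\<lambda>i. ?p i \<phi> \<mu>"
      let ?s = "\<lambda>n i x. A i * \<bar>\<psi> n i x - \<phi> i x\<bar> + \<bar>?a n i - ?b i\<bar> * C"
      let ?e = "\<lambda>n. \<Sum>i<d. A i * (\<integral>x. \<bar>\<psi> n i x - \<phi> i x\<bar> \<partial>\<mu>) + \<bar>?a n i - ?b i\<bar> * C"
      have "?e \<longlonglongrightarrow> (\<Sum>i<d. A i * 0 + \<bar>?b i - ?b i\<bar> * C)"
      proof (intro tendsto_sum tendsto_add tendsto_mult tendsto_const tendsto_rabs tendsto_diff)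
        fix i assume "i \<in> {..<d}"
        then have i: "i < d" by simp
        show "(\<lambda>n. \<integral>x. \<bar>\<psi> n i x - \<phi> i x\<bar> \<partial>\<mu>) \<longlonglongrightarrow> 0" using elim(1) i by simp
        show "(\<lambda>n. ?a n i) \<longlonglongrightarrow> ?b i" by (rule comp_means_tendsto[OF elim(2,1) C_infinity_pderivative[OF f i]])
      qed
      then have e_lim: "?e \<longlonglongrightarrow> 0" by simp
      have e_bound: "norm (\<integral>x. \<bar>cyl_grad d (\<psi> n) f \<mu> x - cyl_grad d \<phi> f \<mu> x\<bar> \<partial>\<mu>) \<le> ?e n" for n
      proof -
        have product_diff: "\<bar>p * s - q * t\<bar> \<le> a * \<bar>s - t\<bar> + \<bar>p - q\<bar> * C"
          if "\<bar>p\<bar> \<le> a" "\<bar>t\<bar> \<le> C" for a p q s t :: real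
        proof -
          have eq: "p * s - q * t = p * (s - t) + (p - q) * t" by (simp add: algebra_simps)
          have "\<bar>p * s - q * t\<bar> \<le> \<bar>p\<bar> * \<bar>s - t\<bar> + \<bar>p - q\<bar> * \<bar>t\<bar>"
            unfolding eq abs_mult[symmetric] by (rule abs_triangle_ineq)
          also have "\<dots> \<le> a * \<bar>s - t\<bar> + \<bar>p - q\<bar> * C"
            using that by (intro add_mono mult_right_mono mult_left_mono) auto
          finally show ?thesis .
        qed
        have pw: "\<bar>cyl_grad d (\<psi> n) f \<mu> x - cyl_grad d \<phi> f \<mu> x\<bar> \<le> (\<Sum>i<d. ?s n i x)" for x
        proof -
          have eq: "cyl_grad d (\<psi> n) f \<mu> x - cyl_grad d \<phi> f \<mu> x = (\<Sum>i<d. ?a n i * \<psi> n i x - ?b i * \<phi> i x)"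
            by (simp only: cyl_grad_def sum_subtractf)
          show ?thesis
            unfolding eq
          proof (intro order_trans[OF sum_abs] sum_mono)
            fix i assume "i \<in> {..<d}"
            then have i: "i < d" by simp
            show "\<bar>?a n i * \<psi> n i x - ?b i * \<phi> i x\<bar> \<le> ?s n i x"
              by (rule product_diff[OF A_\<psi>[OF i elim(2)] \<phi>(2)[OF i]])
          qed
        qed
        have close: "integrable \<mu> (\<lambda>x. \<bar>\<psi> n i x - \<phi> i x\<bar>)" if "i < d" for i
          using integrable_\<mu>[OF elim(2) \<psi>[OF that]] integrable_\<mu>[OF elim(2) \<phi>[OF that]]
          by (intro integrable_abs Bochner_Integration.integrable_diff)
        have summands: "integrable \<mu> (?s n i)" if "i \<in> {..<d}" for i
          using close[of i] that by (intro Bochner_Integration.integrable_add integrable_mult_right) auto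
        have "(\<integral>x. \<bar>cyl_grad d (\<psi> n) f \<mu> x - cyl_grad d \<phi> f \<mu> x\<bar> \<partial>\<mu>) \<le> (\<integral>x. (\<Sum>i<d. ?s n i x) \<partial>\<mu>)"
          by (intro integral_mono[OF _ _ pw] integrable_abs Bochner_Integration.integrable_diff
              Bochner_Integration.integrable_sum summands bounded_field_integrable fields elim(2))
        also have "\<dots> = (\<Sum>i<d. \<integral>x. ?s n i x \<partial>\<mu>)"
          by (rule Bochner_Integration.integral_sum[OF summands])
        also have "\<dots> = ?e n"
          using close by (intro sum.cong refl) (simp add: \<mu>.prob_space)
        finally show ?thesis by simp
      qed
      show ?case
        by (rule Lim_null_comparison[OF always_eventually[OF allI[OF e_bound]] e_lim])
    qed
  qed
qed

end

end

section \<open>The projection forms\<close>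

locale mean_random_probability = random_probability P + generating_partitions \<nu> B
  for P :: "'a::topological_space measure measure" and \<nu> :: "'a measure" and B :: "nat \<Rightarrow> nat \<Rightarrow> 'a set" +
  assumes mean: "\<psi> \<in> borel_measurable borel \<Longrightarrow>
    (\<integral>\<^sup>+\<mu>. (\<integral>\<^sup>+x. \<psi> x \<partial>\<mu>) \<partial>P) = (\<integral>\<^sup>+x. \<psi> x \<partial>\<nu>)"
begin

lemma mean_integral:
  fixes \<psi> :: "'a \<Rightarrow> real"
  assumes \<psi>: "\<psi> \<in> borel_measurable borel" and nonneg: "\<And>x. 0 \<le> \<psi> x" and C: "\<And>x. \<bar>\<psi> x\<bar> \<le> C"
  shows "integrable P (\<lambda>\<mu>. \<integral>x. \<psi> x \<partial>\<mu>)" and "(\<integral>\<mu>. (\<integral>x. \<psi> x \<partial>\<mu>) \<partial>P) = (\<integral>x. \<psi> x \<partial>\<nu>)"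
proof -
  show int: "integrable P (\<lambda>\<mu>. \<integral>x. \<psi> x \<partial>\<mu>)"
  proof (rule integrable_const_bound[of _ C])
    show "AE \<mu> in P. norm (\<integral>x. \<psi> x \<partial>\<mu>) \<le> C"
    proof (rule AE_I2)
      fix \<mu> assume \<mu>: "\<mu> \<in> space P"
      then interpret \<mu>: prob_space \<mu> by (rule prob_space_P)
      show "norm (\<integral>x. \<psi> x \<partial>\<mu>) \<le> C"
        using \<mu>.abs_integral_le[OF integrable_\<mu>[OF \<mu> \<psi> C] C] by simp
    qed
    show "(\<lambda>\<mu>. \<integral>x. \<psi> x \<partial>\<mu>) \<in> borel_measurable P"
      by (rule integral_measurable[OF bounded_field_space[OF \<psi> C]])
  qed
  have int_\<nu>: "integrable \<nu> \<psi>"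
    using \<psi> C by (intro \<nu>.integrable_const_bound[of _ C]) (auto simp: borel_measurable_\<nu>)
  have "ennreal (\<integral>\<mu>. (\<integral>x. \<psi> x \<partial>\<mu>) \<partial>P) = (\<integral>\<^sup>+\<mu>. ennreal (\<integral>x. \<psi> x \<partial>\<mu>) \<partial>P)"
    using nonneg by (intro nn_integral_eq_integral[symmetric] int AE_I2 Bochner_Integration.integral_nonneg)
  also have "\<dots> = (\<integral>\<^sup>+\<mu>. (\<integral>\<^sup>+x. ennreal (\<psi> x) \<partial>\<mu>) \<partial>P)"
    using nonneg by (intro nn_integral_cong nn_integral_eq_integral[symmetric] integrable_\<mu>[OF _ \<psi> C] AE_I2)
  also have "\<dots> = (\<integral>\<^sup>+x. ennreal (\<psi> x) \<partial>\<nu>)"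
    using \<psi> by (intro mean) simp
  also have "\<dots> = ennreal (\<integral>x. \<psi> x \<partial>\<nu>)"
    using nonneg by (intro nn_integral_eq_integral int_\<nu> AE_I2)
  finally show "(\<integral>\<mu>. (\<integral>x. \<psi> x \<partial>\<mu>) \<partial>P) = (\<integral>x. \<psi> x \<partial>\<nu>)"
    using nonneg by (subst (asm) ennreal_inj) (auto intro!: Bochner_Integration.integral_nonneg)
qed

abbreviation cell :: "nat \<Rightarrow> nat \<Rightarrow> 'a \<Rightarrow> real" where
  "cell k \<equiv> \<lambda>i. indicator (B k (Suc i))"

lemma cell_index: "i < 2 ^ k - 1 \<Longrightarrow> Suc i \<in> {1..2 ^ k}"
  by auto

lemma cell_borel: "1 \<le> k \<Longrightarrow> i < 2 ^ k - 1 \<Longrightarrow> cell k i \<in> borel_measurable borel"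
  using cell_measurable[OF _ cell_index] by simp

lemma cell_le_1: "\<bar>cell k i x\<bar> \<le> 1"
  by (simp add: indicator_def)

lemma proj_cyl_field: "1 \<le> k \<Longrightarrow> (G, DG) \<in> proj_cyl B k \<Longrightarrow> bounded_field DG"
  unfolding proj_cyl_def using cyl_grad_bounded_field[OF cell_borel cell_le_1 zero_le_one] by auto

lemma proj_cyl_smooth:
  assumes "1 \<le> k" "(G, DG) \<in> proj_cyl B k"
  shows "(G, DG) \<in> smooth_cyl"
proof -
  obtain f where f: "f \<in> C_infinity (2 ^ k - 1)" "G = cyl_fun (cell k) f" "DG = cyl_grad (2 ^ k - 1) (cell k) f"
    using assms(2) unfolding proj_cyl_def by blast
  have "(2::nat) ^ 1 \<le> 2 ^ k" using assms(1) by (intro power_increasing) auto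
  then have "(1::nat) \<le> 2 ^ k - 1" by simp
  moreover have "bounded (range (cell k i))" for i
    by (rule boundedI[of _ 1]) (auto simp: indicator_def)
  ultimately show ?thesis
    unfolding smooth_cyl_def using f cell_borel[OF assms(1)] by blast
qed

text \<open>
The integrals of step functions are linear in the masses of the cells. So cylinder functions of step functions are smooth
functions of these masses, and by the chain rule the gradients are the same. The equations are restricted to
\<open>space P\<close> because additivity of the integrals requires Borel probability measures.
\<close>

lemma step_cyl_in_proj_cyl:
  assumes k: "1 \<le> k" and f: "f \<in> C_infinity d"
    and \<psi>: "\<And>i x. \<psi> i x = (\<Sum>j<2 ^ k - 1. c i j * cell k j x)"
  obtains G DG where "(G, DG) \<in> proj_cyl B k"
    "\<And>\<mu>. \<mu> \<in> space P \<Longrightarrow> G \<mu> = cyl_fun \<psi> f \<mu>"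
    "\<And>\<mu>. \<mu> \<in> space P \<Longrightarrow> DG \<mu> = cyl_grad d \<psi> f \<mu>"
proof -
  let ?m = "2 ^ k - 1 :: nat"
  let ?g = "\<lambda>y. f (linear_map c ?m y)"
  have mean_\<psi>: "linear_map c ?m (\<lambda>j. \<integral>x. cell k j x \<partial>\<mu>) = (\<lambda>i. \<integral>x. \<psi> i x \<partial>\<mu>)" if \<mu>: "\<mu> \<in> space P" for \<mu>
  proof
    fix i
    have int: "integrable \<mu> (cell k j)" if "j < ?m" for j
      by (rule integrable_\<mu>[OF \<mu> cell_borel[OF k that] cell_le_1])
    have "(\<integral>x. \<psi> i x \<partial>\<mu>) = (\<integral>x. (\<Sum>j<?m. c i j * cell k j x) \<partial>\<mu>)" by (simp only: \<psi>)
    also have "\<dots> = (\<Sum>j<?m. \<integral>x. c i j * cell k j x \<partial>\<mu>)"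
      using int by (intro Bochner_Integration.integral_sum integrable_mult_right) auto
    also have "\<dots> = linear_map c ?m (\<lambda>j. \<integral>x. cell k j x \<partial>\<mu>) i"
      unfolding linear_map_def using int by (intro sum.cong refl integral_mult_right) auto
    finally show "linear_map c ?m (\<lambda>j. \<integral>x. cell k j x \<partial>\<mu>) i = (\<integral>x. \<psi> i x \<partial>\<mu>)" ..
  qed
  show ?thesis
  proof (rule that)
    show "(cyl_fun (cell k) ?g, cyl_grad ?m (cell k) ?g) \<in> proj_cyl B k"
      unfolding proj_cyl_def using C_infinity_linear_map[OF f] by blast
    fix \<mu> assume \<mu>: "\<mu> \<in> space P"
    show "cyl_fun (cell k) ?g \<mu> = cyl_fun \<psi> f \<mu>"
      unfolding cyl_fun_def mean_\<psi>[OF \<mu>] ..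
    show "cyl_grad ?m (cell k) ?g \<mu> = cyl_grad d \<psi> f \<mu>"
    proof
      fix x
      let ?p = "\<lambda>i. pderivative i f (\<lambda>i. \<integral>x. \<psi> i x \<partial>\<mu>)"
      have "pderivative j ?g (\<lambda>j. \<integral>x. cell k j x \<partial>\<mu>) = (\<Sum>i<d. c i j * ?p i)" if "j < ?m" for j
        by (simp only: pderivative_linear_map[OF f that] mean_\<psi>[OF \<mu>])
      then have "cyl_grad ?m (cell k) ?g \<mu> x = (\<Sum>j<?m. (\<Sum>i<d. c i j * ?p i) * cell k j x)"
        unfolding cyl_grad_def by (intro sum.cong refl arg_cong2[where f = "(*)"]) auto
      also have "\<dots> = (\<Sum>j<?m. \<Sum>i<d. ?p i * (c i j * cell k j x))"
        by (simp add: sum_distrib_right sum_distrib_left mult_ac)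
      also have "\<dots> = (\<Sum>i<d. \<Sum>j<?m. ?p i * (c i j * cell k j x))"
        by (rule sum.swap)
      also have "\<dots> = (\<Sum>i<d. ?p i * (\<Sum>j<?m. c i j * cell k j x))"
        by (simp only: sum_distrib_left)
      also have "\<dots> = cyl_grad d \<psi> f \<mu> x"
        by (simp only: cyl_grad_def \<psi>[symmetric])
      finally show "cyl_grad ?m (cell k) ?g \<mu> x = cyl_grad d \<psi> f \<mu> x" .
    qed
  qed
qed

text \<open>
The energies of the projection form, attached to all functions that agree almost everywhere with some function in its domain.
\<close>

definition proj_rel :: "nat \<Rightarrow> ('a measure \<Rightarrow> real) \<Rightarrow> real \<Rightarrow> bool" where
  "proj_rel k F a \<longleftrightarrow> F \<in> L2_space P \<and>
     (\<exists>G DG. (G, DG) \<in> proj_cyl B k \<and> (AE \<mu> in P. G \<mu> = F \<mu>) \<and> a = energy P DG DG)"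

text \<open>
A cell is the union of its two halves, and the halves of the first \<open>2\<^sup>k - 1\<close> cells of one generation are among the first
\<open>2\<^bsup>k+1\<^esup> - 1\<close> cells of the next. So the masses in one generation are linear functions of the masses in the next.
\<close>

lemma proj_rel_Suc:
  assumes k: "1 \<le> k" and "proj_rel k F a"
  shows "proj_rel (Suc k) F a"
proof -
  let ?m = "2 ^ k - 1 :: nat"
  obtain f where F: "F \<in> L2_space P" and f: "f \<in> C_infinity ?m"
    and AE: "AE \<mu> in P. cyl_fun (cell k) f \<mu> = F \<mu>"
    and a: "a = energy P (cyl_grad ?m (cell k) f) (cyl_grad ?m (cell k) f)"
    using assms(2) unfolding proj_rel_def proj_cyl_def by blast
  define c where "c i j = (of_bool (j div 2 = i) :: real)" for i j :: nat
  define \<psi> where "\<psi> i x = (\<Sum>j<2 ^ Suc k - 1. c i j * cell (Suc k) j x)" for i x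
  have \<psi>: "\<psi> i = cell k i" if i: "i < ?m" for i
  proof
    fix x
    have idx: "Suc i \<in> {1..2 ^ k}" by (rule cell_index[OF i])
    have split: "B k (Suc i) = B (Suc k) (Suc (2 * i)) \<union> B (Suc k) (Suc (2 * i + 1))"
      using cell_split[OF k idx] by simp
    have "x \<notin> B (Suc k) (Suc (2 * i + 1))" if "x \<in> B (Suc k) (Suc (2 * i))"
    proof
      assume "x \<in> B (Suc k) (Suc (2 * i + 1))"
      then have "Suc (2 * i) = Suc (2 * i + 1)"
        using that idx by (intro cell_disjoint[of "Suc k" _ _ x]) auto
      then show False by simp
    qed
    then have two: "cell k i x = cell (Suc k) (2 * i) x + cell (Suc k) (2 * i + 1) x"
      unfolding split by (auto simp: indicator_def)
    have "\<psi> i x = (\<Sum>j\<in>{2 * i, 2 * i + 1}. c i j * cell (Suc k) j x)"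
      unfolding \<psi>_def using i by (intro sum.mono_neutral_right) (auto simp: c_def)
    also have "\<dots> = cell k i x" unfolding two by (simp add: c_def)
    finally show "\<psi> i x = cell k i x" .
  qed
  obtain G DG where G: "(G, DG) \<in> proj_cyl B (Suc k)"
    "\<And>\<mu>. \<mu> \<in> space P \<Longrightarrow> G \<mu> = cyl_fun \<psi> f \<mu>"
    "\<And>\<mu>. \<mu> \<in> space P \<Longrightarrow> DG \<mu> = cyl_grad ?m \<psi> f \<mu>"
    by (rule step_cyl_in_proj_cyl[where \<psi> = \<psi> and c = c, OF _ f \<psi>_def]) simp_all
  have mean_eq: "g (\<lambda>i. \<integral>x. \<psi> i x \<partial>\<mu>) = g (\<lambda>i. \<integral>x. cell k i x \<partial>\<mu>)" if "g \<in> C_infinity ?m" for g \<mu>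
    using that by (rule C_infinity_cong_coords) (simp add: \<psi>)
  have G_eq: "G \<mu> = cyl_fun (cell k) f \<mu>" if "\<mu> \<in> space P" for \<mu>
    unfolding G(2)[OF that] cyl_fun_def by (rule mean_eq[OF f])
  have "AE \<mu> in P. G \<mu> = F \<mu>"
    using AE AE_space by eventually_elim (simp add: G_eq)
  moreover have "DG \<mu> = cyl_grad ?m (cell k) f \<mu>" if "\<mu> \<in> space P" for \<mu>
    unfolding G(3)[OF that] cyl_grad_def[abs_def]
    by (intro ext sum.cong refl) (simp add: \<psi> mean_eq[OF C_infinity_pderivative[OF f]])
  then have "energy P DG DG = a" unfolding a by (rule energy_cong)
  ultimately show ?thesis unfolding proj_rel_def using F G(1) by blast
qed

lemma proj_rel_mono:
  assumes "1 \<le> k" "proj_rel k F a" "k \<le> l"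
  shows "proj_rel l F a"
  using assms(3)
proof (induction l rule: dec_induct)
  case (step n)
  then show ?case using assms(1) by (intro proj_rel_Suc) auto
qed (rule assms(2))

lemma proj_rel_scale:
  assumes "proj_rel k F a"
  shows "proj_rel k (\<lambda>x. c * F x) (c\<^sup>2 * a)"
proof -
  let ?m = "2 ^ k - 1 :: nat"
  obtain f where F: "F \<in> L2_space P" and f: "f \<in> C_infinity ?m"
    and AE: "AE \<mu> in P. cyl_fun (cell k) f \<mu> = F \<mu>"
    and a: "a = energy P (cyl_grad ?m (cell k) f) (cyl_grad ?m (cell k) f)"
    using assms unfolding proj_rel_def proj_cyl_def by blast
  let ?g = "\<lambda>x. c * f x"
  have g: "?g \<in> C_infinity ?m" using C_infinity_lincomb[OF f f, of c 0] by simp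
  have grad: "cyl_grad ?m (cell k) ?g = (\<lambda>\<mu> x. c * cyl_grad ?m (cell k) f \<mu> x)"
    unfolding cyl_grad_def[abs_def] sum_distrib_left
    using pderivative_lincomb[OF f f, of _ c 0] by (intro ext sum.cong refl) simp
  have "AE \<mu> in P. cyl_fun (cell k) ?g \<mu> = c * F \<mu>"
    using AE by eventually_elim (simp add: cyl_fun_def)
  moreover have "c\<^sup>2 * a = energy P (cyl_grad ?m (cell k) ?g) (cyl_grad ?m (cell k) ?g)"
    unfolding grad energy_scale a ..
  moreover have "(cyl_fun (cell k) ?g, cyl_grad ?m (cell k) ?g) \<in> proj_cyl B k"
    unfolding proj_cyl_def using g by blast
  ultimately show ?thesis unfolding proj_rel_def using L2_mult[OF F] by blast
qed

lemma proj_rel_parallelogram: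
  assumes k: "1 \<le> k" and Fa: "proj_rel k F a" and Gb: "proj_rel k G b"
  shows "\<exists>a' b'. proj_rel k (\<lambda>x. F x + G x) a' \<and> proj_rel k (\<lambda>x. F x - G x) b' \<and> a' + b' = 2 * a + 2 * b"
proof -
  let ?m = "2 ^ k - 1 :: nat"
  let ?D = "cyl_grad ?m (cell k)"
  obtain f where F: "F \<in> L2_space P" and f: "f \<in> C_infinity ?m"
    and AEf: "AE \<mu> in P. cyl_fun (cell k) f \<mu> = F \<mu>" and a: "a = energy P (?D f) (?D f)"
    using Fa unfolding proj_rel_def proj_cyl_def by blast
  obtain g where G: "G \<in> L2_space P" and g: "g \<in> C_infinity ?m"
    and AEg: "AE \<mu> in P. cyl_fun (cell k) g \<mu> = G \<mu>" and b: "b = energy P (?D g) (?D g)"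
    using Gb unfolding proj_rel_def proj_cyl_def by blast
  let ?s = "\<lambda>x. f x + g x" and ?d = "\<lambda>x. f x - g x"
  have s: "?s \<in> C_infinity ?m" and d: "?d \<in> C_infinity ?m"
    using C_infinity_lincomb[OF f g, of 1 1] C_infinity_lincomb[OF f g, of 1 "-1"] by simp_all
  have grad_s: "?D ?s = (\<lambda>\<mu> x. ?D f \<mu> x + ?D g \<mu> x)"
    unfolding cyl_grad_def[abs_def] sum.distrib[symmetric]
    using pderivative_lincomb[OF f g, of _ 1 1] by (intro ext sum.cong refl) (simp add: distrib_right)
  have grad_d: "?D ?d = (\<lambda>\<mu> x. ?D f \<mu> x - ?D g \<mu> x)"
    unfolding cyl_grad_def[abs_def] sum_subtractf[symmetric]
    using pderivative_lincomb[OF f g, of _ 1 "-1"] by (intro ext sum.cong refl) (simp add: left_diff_distrib)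
  have fields: "bounded_field (?D f)" "bounded_field (?D g)"
    using cyl_grad_bounded_field[OF cell_borel[OF k] cell_le_1 zero_le_one] f g by auto
  have "proj_rel k (\<lambda>x. F x + G x) (energy P (?D ?s) (?D ?s))"
    unfolding proj_rel_def
  proof (intro conjI exI)
    show "(\<lambda>x. F x + G x) \<in> L2_space P" by (rule L2_add[OF F G])
    show "(cyl_fun (cell k) ?s, ?D ?s) \<in> proj_cyl B k" unfolding proj_cyl_def using s by blast
    show "AE \<mu> in P. cyl_fun (cell k) ?s \<mu> = F \<mu> + G \<mu>"
      using AEf AEg by eventually_elim (simp add: cyl_fun_def)
  qed (rule refl)
  moreover have "proj_rel k (\<lambda>x. F x - G x) (energy P (?D ?d) (?D ?d))"
    unfolding proj_rel_def
  proof (intro conjI exI)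
    show "(\<lambda>x. F x - G x) \<in> L2_space P" by (rule L2_diff[OF F G])
    show "(cyl_fun (cell k) ?d, ?D ?d) \<in> proj_cyl B k" unfolding proj_cyl_def using d by blast
    show "AE \<mu> in P. cyl_fun (cell k) ?d \<mu> = F \<mu> - G \<mu>"
      using AEf AEg by eventually_elim (simp add: cyl_fun_def)
  qed (rule refl)
  moreover have "energy P (?D ?s) (?D ?s) + energy P (?D ?d) (?D ?d) = 2 * a + 2 * b"
    unfolding grad_s grad_d a b by (rule energy_parallelogram[OF fields])
  ultimately show ?thesis by blast
qed

definition cyl_rel :: "('a measure \<Rightarrow> real) \<Rightarrow> real \<Rightarrow> bool" where
  "cyl_rel F a \<longleftrightarrow> (\<exists>k\<ge>1. proj_rel k F a)"

sublocale cyl: quadratic_relation P cyl_rel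
proof
  fix F a assume "cyl_rel F a"
  then obtain k where k: "1 \<le> k" "proj_rel k F a" unfolding cyl_rel_def by blast
  then show "F \<in> L2_space P" by (simp add: proj_rel_def)
  show "0 \<le> a"
    using k proj_cyl_field energy_nonneg unfolding proj_rel_def by blast
  show "cyl_rel (\<lambda>x. c * F x) (c\<^sup>2 * a)" for c
    using k proj_rel_scale unfolding cyl_rel_def by blast
  fix G b assume "cyl_rel G b"
  then obtain l where l: "1 \<le> l" "proj_rel l G b" unfolding cyl_rel_def by blast
  have "1 \<le> max k l" using k(1) by simp
  moreover from this obtain a' b' where
    "proj_rel (max k l) (\<lambda>x. F x + G x) a'" "proj_rel (max k l) (\<lambda>x. F x - G x) b'" "a' + b' = 2 * a + 2 * b"
    using proj_rel_parallelogram[OF _ proj_rel_mono[OF k] proj_rel_mono[OF l], of "max k l"] by auto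
  ultimately show "\<exists>a' b'. cyl_rel (\<lambda>x. F x + G x) a' \<and> cyl_rel (\<lambda>x. F x - G x) b' \<and> a' + b' = 2 * a + 2 * b"
    unfolding cyl_rel_def by blast
next
  have one: "(\<lambda>x. 0) \<in> C_infinity (2 ^ 1 - 1)" by (rule C_infinity_const)
  have "proj_rel 1 (\<lambda>x. 0) 0"
    unfolding proj_rel_def
  proof (intro conjI exI L2_zero)
    show "(cyl_fun (cell 1) (\<lambda>x. 0), cyl_grad (2 ^ 1 - 1) (cell 1) (\<lambda>x. 0)) \<in> proj_cyl B 1"
      unfolding proj_cyl_def using one by blast
  qed (auto simp: cyl_fun_def cyl_grad_def[abs_def] pderivative_const energy_def cov_form_def)
  then show "cyl_rel (\<lambda>x. 0) 0" unfolding cyl_rel_def by blast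
qed

lemma step_cyl_rel:
  assumes k: "1 \<le> k" and f: "f \<in> C_infinity d"
    and \<psi>: "\<And>i x. \<psi> i x = (\<Sum>j<2 ^ k - 1. c i j * cell k j x)"
    and L2: "cyl_fun \<psi> f \<in> L2_space P"
  shows "cyl_rel (cyl_fun \<psi> f) (energy P (cyl_grad d \<psi> f) (cyl_grad d \<psi> f))"
proof (rule step_cyl_in_proj_cyl[OF k f \<psi>])
  fix G DG assume G: "(G, DG) \<in> proj_cyl B k" and G_eq: "\<And>\<mu>. \<mu> \<in> space P \<Longrightarrow> G \<mu> = cyl_fun \<psi> f \<mu>"
    and DG_eq: "\<And>\<mu>. \<mu> \<in> space P \<Longrightarrow> DG \<mu> = cyl_grad d \<psi> f \<mu>"
  have "energy P DG DG = energy P (cyl_grad d \<psi> f) (cyl_grad d \<psi> f)" by (rule energy_cong[OF DG_eq])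
  moreover have "AE \<mu> in P. G \<mu> = cyl_fun \<psi> f \<mu>" using G_eq by (rule AE_I2)
  ultimately have "proj_rel k (cyl_fun \<psi> f) (energy P (cyl_grad d \<psi> f) (cyl_grad d \<psi> f))"
    unfolding proj_rel_def using G L2 by (intro conjI exI[of _ G] exI[of _ DG]) simp_all
  then show ?thesis unfolding cyl_rel_def using k by blast
qed

lemma common_bound:
  fixes \<phi> :: "nat \<Rightarrow> 'a \<Rightarrow> real"
  assumes "\<And>i. i < d \<Longrightarrow> bounded (range (\<phi> i))"
  obtains C where "0 \<le> C" "\<And>i x. i < d \<Longrightarrow> \<bar>\<phi> i x\<bar> \<le> C"
proof -
  have "bounded (\<Union>i<d. range (\<phi> i))" using assms by auto
  then obtain C where "0 < C" "\<And>y. y \<in> (\<Union>i<d. range (\<phi> i)) \<Longrightarrow> norm y \<le> C"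
    unfolding bounded_pos by blast
  then show ?thesis by (intro that[of C]) auto
qed

end

section \<open>Mosco convergence\<close>

context mean_random_probability
begin

lemma simultaneous_step_approximation:
  fixes \<phi> :: "nat \<Rightarrow> 'a \<Rightarrow> real" and C \<epsilon> :: real
  assumes \<phi>: "\<And>i. i < d \<Longrightarrow> \<phi> i \<in> borel_measurable borel" "\<And>i x. i < d \<Longrightarrow> \<bar>\<phi> i x\<bar> \<le> C" and "0 < \<epsilon>"
  shows "\<exists>k c. 1 \<le> k \<and> (\<forall>i<d. (\<forall>x. \<bar>\<Sum>j<2 ^ k - 1. c i j * cell k j x\<bar> \<le> C) \<and>
    (\<integral>x. \<bar>\<phi> i x - (\<Sum>j<2 ^ k - 1. c i j * cell k j x)\<bar> \<partial>\<nu>) < \<epsilon>)"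
proof -
  let ?P = "\<lambda>i k c. (\<forall>x. \<bar>\<Sum>j<2 ^ k - 1. c j * cell k j x\<bar> \<le> C) \<and>
    (\<integral>x. \<bar>\<phi> i x - (\<Sum>j<2 ^ k - 1. c j * cell k j x)\<bar> \<partial>\<nu>) < \<epsilon>"
  have "\<exists>K. i < d \<longrightarrow> (\<forall>k\<ge>K. \<exists>c. ?P i k c)" for i
  proof (cases "i < d")
    case i: True
    show ?thesis
    proof (rule bounded_step_approximation[OF \<phi>(1)[OF i] \<phi>(2)[OF i] \<open>0 < \<epsilon>\<close>])
      fix K assume "\<And>k. K \<le> k \<Longrightarrow> \<exists>c. ?P i k c"
      then show "\<exists>K. i < d \<longrightarrow> (\<forall>k\<ge>K. \<exists>c. ?P i k c)" by (intro exI[of _ K] impI allI)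
    qed
  qed simp
  from choice[OF allI[OF this]] obtain K where K: "\<forall>i. i < d \<longrightarrow> (\<forall>k\<ge>K i. \<exists>c. ?P i k c)" ..
  define k where "k = Suc (\<Sum>i<d. K i)"
  have "K i \<le> k" if "i < d" for i
    using member_le_sum[of i "{..<d}" K] that by (simp add: k_def)
  then have "\<exists>c. i < d \<longrightarrow> ?P i k c" for i
    using K[rule_format, of i k] by (cases "i < d") simp_all
  from choice[OF allI[OF this]] obtain c where c: "\<forall>i. i < d \<longrightarrow> ?P i k (c i)" ..
  show ?thesis
  proof (intro exI conjI)
    show "1 \<le> k" by (simp add: k_def)
    show "\<forall>i<d. ?P i k (c i)" by (rule c)
  qed
qed

text \<open>
Convergence in \<open>L\<^sup>1(\<nu>)\<close> is convergence to \<open>0\<close> of the average over \<open>P\<close> of the distances in \<open>L\<^sup>1(\<mu>)\<close>. So along a subsequence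
these distances tend to \<open>0\<close> for almost every \<open>\<mu>\<close>.
\<close>

lemma AE_step_approximation:
  fixes \<phi> :: "nat \<Rightarrow> 'a \<Rightarrow> real" and C :: real
  assumes \<phi>: "\<And>i. i < d \<Longrightarrow> \<phi> i \<in> borel_measurable borel" "\<And>i x. i < d \<Longrightarrow> \<bar>\<phi> i x\<bar> \<le> C"
  shows "\<exists>k c. (\<forall>n. 1 \<le> k n) \<and> (\<forall>n. \<forall>i<d. \<forall>x. \<bar>\<Sum>j<2 ^ k n - 1. c n i j * cell (k n) j x\<bar> \<le> C) \<and>
    (AE \<mu> in P. \<forall>i<d. (\<lambda>n. \<integral>x. \<bar>(\<Sum>j<2 ^ k n - 1. c n i j * cell (k n) j x) - \<phi> i x\<bar> \<partial>\<mu>) \<longlonglongrightarrow> 0)"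
proof -
  let ?R = "\<lambda>n k c. 1 \<le> k \<and> (\<forall>i<d. (\<forall>x. \<bar>\<Sum>j<2 ^ k - 1. c i j * cell k j x\<bar> \<le> C) \<and>
    (\<integral>x. \<bar>\<phi> i x - (\<Sum>j<2 ^ k - 1. c i j * cell k j x)\<bar> \<partial>\<nu>) < inverse (real (Suc n)))"
  have "\<exists>k c. ?R n k c" for n
    by (rule simultaneous_step_approximation[OF \<phi>]) simp_all
  from choice[OF allI[OF this]] obtain k where "\<forall>n. \<exists>c. ?R n (k n) c" ..
  from choice[OF this] obtain c where R: "\<forall>n. ?R n (k n) (c n)" ..
  define \<psi> where "\<psi> n i x = (\<Sum>j<2 ^ k n - 1. c n i j * cell (k n) j x)" for n i x
  have k: "1 \<le> k n" for n using R by blast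
  have \<psi>_bound: "\<bar>\<psi> n i x\<bar> \<le> C" if "i < d" for n i x
    using R that by (simp add: \<psi>_def)
  have \<psi>_close: "(\<integral>x. \<bar>\<phi> i x - \<psi> n i x\<bar> \<partial>\<nu>) \<le> inverse (real (Suc n))" if "i < d" for n i
    using R that by (simp add: \<psi>_def less_imp_le)
  have \<psi>_meas: "\<psi> n i \<in> borel_measurable borel" for n i
    unfolding \<psi>_def using cell_borel[OF k] by (intro borel_measurable_sum borel_measurable_times) auto
  define h where "h n \<mu> = (\<Sum>i<d. \<integral>x. \<bar>\<phi> i x - \<psi> n i x\<bar> \<partial>\<mu>)" for n \<mu>
  have diff_meas: "(\<lambda>x. \<bar>\<phi> i x - \<psi> n i x\<bar>) \<in> borel_measurable borel" if "i < d" for n i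
    using \<phi>(1)[OF that] \<psi>_meas[of n i] by simp
  have diff_bound: "\<bar>\<bar>\<phi> i x - \<psi> n i x\<bar>\<bar> \<le> 2 * C" if "i < d" for n i x
    using \<phi>(2)[OF that, of x] \<psi>_bound[OF that, of n x] by linarith
  have h_int: "integrable P (h n)" for n
    unfolding h_def using diff_meas diff_bound by (intro Bochner_Integration.integrable_sum mean_integral(1)) auto
  have h_mean: "(\<integral>\<mu>. norm (h n \<mu>) \<partial>P) \<le> real d * inverse (real (Suc n))" for n
  proof -
    have "h n \<mu> \<ge> 0" for \<mu> unfolding h_def by (intro sum_nonneg) simp
    then have "(\<integral>\<mu>. norm (h n \<mu>) \<partial>P) = (\<integral>\<mu>. h n \<mu> \<partial>P)" by simp
    also have "\<dots> = (\<Sum>i<d. \<integral>\<mu>. (\<integral>x. \<bar>\<phi> i x - \<psi> n i x\<bar> \<partial>\<mu>) \<partial>P)"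
      unfolding h_def using diff_meas diff_bound by (intro Bochner_Integration.integral_sum mean_integral(1)) auto
    also have "\<dots> = (\<Sum>i<d. \<integral>x. \<bar>\<phi> i x - \<psi> n i x\<bar> \<partial>\<nu>)"
      using diff_meas diff_bound by (intro sum.cong refl mean_integral(2)) auto
    also have "\<dots> \<le> (\<Sum>i<d. inverse (real (Suc n)))"
      using \<psi>_close by (intro sum_mono) auto
    finally show ?thesis by simp
  qed
  have "(\<lambda>n. \<integral>\<mu>. norm (h n \<mu>) \<partial>P) \<longlonglongrightarrow> 0"
  proof (rule Lim_null_comparison[OF always_eventually], intro allI)
    show "norm (\<integral>\<mu>. norm (h n \<mu>) \<partial>P) \<le> real d * inverse (real (Suc n))" for n
      using h_mean[of n] by simp
    have "(\<lambda>n. real d * inverse (real (Suc n))) \<longlonglongrightarrow> real d * 0"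
      by (intro tendsto_intros LIMSEQ_inverse_real_of_nat)
    then show "(\<lambda>n. real d * inverse (real (Suc n))) \<longlonglongrightarrow> 0" by simp
  qed
  from tendsto_L1_AE_subseq[OF h_int this] obtain r where AE_h: "AE \<mu> in P. (\<lambda>n. h (r n) \<mu>) \<longlonglongrightarrow> 0" by blast
  have "AE \<mu> in P. \<forall>i<d. (\<lambda>n. \<integral>x. \<bar>\<psi> (r n) i x - \<phi> i x\<bar> \<partial>\<mu>) \<longlonglongrightarrow> 0"
    using AE_h
  proof eventually_elim
    case (elim \<mu>)
    show ?case
    proof (intro allI impI)
      fix i assume "i < d"
      show "(\<lambda>n. \<integral>x. \<bar>\<psi> (r n) i x - \<phi> i x\<bar> \<partial>\<mu>) \<longlonglongrightarrow> 0"
      proof (rule Lim_null_comparison[OF always_eventually elim], intro allI)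
        fix n
        have "(\<integral>x. \<bar>\<phi> i x - \<psi> (r n) i x\<bar> \<partial>\<mu>) \<le> h (r n) \<mu>"
          unfolding h_def using \<open>i < d\<close> by (intro member_le_sum) auto
        then show "norm (\<integral>x. \<bar>\<psi> (r n) i x - \<phi> i x\<bar> \<partial>\<mu>) \<le> h (r n) \<mu>"
          by (simp add: abs_minus_commute)
      qed
    qed
  qed
  moreover have "\<forall>n. \<forall>i<d. \<forall>x. \<bar>\<psi> (r n) i x\<bar> \<le> C" using \<psi>_bound by blast
  moreover have "\<forall>n. 1 \<le> k (r n)" using k by blast
  ultimately show ?thesis
    unfolding \<psi>_def by (intro exI[of _ "\<lambda>n. k (r n)"] exI[of _ "\<lambda>n. c (r n)"] conjI)
qed

lemma smooth_cyl_cases: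
  fixes F :: "'a measure \<Rightarrow> real"
  assumes "(F, DF) \<in> smooth_cyl"
  obtains \<phi> f d C where "F = cyl_fun \<phi> f" "DF = cyl_grad d \<phi> f" "f \<in> C_infinity d" "0 \<le> C"
    "\<And>i. i < d \<Longrightarrow> \<phi> i \<in> borel_measurable borel" "\<And>i x. i < d \<Longrightarrow> \<bar>\<phi> i x\<bar> \<le> C"
proof -
  obtain d \<phi> f where *: "F = cyl_fun \<phi> f" "DF = cyl_grad d \<phi> f" "f \<in> C_infinity d"
    "\<And>i. i < d \<Longrightarrow> \<phi> i \<in> borel_measurable borel" "\<And>i. i < d \<Longrightarrow> bounded (range (\<phi> i))"
    using assms unfolding smooth_cyl_def by blast
  obtain C where "0 \<le> C" "\<And>i x. i < d \<Longrightarrow> \<bar>\<phi> i x\<bar> \<le> C"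
    using common_bound[of d \<phi>] *(5) by blast
  then show ?thesis using that * by blast
qed

lemma smooth_cyl_L2:
  fixes F :: "'a measure \<Rightarrow> real"
  assumes "(F, DF) \<in> smooth_cyl"
  shows "F \<in> L2_space P"
proof -
  obtain \<phi> f d C where "F = cyl_fun \<phi> f" "DF = cyl_grad d \<phi> f" "f \<in> C_infinity d" "0 \<le> C"
    "\<And>i. i < d \<Longrightarrow> \<phi> i \<in> borel_measurable borel" "\<And>i x. i < d \<Longrightarrow> \<bar>\<phi> i x\<bar> \<le> C"
    by (rule smooth_cyl_cases[OF assms], rule that)
  then show ?thesis using cyl_fun_L2[of d \<phi> C f] by simp
qed

lemma smooth_cyl_relaxed_le:
  fixes F :: "'a measure \<Rightarrow> real"
  assumes "(F, DF) \<in> smooth_cyl"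
  shows "relaxed_le P cyl_rel F (energy P DF DF)"
proof -
  obtain \<phi> f d C where F: "F = cyl_fun \<phi> f" and DF: "DF = cyl_grad d \<phi> f" and f: "f \<in> C_infinity d" and C: "0 \<le> C"
    and \<phi>: "\<And>i. i < d \<Longrightarrow> \<phi> i \<in> borel_measurable borel" "\<And>i x. i < d \<Longrightarrow> \<bar>\<phi> i x\<bar> \<le> C"
    by (rule smooth_cyl_cases[OF assms], rule that)
  let ?\<psi> = "\<lambda>k c n i x. \<Sum>j<2 ^ k n - 1. c n i j * cell (k n) j x"
  have "\<exists>k c. (\<forall>n. 1 \<le> k n) \<and> (\<forall>n. \<forall>i<d. \<forall>x. \<bar>?\<psi> k c n i x\<bar> \<le> C) \<and>
      (AE \<mu> in P. \<forall>i<d. (\<lambda>n. \<integral>x. \<bar>?\<psi> k c n i x - \<phi> i x\<bar> \<partial>\<mu>) \<longlonglongrightarrow> 0)"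
    by (rule AE_step_approximation[OF \<phi>])
  then obtain k c where k: "\<forall>n. 1 \<le> k n" and bound: "\<forall>n. \<forall>i<d. \<forall>x. \<bar>?\<psi> k c n i x\<bar> \<le> C"
    and AE: "AE \<mu> in P. \<forall>i<d. (\<lambda>n. \<integral>x. \<bar>?\<psi> k c n i x - \<phi> i x\<bar> \<partial>\<mu>) \<longlonglongrightarrow> 0"
    by (elim exE conjE)
  define \<psi> where "\<psi> n i x = (\<Sum>j<2 ^ k n - 1. c n i j * cell (k n) j x)" for n i x
  have \<psi>: "\<psi> n i \<in> borel_measurable borel" "\<bar>\<psi> n i x\<bar> \<le> C" if "i < d" for n i x
  proof -
    show "\<psi> n i \<in> borel_measurable borel"
      unfolding \<psi>_def using cell_borel k by (intro borel_measurable_sum borel_measurable_times) auto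
    show "\<bar>\<psi> n i x\<bar> \<le> C" using bound that by (simp add: \<psi>_def)
  qed
  let ?E = "\<lambda>\<phi>. energy P (cyl_grad d \<phi> f) (cyl_grad d \<phi> f)"
  have rel: "cyl_rel (cyl_fun (\<psi> n) f) (?E (\<psi> n))" for n
    by (rule step_cyl_rel[OF k[rule_format] f \<psi>_def cyl_fun_L2[OF \<psi> C f]])
  note limits = C f \<phi> \<psi> AE[folded \<psi>_def]
  have dist_lim: "(\<lambda>n. sqdist P (cyl_fun (\<psi> n) f) F) \<longlonglongrightarrow> 0"
    unfolding F by (rule cyl_fun_tendsto[OF limits])
  have energy_lim: "(\<lambda>n. ?E (\<psi> n)) \<longlonglongrightarrow> energy P DF DF"
    unfolding DF by (rule energy_cyl_grad_tendsto[OF limits])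
  show ?thesis
    unfolding relaxed_le_def
  proof (intro allI impI)
    fix \<epsilon> :: real assume "0 < \<epsilon>"
    have "eventually (\<lambda>n. sqdist P (cyl_fun (\<psi> n) f) F < \<epsilon>) sequentially"
      using dist_lim \<open>0 < \<epsilon>\<close> by (rule order_tendstoD(2))
    moreover have "eventually (\<lambda>n. ?E (\<psi> n) < energy P DF DF + \<epsilon>) sequentially"
      using \<open>0 < \<epsilon>\<close> by (intro order_tendstoD(2)[OF energy_lim]) simp
    ultimately have "eventually (\<lambda>n. sqdist P (cyl_fun (\<psi> n) f) F < \<epsilon> \<and> ?E (\<psi> n) < energy P DF DF + \<epsilon>) sequentially"
      by (rule eventually_conj)
    from eventually_happens'[OF sequentially_bot this]
    obtain n where n: "sqdist P (cyl_fun (\<psi> n) f) F < \<epsilon> \<and> ?E (\<psi> n) < energy P DF DF + \<epsilon>" ..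
    show "\<exists>G a. cyl_rel G a \<and> sqdist P G F < \<epsilon> \<and> a < energy P DF DF + \<epsilon>"
      by (rule exI[of _ "cyl_fun (\<psi> n) f"], rule exI[of _ "?E (\<psi> n)"], intro conjI rel conjunct1[OF n] conjunct2[OF n])
  qed
qed

lemma relaxed_minorant: "minorant P (relaxed_dom P cyl_rel) (polarization (relaxed P cyl_rel))"
  unfolding minorant_def
proof clarify
  fix F :: "'a measure \<Rightarrow> real" and DF assume FDF: "(F, DF) \<in> smooth_cyl"
  note le = smooth_cyl_relaxed_le[OF FDF]
  have dom: "F \<in> relaxed_dom P cyl_rel" by (rule cyl.relaxed_domI[OF smooth_cyl_L2[OF FDF] le])
  then show "F \<in> relaxed_dom P cyl_rel \<and> polarization (relaxed P cyl_rel) F F \<le> energy P DF DF"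
    using cyl.relaxed_least[OF le] by (simp add: cyl.relaxed_polarization_diag)
qed

lemma relaxation_le_proj_form:
  assumes rel: "is_relaxation P D Q" and k: "1 \<le> k" and u: "u \<in> L2_space P"
  shows "extended_form D Q u \<le> proj_form P B k u"
  unfolding proj_form_def
proof (rule Inf_greatest, clarify)
  fix G DG assume G: "(G, DG) \<in> proj_cyl B k" and ae: "AE \<mu> in P. G \<mu> = u \<mu>"
  have form: "symmetric_form P D Q" and "minorant P D Q" using rel by (auto simp: is_relaxation_def)
  then have GD: "G \<in> D" and le: "Q G G \<le> energy P DG DG"
    using proj_cyl_smooth[OF k G] unfolding minorant_def by auto
  note form' = form[unfolded symmetric_form_def]
  have "u \<in> D \<and> (\<forall>H\<in>D. Q G H = Q u H)"
    using form' GD L2_measurable[OF u] ae by blast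
  moreover have "Q u G = Q G u" if "u \<in> D" using form' GD that by blast
  ultimately have "u \<in> D" "Q u u = Q G G" using GD by auto
  then show "extended_form D Q u \<le> ereal (energy P DG DG)"
    using le by (simp add: extended_form_def)
qed

text \<open>
Functions \<open>G n\<close> with energies nearly \<open>c\<close> that converge to \<open>F\<close> lie in the domains of certain generations. As the domains
grow, it is enough to repeat each of them until the generation is large enough for the next one.
\<close>

lemma recovery_sequence:
  assumes F: "F \<in> L2_space P" and le: "relaxed_le P cyl_rel F c"
  obtains u where "\<And>k. u k \<in> L2_space P" "L2_converges P u F" "limsup (\<lambda>k. proj_form P B k (u k)) \<le> ereal c"
proof -
  let ?R = "\<lambda>n G a k. 1 \<le> k \<and> proj_rel k G a \<and> sqdist P G F < inverse (real (Suc n)) \<and> a < c + inverse (real (Suc n))"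
  have "\<exists>G a k. ?R n G a k" for n
  proof -
    have "0 < inverse (real (Suc n))" by simp
    with le obtain G a where "cyl_rel G a" "sqdist P G F < inverse (real (Suc n))" "a < c + inverse (real (Suc n))"
      unfolding relaxed_le_def by blast
    moreover from this(1) obtain k where "1 \<le> k" "proj_rel k G a" unfolding cyl_rel_def by blast
    ultimately show ?thesis by (intro exI[of _ G] exI[of _ a] exI[of _ k] conjI)
  qed
  from choice[OF allI[OF this]] obtain G where "\<forall>n. \<exists>a k. ?R n (G n) a k" ..
  from choice[OF this] obtain a where "\<forall>n. \<exists>k. ?R n (G n) (a n) k" ..
  from choice[OF this] obtain l where R: "\<forall>n. ?R n (G n) (a n) (l n)" ..
  have l: "1 \<le> l n" and G: "proj_rel (l n) (G n) (a n)"
    and close: "sqdist P (G n) F < inverse (real (Suc n))" and a: "a n < c + inverse (real (Suc n))" for n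
    using R by simp_all
  \<comment> \<open>A nondecreasing sequence of generations that dominates \<open>l\<close>; it exceeds \<open>n\<close>, so \<open>N k\<close> is a maximum over a finite set.\<close>
  define K where "K n = (\<Sum>m\<le>n. l m)" for n
  have K_ge: "n < K n" for n
  proof -
    have "(\<Sum>m\<le>n. 1) \<le> K n" unfolding K_def using l by (intro sum_mono) auto
    then show ?thesis by simp
  qed
  have K_rel: "proj_rel k (G n) (a n)" if "K n \<le> k" for n k
  proof (rule proj_rel_mono[OF l G])
    have "l n \<le> K n" unfolding K_def by (rule member_le_sum) auto
    then show "l n \<le> k" using that by simp
  qed
  define N where "N k = Max {n. K n \<le> k}" for k
  have fin: "finite {n. K n \<le> k}" for k
  proof (rule finite_subset[of _ "{..k}"])
    show "{n. K n \<le> k} \<subseteq> {..k}"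
    proof
      fix n assume "n \<in> {n. K n \<le> k}"
      then show "n \<in> {..k}" using K_ge[of n] by simp
    qed
  qed simp
  have N: "m \<le> N k" "K (N k) \<le> k" if "K m \<le> k" for m k
  proof -
    show "m \<le> N k" unfolding N_def using that by (intro Max_ge fin) simp
    have "N k \<in> {n. K n \<le> k}" unfolding N_def using that by (intro Max_in fin) auto
    then show "K (N k) \<le> k" by simp
  qed
  define u where "u k = (if K 0 \<le> k then G (N k) else F)" for k
  have u_rel: "proj_rel k (u k) (a (N k))" if "K 0 \<le> k" for k
    using K_rel[OF N(2)[OF that]] that by (simp add: u_def)
  have inverse_N: "inverse (real (Suc (N k))) \<le> inverse (real (Suc m))" if "K m \<le> k" for m k
    using N(1)[OF that] by (intro le_imp_inverse_le) auto
  have K0: "K 0 \<le> k" if "K m \<le> k" for m k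
    using sum_mono2[of "{..m}" "{..0}" l] that by (simp add: K_def)
  show ?thesis
  proof (rule that)
    show "u k \<in> L2_space P" for k
      using u_rel[of k] F by (cases "K 0 \<le> k") (auto simp: proj_rel_def u_def)
    show "L2_converges P u F"
      unfolding L2_converges_iff_sqdist
    proof (rule LIMSEQ_I)
      fix e :: real assume "0 < e"
      then obtain m where m: "inverse (real (Suc m)) < e" using reals_Archimedean by blast
      have "norm (sqdist P (u k) F - 0) < e" if "K m \<le> k" for k
      proof -
        have "sqdist P (u k) F < inverse (real (Suc (N k)))"
          using close[of "N k"] K0[OF that] by (simp add: u_def)
        then have "sqdist P (u k) F < e" using inverse_N[OF that] m by linarith
        then show ?thesis using sqdist_nonneg[of P "u k" F] by simp
      qed
      then show "\<exists>no. \<forall>k\<ge>no. norm (sqdist P (u k) F - 0) < e" by blast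
    qed
    show "limsup (\<lambda>k. proj_form P B k (u k)) \<le> ereal c"
    proof (rule ereal_le_epsilon2)
      fix e :: real assume "0 < e"
      then obtain m where m: "inverse (real (Suc m)) < e" using reals_Archimedean by blast
      have "proj_form P B k (u k) \<le> ereal c + ereal e" if "K m \<le> k" for k
      proof -
        have "proj_form P B k (u k) \<le> ereal (a (N k))"
          unfolding proj_form_def using u_rel[OF K0[OF that]] unfolding proj_rel_def
          by (intro Inf_lower) blast
        also have "a (N k) \<le> c + e" using a[of "N k"] inverse_N[OF that] m by linarith
        finally show ?thesis by simp
      qed
      then show "limsup (\<lambda>k. proj_form P B k (u k)) \<le> ereal c + ereal e"
        by (intro Limsup_bounded) (auto simp: eventually_sequentially)
    qed
  qed
qed

theorem relaxation_mosco_limit: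
  assumes rel: "is_relaxation P D Q"
  shows "mosco_converges P (proj_form P B) (extended_form D Q)"
  unfolding mosco_converges_def
proof (intro conjI allI impI ballI)
  have form: "symmetric_form P D Q" and lsc: "lower_semicontinuous_form P D Q"
    using rel by (auto simp: is_relaxation_def)
  {
    fix u F assume u: "\<forall>k. u k \<in> L2_space P" and F: "F \<in> L2_space P" and weak: "L2_converges_weakly P u F"
    have "extended_form D Q F \<le> liminf (\<lambda>k. extended_form D Q (u k))"
      using u by (intro weakly_lower_semicontinuous[OF form lsc _ F weak]) auto
    also have "\<dots> \<le> liminf (\<lambda>k. proj_form P B k (u k))"
    proof (rule Liminf_mono)
      show "\<forall>\<^sub>F k in sequentially. extended_form D Q (u k) \<le> proj_form P B k (u k)"
        using eventually_ge_at_top[of 1] by eventually_elim (use u relaxation_le_proj_form[OF rel] in auto)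
    qed
    finally show "extended_form D Q F \<le> liminf (\<lambda>k. proj_form P B k (u k))" .
  }
  fix F assume F: "F \<in> L2_space P"
  show "\<exists>u. (\<forall>k. u k \<in> L2_space P) \<and> L2_converges P u F \<and>
      limsup (\<lambda>k. proj_form P B k (u k)) \<le> extended_form D Q F"
  proof (cases "F \<in> D")
    case False
    then show ?thesis
      using F by (intro exI[of _ "\<lambda>k. F"]) (simp add: extended_form_def L2_converges_iff_sqdist)
  next
    case True
    have "D \<subseteq> relaxed_dom P cyl_rel \<and> (\<forall>F\<in>D. polarization (relaxed P cyl_rel) F F \<le> Q F F)"
      using rel cyl.relaxed_symmetric_form cyl.relaxed_lower_semicontinuous relaxed_minorant
      unfolding is_relaxation_def by blast
    with True have dom: "F \<in> relaxed_dom P cyl_rel" and "polarization (relaxed P cyl_rel) F F \<le> Q F F"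
      by auto
    then have "relaxed P cyl_rel F \<le> Q F F" by (simp add: cyl.relaxed_polarization_diag)
    then have "relaxed_le P cyl_rel F (Q F F)"
      by (rule cyl.relaxed_le_mono[OF cyl.relaxed_le_relaxed[OF dom]])
    then show ?thesis
    proof (rule recovery_sequence[OF F])
      fix u assume "\<And>k. u k \<in> L2_space P" "L2_converges P u F" "limsup (\<lambda>k. proj_form P B k (u k)) \<le> ereal (Q F F)"
      then show ?thesis using True by (intro exI[of _ u]) (simp add: extended_form_def)
    qed
  qed
qed

end

lemma mean_random_probability_dirichlet_process:
  fixes \<nu> :: "'a::topological_space measure"
  assumes "0 \<le> \<alpha>" "\<alpha> < 1" "- \<alpha> < \<theta>"
    and "prob_space \<nu>" "sets \<nu> = sets borel" "dyadic_partitions \<nu> B"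
    and "\<And>A. A \<in> sets borel \<Longrightarrow> \<exists>A' \<in> sigma_sets UNIV {B k j | k j. 1 \<le> k \<and> j \<in> {1..2 ^ k}}.
        emeasure \<nu> ((A - A') \<union> (A' - A)) = 0"
  shows "mean_random_probability (dirichlet_process \<alpha> \<theta> \<nu>) \<nu> B"
  unfolding mean_random_probability_def random_probability_def random_probability_axioms_def
    generating_partitions_def mean_random_probability_axioms_def
  using assms by (intro conjI prob_space_dirichlet_process sets_dirichlet_process mean_dirichlet_process allI impI) auto

theorem corollary3p3:
  fixes \<alpha> \<theta> :: real
    and \<nu> :: "'a::metric_space measure"
    and B :: "nat \<Rightarrow> nat \<Rightarrow> 'a set"
    and D :: "('a measure \<Rightarrow> real) set"
    and \<Xi> :: "('a measure \<Rightarrow> real) \<Rightarrow> ('a measure \<Rightarrow> real) \<Rightarrow> real"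
  assumes "\<alpha> = 1 / 2" and "\<theta> > - 1 / 2"
    and "locally_compact_space (euclidean :: 'a topology)"
    and "separable_space (euclidean :: 'a topology)"
    and "prob_space \<nu>" and "sets \<nu> = sets borel"
    and diffuse: "\<And>x. emeasure \<nu> {x} = 0"
    and "dyadic_partitions \<nu> B"
    and generating: "\<And>A. A \<in> sets borel \<Longrightarrow>
      \<exists>A' \<in> sigma_sets UNIV {B k j | k j. 1 \<le> k \<and> j \<in> {1..2 ^ k}}.
        emeasure \<nu> ((A - A') \<union> (A' - A)) = 0"
    and "is_relaxation (dirichlet_process \<alpha> \<theta> \<nu>) D \<Xi>"
  shows "mosco_converges (dirichlet_process \<alpha> \<theta> \<nu>)
    (proj_form (dirichlet_process \<alpha> \<theta> \<nu>) B) (extended_form D \<Xi>)"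
proof -
  interpret mean_random_probability "dirichlet_process \<alpha> \<theta> \<nu>" \<nu> B
    using assms(1,2) by (intro mean_random_probability_dirichlet_process generating assms) simp_all
  show ?thesis
    by (rule relaxation_mosco_limit) fact
qed

end
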